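(* Let $q>2$ be a power of $2$ and let $k$ be a positive integer with $(q,k)\neq(4,1)$. If the group $L_2(q)^k$ (the direct product of $k$ copies of $L_2(q)$) can be generated by two elements, then $L_2(q)^k$ is a purely strongly real Beauville group.
   Context: $L_2(q)=\mathrm{PSL}_2(q)$ denotes the projective special linear group of degree $2$ over the field with $q$ elements. Conjugation convention: $g^h=hgh^{-1}$. For a finite group $G$ with identity $e$ and $x,y\in G$, let \[ \Sigma(x,y):=\bigcup_{i=1}^{|G|}\bigcup_{g\in G}\{(x^i)^g,(y^i)^g,((xy)^i)^g\}. \] A Beauville structure for a finite group $G$ is a set of pairs $\{(x_1,y_1),(x_2,y_2)\}\subset G\times G$ such that $\langle x_1,y_1\rangle=\langle x_2,y_2\rangle=G$ and $\Sigma(x_1,y_1)\cap\Sigma(x_2,y_2)=\{e\}$. The group $G$ is a Beauville group if it has a Beauville structure. A Beauville structure $\{(x_1,y_1),(x_2,y_2)\}$ of $G$ is strongly real if there exist an automorphism $\phi\in\mathrm{Aut}(G)$ and elements $g_1,g_2\in G$ such that $g_i\phi(x_i)g_i^{-1}=x_i^{-1}$ and $g_i\phi(y_i)g_i^{-1}=y_i^{-1}$ for $i=1,2$. A finite group $G$ is a purely strongly real Beauville group if $G$ is a Beauville group and every Beauville structure of $G$ is strongly real. *)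

theory Defs
  imports "HOL-Analysis.Determinants" "HOL-Algebra.Product_Groups" "HOL-Algebra.Bij"
begin

section \<open>The groups \<open>L\<^sub>2(q)\<close> and their direct powers\<close>

definition SL2 :: "('f::field ^ 2 ^ 2) monoid" where
  "SL2 = \<lparr>carrier = {A. det A = 1}, monoid.mult = (**), one = mat 1\<rparr>"

definition group_center :: "('a, 'b) monoid_scheme \<Rightarrow> 'a set" where
  "group_center G = {z \<in> carrier G. \<forall>g \<in> carrier G. z \<otimes>\<^bsub>G\<^esub> g = g \<otimes>\<^bsub>G\<^esub> z}"

text \<open>The order of the field is carried by its type: \<open>L\<^sub>2(q)\<close> is \<open>PSL2\<close> over a field type of
  cardinality \<open>q\<close>.\<close>

definition PSL2 :: "('f::field ^ 2 ^ 2) set monoid" where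
  "PSL2 = SL2 Mod group_center SL2"

definition direct_power :: "('a, 'b) monoid_scheme \<Rightarrow> nat \<Rightarrow> (nat \<Rightarrow> 'a) monoid" where
  "direct_power G k = product_group {..<k} (\<lambda>_. G)"

lemma group_SL2: "group (SL2 :: ('f::field ^ 2 ^ 2) monoid)"
proof (rule groupI)
  fix A :: "'f ^ 2 ^ 2" assume "A \<in> carrier SL2"
  then have d: "det A = 1" by (simp add: SL2_def)
  then have "invertible A" by (simp add: invertible_det_nz)
  then obtain B where B: "A ** B = mat 1" "B ** A = mat 1"
    unfolding invertible_def by blast
  have "det B * det A = 1" by (metis B(2) det_mul det_I)
  with d have "det B = 1" by simp
  with B show "\<exists>B\<in>carrier SL2. B \<otimes>\<^bsub>SL2\<^esub> A = \<one>\<^bsub>SL2\<^esub>"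
    by (auto simp: SL2_def)
qed (simp_all add: SL2_def det_mul matrix_mul_assoc)

lemma (in group) normal_group_center: "group_center G \<lhd> G"
proof (rule normal_invI)
  show "subgroup (group_center G) G"
  proof (rule subgroupI)
    show "group_center G \<subseteq> carrier G" "group_center G \<noteq> {}"
      by (auto simp: group_center_def intro!: exI[of _ "\<one>"])
  next
    fix a assume a: "a \<in> group_center G"
    then have ac: "a \<in> carrier G" by (simp add: group_center_def)
    have "inv a \<otimes> g = g \<otimes> inv a" if g: "g \<in> carrier G" for g
    proof -
      have "g = a \<otimes> (g \<otimes> inv a)"
        using a g ac by (simp add: group_center_def m_assoc[symmetric]) (simp add: m_assoc)
      then show ?thesis
        using ac g inv_solve_left[of "g \<otimes> inv a" a g] by simp
    qed
    with ac show "inv a \<in> group_center G" by (simp add: group_center_def)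
  next
    fix a b assume a: "a \<in> group_center G" and b: "b \<in> group_center G"
    have "a \<otimes> b \<otimes> g = g \<otimes> (a \<otimes> b)" if g: "g \<in> carrier G" for g
    proof -
      have c: "a \<in> carrier G" "b \<in> carrier G" and ag: "a \<otimes> g = g \<otimes> a" and bg: "b \<otimes> g = g \<otimes> b"
        using a b g by (simp_all add: group_center_def)
      have "a \<otimes> b \<otimes> g = a \<otimes> (b \<otimes> g)" using c g by (rule m_assoc)
      also have "\<dots> = a \<otimes> g \<otimes> b" unfolding bg using c g by (simp add: m_assoc)
      also have "\<dots> = g \<otimes> (a \<otimes> b)" unfolding ag using c g by (simp add: m_assoc)
      finally show ?thesis .
    qed
    moreover have "a \<otimes> b \<in> carrier G" using a b unfolding group_center_def by blast
    ultimately show "a \<otimes> b \<in> group_center G" unfolding group_center_def by blast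
  qed
next
  fix x h assume x: "x \<in> carrier G" and h: "h \<in> group_center G"
  then have hc: "h \<in> carrier G" and "x \<otimes> h = h \<otimes> x"
    by (simp_all add: group_center_def)
  with x have "x \<otimes> h \<otimes> inv x = h" by (simp add: m_assoc)
  with h show "x \<otimes> h \<otimes> inv x \<in> group_center G" by simp
qed

lemma group_PSL2: "group (PSL2 :: ('f::field ^ 2 ^ 2) set monoid)"
  unfolding PSL2_def
  by (rule normal.factorgroup_is_group[OF group.normal_group_center[OF group_SL2]])

lemma group_direct_power: "group G \<Longrightarrow> group (direct_power G k)"
  by (simp add: direct_power_def)


section \<open>Beauville structures\<close>

definition generating_pair :: "('a, 'b) monoid_scheme \<Rightarrow> 'a \<Rightarrow> 'a \<Rightarrow> bool" where
  "generating_pair G x y \<longleftrightarrow>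
     x \<in> carrier G \<and> y \<in> carrier G \<and> generate G {x, y} = carrier G"

text \<open>Conjugation convention: \<open>g\<^sup>h = h g h\<^sup>-\<^sup>1\<close>.\<close>

definition conj_by :: "('a, 'b) monoid_scheme \<Rightarrow> 'a \<Rightarrow> 'a \<Rightarrow> 'a" where
  "conj_by G g h = h \<otimes>\<^bsub>G\<^esub> g \<otimes>\<^bsub>G\<^esub> inv\<^bsub>G\<^esub> h"

definition Beauville_Sigma :: "('a, 'b) monoid_scheme \<Rightarrow> 'a \<Rightarrow> 'a \<Rightarrow> 'a set" where
  "Beauville_Sigma G x y =
     (\<Union>i\<in>{1..order G}. \<Union>g\<in>carrier G.
        {conj_by G (x [^]\<^bsub>G\<^esub> i) g, conj_by G (y [^]\<^bsub>G\<^esub> i) g,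
         conj_by G ((x \<otimes>\<^bsub>G\<^esub> y) [^]\<^bsub>G\<^esub> i) g})"

definition Beauville_structure :: "('a, 'b) monoid_scheme \<Rightarrow> ('a \<times> 'a) set \<Rightarrow> bool" where
  "Beauville_structure G S \<longleftrightarrow>
     (\<exists>x\<^sub>1 y\<^sub>1 x\<^sub>2 y\<^sub>2. S = {(x\<^sub>1, y\<^sub>1), (x\<^sub>2, y\<^sub>2)} \<and>
        generating_pair G x\<^sub>1 y\<^sub>1 \<and> generating_pair G x\<^sub>2 y\<^sub>2 \<and>
        Beauville_Sigma G x\<^sub>1 y\<^sub>1 \<inter> Beauville_Sigma G x\<^sub>2 y\<^sub>2 = {\<one>\<^bsub>G\<^esub>})"

definition Beauville_group :: "('a, 'b) monoid_scheme \<Rightarrow> bool" where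
  "Beauville_group G \<longleftrightarrow>
     group G \<and> finite (carrier G) \<and> (\<exists>S. Beauville_structure G S)"

text \<open>One automorphism serves both pairs, while the conjugating element may depend on the pair.\<close>

definition strongly_real :: "('a, 'b) monoid_scheme \<Rightarrow> ('a \<times> 'a) set \<Rightarrow> bool" where
  "strongly_real G S \<longleftrightarrow>
     (\<exists>\<phi>\<in>auto G. \<forall>(x, y)\<in>S. \<exists>g\<in>carrier G.
        conj_by G (\<phi> x) g = inv\<^bsub>G\<^esub> x \<and> conj_by G (\<phi> y) g = inv\<^bsub>G\<^esub> y)"

definition purely_strongly_real_Beauville_group :: "('a, 'b) monoid_scheme \<Rightarrow> bool" where
  "purely_strongly_real_Beauville_group G \<longleftrightarrow>
     Beauville_group G \<and> (\<forall>S. Beauville_structure G S \<longrightarrow> strongly_real G S)"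

end

theory Submission
  imports Defs "HOL-Algebra.SimpleGroups" "HOL-Number_Theory.Residues"
begin

text \<open>Let \<open>G = SL\<^sub>2(q)\<close>, which is \<open>L\<^sub>2(q)\<close> for even \<open>q\<close>. If \<open>A\<close> and \<open>B\<close> generate \<open>G\<close>, then
  \<open>A B + B A\<close>, scaled to determinant one, inverts both by conjugation. The components of a generating pair
  of \<open>G\<^sup>k\<close> generate \<open>G\<close>, so the identity automorphism makes every Beauville structure of \<open>G\<^sup>k\<close> strongly real.

  For the existence of a Beauville structure, pairs generate \<open>G\<^sup>k\<close> as soon as their components generate \<open>G\<close>
  and are pairwise inequivalent under automorphisms. The exponent of \<open>G\<close> divides \<open>2 (q - 1) (q + 1)\<close>, a product
  of three coprime factors. The first few components of the two pairs are chosen such that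
  \<open>x\<close>, \<open>y\<close> and \<open>x y\<close> have orders in \<open>{2, q - 1, q + 1}\<close>, in such a way that the sets of components where these orders
  occur distinguish the elements of the first pair from those of the second one. The other components come from the
  generating pair of \<open>G\<^sup>k\<close> that exists by assumption, omitting those equivalent to a chosen one. The
  pairs with prescribed orders are found by prescribing the traces of \<open>x\<close>, \<open>y\<close> and \<open>x y\<close>.\<close>

section \<open>Conjugation and generating pairs\<close>

text \<open>A common element \<open>z\<close> of the two Sigma sets is handled one coprime factor
  \<open>t\<close> at a time, \<open>t\<close> being \<open>2\<close>, \<open>q - 1\<close> or
  \<open>q + 1\<close>. Suppose that one of the two elements has order exactly \<open>t\<close> in
  some component where the other has order prime to \<open>t\<close>. Then \<open>z\<close>,
  conjugate to powers of both, has trivial \<open>t\<close>-part there. This forces \<open>t\<close>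
  to divide the exponent of the first power, so the \<open>t\<close>-part of \<open>z\<close>
  vanishes in all components, also in those whose orders are unknown. Hence four prescribed
  components suffice for all larger \<open>k\<close>. Generation is shown without the classification
  of subgroups of \<open>L\<^sub>2(q)\<close>. A subgroup that contains a full split torus and an
  element outside its normalizer and outside the two Borel subgroups around it is the whole group.
  Of all prescribed order triples only \<open>q + 1, q + 1, q + 1\<close> has no entry
  \<open>q - 1\<close>; there the split torus must first be produced, by computing in the field with
  \<open>q * q\<close> elements.\<close>

context group
begin

lemma conj_by_closed [simp]: "\<lbrakk>x \<in> carrier G; g \<in> carrier G\<rbrakk> \<Longrightarrow> conj_by G x g \<in> carrier G"
  by (simp add: conj_by_def)

lemma conj_by_mult:
  "\<lbrakk>x \<in> carrier G; y \<in> carrier G; g \<in> carrier G\<rbrakk>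
    \<Longrightarrow> conj_by G (x \<otimes> y) g = conj_by G x g \<otimes> conj_by G y g"
  by (simp add: conj_by_def m_assoc inv_solve_left)

lemma conj_by_one [simp]: "g \<in> carrier G \<Longrightarrow> conj_by G \<one> g = \<one>"
  by (simp add: conj_by_def)

lemma conj_by_pow:
  "\<lbrakk>x \<in> carrier G; g \<in> carrier G\<rbrakk> \<Longrightarrow> conj_by G (x [^] (n::nat)) g = conj_by G x g [^] n"
  by (induction n) (simp_all add: conj_by_mult)

lemma conj_by_conj_by:
  "\<lbrakk>x \<in> carrier G; g \<in> carrier G; h \<in> carrier G\<rbrakk>
    \<Longrightarrow> conj_by G (conj_by G x g) h = conj_by G x (h \<otimes> g)"
  by (simp add: conj_by_def m_assoc inv_mult_group)

lemma conj_by_inverse: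
  "\<lbrakk>x \<in> carrier G; g \<in> carrier G\<rbrakk> \<Longrightarrow> conj_by G (conj_by G x g) (inv g) = x"
  by (subst conj_by_conj_by) (simp_all add: conj_by_def)

lemma eq_conj_byI:
  assumes "x \<in> carrier G" "y \<in> carrier G" "g \<in> carrier G" "x \<otimes> g = g \<otimes> y"
  shows "x = conj_by G y g"
proof -
  have "g \<otimes> y \<otimes> inv g = x \<otimes> g \<otimes> inv g" using assms(4) by simp
  also have "\<dots> = x" using assms(1-3) by (simp add: m_assoc)
  finally show ?thesis by (simp add: conj_by_def)
qed

lemma conj_by_eq_one_iff:
  "\<lbrakk>x \<in> carrier G; g \<in> carrier G\<rbrakk> \<Longrightarrow> conj_by G x g = \<one> \<longleftrightarrow> x = \<one>"
  by (metis conj_by_inverse conj_by_one inv_closed)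

lemma ord_unique_iff:
  assumes "x \<in> carrier G" "\<And>n::nat. x [^] n = \<one> \<longleftrightarrow> d dvd n"
  shows "ord x = d"
  using assms by (meson dvd_antisym dvd_refl pow_eq_id)

lemma ord_conj_by:
  "\<lbrakk>x \<in> carrier G; g \<in> carrier G\<rbrakk> \<Longrightarrow> ord (conj_by G x g) = ord x"
  by (rule ord_unique_iff) (simp_all add: conj_by_pow[symmetric] conj_by_eq_one_iff pow_eq_id)

lemma ord_generator:
  assumes "finite (carrier G)" "a \<in> carrier G" "carrier G = {a [^] i | i::nat. True}"
  shows "ord a = order G"
proof -
  have "generate G {a} = carrier G"
    using generate_pow_on_finite_carrier[OF assms(1,2)] assms(3) by auto
  then show ?thesis using generate_pow_card[OF assms(2)] by (simp add: order_def)
qed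

lemma subgroup_centralizer:
  assumes "S \<subseteq> carrier G"
  shows "subgroup {z \<in> carrier G. \<forall>s\<in>S. z \<otimes> s = s \<otimes> z} G" (is "subgroup ?Z G")
proof (rule subgroupI)
  show "?Z \<subseteq> carrier G" "?Z \<noteq> {}" using assms by (auto intro!: exI[of _ \<one>])
next
  fix a assume a: "a \<in> ?Z"
  have "inv a \<otimes> s = s \<otimes> inv a" if s: "s \<in> S" for s
  proof -
    have c: "a \<in> carrier G" "s \<in> carrier G" and as: "a \<otimes> s = s \<otimes> a"
      using a s assms by auto
    have "a \<otimes> (s \<otimes> inv a) = (s \<otimes> a) \<otimes> inv a" using c by (simp add: m_assoc flip: as)
    also have "\<dots> = s" using c by (simp add: m_assoc)
    finally have "s = a \<otimes> (s \<otimes> inv a)" by simp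
    then show ?thesis
      using a s assms inv_solve_left[of "s \<otimes> inv a" a s] by auto
  qed
  then show "inv a \<in> ?Z" using a by simp
next
  fix a b assume a: "a \<in> ?Z" and b: "b \<in> ?Z"
  have "a \<otimes> b \<otimes> s = s \<otimes> (a \<otimes> b)" if s: "s \<in> S" for s
  proof -
    have c: "a \<in> carrier G" "b \<in> carrier G" "s \<in> carrier G" and "a \<otimes> s = s \<otimes> a" "b \<otimes> s = s \<otimes> b"
      using a b s assms by auto
    then show ?thesis by (metis m_assoc)
  qed
  then show "a \<otimes> b \<in> ?Z" using a b by simp
qed

text \<open>Two passes through centralizers: that of \<open>{x, y}\<close> contains the generators,
  hence is everything; so \<open>x\<close> and \<open>y\<close> are central, and the centralizer of
  the whole group is everything too.\<close>

lemma generating_pair_comm: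
  assumes gen: "generating_pair G x y" and comm: "x \<otimes> y = y \<otimes> x"
    and a: "a \<in> carrier G" and b: "b \<in> carrier G"
  shows "a \<otimes> b = b \<otimes> a"
proof -
  have xy: "x \<in> carrier G" "y \<in> carrier G" "generate G {x, y} = carrier G"
    using gen by (auto simp: generating_pair_def)
  have *: "{x, y} \<subseteq> {z \<in> carrier G. \<forall>s\<in>{x, y}. z \<otimes> s = s \<otimes> z}"
    using xy comm by auto
  then have "carrier G \<subseteq> {z \<in> carrier G. \<forall>s\<in>{x, y}. z \<otimes> s = s \<otimes> z}"
    using generate_subgroup_incl[OF * subgroup_centralizer] xy by simp
  then have "{x, y} \<subseteq> {z \<in> carrier G. \<forall>s\<in>carrier G. z \<otimes> s = s \<otimes> z}"
    using xy by auto
  then have "carrier G \<subseteq> {z \<in> carrier G. \<forall>s\<in>carrier G. z \<otimes> s = s \<otimes> z}"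
    using generate_subgroup_incl[OF _ subgroup_centralizer] xy by blast
  with a b show ?thesis by blast
qed

lemma conj_by_inv: "\<lbrakk>x \<in> carrier G; g \<in> carrier G\<rbrakk> \<Longrightarrow> conj_by G (inv x) g = inv (conj_by G x g)"
  by (simp add: conj_by_def inv_mult_group m_assoc)

lemma subgroup_conj_vimage:
  assumes "subgroup H G" "g \<in> carrier G"
  shows "subgroup {x \<in> carrier G. conj_by G x g \<in> H} G"
proof (rule subgroupI)
  interpret H: subgroup H G by (rule assms)
  show "{x \<in> carrier G. conj_by G x g \<in> H} \<noteq> {}" using assms(2) by (auto intro!: exI[of _ \<one>])
  show "a \<otimes> b \<in> {x \<in> carrier G. conj_by G x g \<in> H}"
    if "a \<in> {x \<in> carrier G. conj_by G x g \<in> H}" "b \<in> {x \<in> carrier G. conj_by G x g \<in> H}" for a b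
    using that assms(2) by (simp add: conj_by_mult)
  show "inv a \<in> {x \<in> carrier G. conj_by G x g \<in> H}" if "a \<in> {x \<in> carrier G. conj_by G x g \<in> H}" for a
    using that assms(2) by (simp add: conj_by_inv)
qed auto

lemma subgroup_nat_pow_closed:
  "\<lbrakk>subgroup H G; x \<in> H\<rbrakk> \<Longrightarrow> x [^] (n::nat) \<in> H"
  by (induction n) (simp_all add: subgroup.one_closed subgroup.m_closed)

lemma generating_pair_swap: "generating_pair G x y \<Longrightarrow> generating_pair G y x"
  by (simp add: generating_pair_def insert_commute)

text \<open>The product of \<open>x \<otimes> y\<close> and \<open>inv y\<close> is
  \<open>x\<close>, so this permutes the triple \<open>x\<close>, \<open>y\<close>,
  \<open>x \<otimes> y\<close> up to an inverse; one generating pair thereby serves several type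
  lists.\<close>

lemma generating_pair_mult_inv:
  assumes "generating_pair G x y"
  shows "generating_pair G (x \<otimes> y) (inv y)"
proof -
  have xy: "x \<in> carrier G" "y \<in> carrier G" "generate G {x, y} = carrier G"
    using assms by (auto simp: generating_pair_def)
  let ?H = "generate G {x \<otimes> y, inv y}"
  have H: "subgroup ?H G" using xy by (intro generate_is_subgroup) auto
  have in_H: "x \<otimes> y \<in> ?H" "inv y \<in> ?H" by (auto intro: generate.incl)
  then have "(x \<otimes> y) \<otimes> inv y \<in> ?H" "inv (inv y) \<in> ?H"
    by (simp_all add: subgroup.m_closed[OF H] subgroup.m_inv_closed[OF H])
  then have "{x, y} \<subseteq> ?H" using xy by (simp add: m_assoc)
  then have "carrier G \<subseteq> ?H" using generate_subgroup_incl[OF _ H] xy by metis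
  then show ?thesis using xy subgroup.subset[OF H] by (auto simp: generating_pair_def)
qed

end

section \<open>Generating pairs of powers of a simple group\<close>

text \<open>The orbit relation of the automorphism group on pairs. Hall's criterion for powers of a
  simple group is phrased with it: generating pairs of the power are tuples of generating pairs from
  distinct orbits.\<close>

definition linked :: "('a, 'b) monoid_scheme \<Rightarrow> 'a \<Rightarrow> 'a \<Rightarrow> 'a \<Rightarrow> 'a \<Rightarrow> bool" where
  "linked G x y x' y' \<longleftrightarrow> (\<exists>\<phi>\<in>iso G G. \<phi> x = x' \<and> \<phi> y = y')"

locale finite_nonabelian_simple_group = simple_group +
  assumes finite_carrier [simp]: "finite (carrier G)"
    and nonabelian: "\<exists>a\<in>carrier G. \<exists>b\<in>carrier G. a \<otimes> b \<noteq> b \<otimes> a"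
begin

lemma linked_sym:
  assumes "linked G x y x' y'" "x \<in> carrier G" "y \<in> carrier G"
  shows "linked G x' y' x y"
proof -
  obtain \<phi> where \<phi>: "\<phi> \<in> iso G G" "\<phi> x = x'" "\<phi> y = y'" using assms by (auto simp: linked_def)
  then have "inj_on \<phi> (carrier G)" by (simp add: iso_iff)
  then have "inv_into (carrier G) \<phi> x' = x" "inv_into (carrier G) \<phi> y' = y"
    using \<phi> assms by auto
  then show ?thesis using iso_set_sym[OF \<phi>(1)] by (auto simp: linked_def)
qed

lemma linked_trans:
  assumes "linked G x y x' y'" "linked G x' y' x'' y''"
  shows "linked G x y x'' y''"
proof -
  obtain \<phi> \<psi> where "\<phi> \<in> iso G G" "\<phi> x = x'" "\<phi> y = y'" "\<psi> \<in> iso G G" "\<psi> x' = x''" "\<psi> y' = y''"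
    using assms by (auto simp: linked_def)
  then show ?thesis using iso_set_trans[of \<phi> G G \<psi> G] by (auto simp: linked_def intro!: bexI[of _ "\<psi> \<circ> \<phi>"])
qed

lemma generating_pair_ne_one:
  assumes "generating_pair G x y"
  shows "x \<noteq> \<one>" "y \<noteq> \<one>" "x \<otimes> y \<noteq> \<one>"
proof -
  have xy: "x \<in> carrier G" "y \<in> carrier G" using assms by (auto simp: generating_pair_def)
  have nc: "x \<otimes> y \<noteq> y \<otimes> x" using generating_pair_comm[OF assms] nonabelian by blast
  with xy show "x \<noteq> \<one>" "y \<noteq> \<one>" by auto
  show "x \<otimes> y \<noteq> \<one>" using nc xy inv_comm by metis
qed

section \<open>Hall's criterion for direct powers\<close>

context
  fixes k :: nat
begin

abbreviation D where "D \<equiv> direct_power G k"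

lemma group_D: "group D" by (rule group_direct_power) (rule is_group)

lemma carrier_D: "carrier D = (\<Pi>\<^sub>E i\<in>{..<k}. carrier G)"
  by (simp add: direct_power_def)

lemma finite_D [simp]: "finite (carrier D)"
  by (simp add: carrier_D finite_PiE)

lemma D_closed: "\<lbrakk>h \<in> carrier D; c < k\<rbrakk> \<Longrightarrow> h c \<in> carrier G"
  by (auto simp: carrier_D)

lemma D_eqI: "\<lbrakk>h \<in> carrier D; h' \<in> carrier D; \<And>c. c < k \<Longrightarrow> h c = h' c\<rbrakk> \<Longrightarrow> h = h'"
  unfolding carrier_D by (rule PiE_ext) auto

lemma D_mult [simp]: "c < k \<Longrightarrow> (h \<otimes>\<^bsub>D\<^esub> h') c = h c \<otimes> h' c"
  by (simp add: direct_power_def)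

lemma D_one [simp]: "c < k \<Longrightarrow> \<one>\<^bsub>D\<^esub> c = \<one>"
  by (simp add: direct_power_def)

lemma D_inv: "\<lbrakk>h \<in> carrier D; c < k\<rbrakk> \<Longrightarrow> (inv\<^bsub>D\<^esub> h) c = inv (h c)"
  by (simp add: direct_power_def)

lemma D_pow: "c < k \<Longrightarrow> (h [^]\<^bsub>D\<^esub> (n::nat)) c = h c [^] n"
  by (induction n) simp_all

lemma D_conj_by: "\<lbrakk>h \<in> carrier D; g \<in> carrier D; c < k\<rbrakk> \<Longrightarrow> conj_by D h g c = conj_by G (h c) (g c)"
  by (simp add: conj_by_def D_inv)

lemma projection_hom: "c < k \<Longrightarrow> group_hom D G (\<lambda>h. h c)"
  using group_D is_group by (auto simp: group_hom_def group_hom_axioms_def hom_def D_closed)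

lemma projection_generate:
  assumes "X \<in> carrier D" "Y \<in> carrier D" "c < k"
  shows "generate G {X c, Y c} = (\<lambda>h. h c) ` generate D {X, Y}"
  using group_hom.generate_img[OF projection_hom[OF assms(3)], of "{X, Y}"] assms by simp

lemma projection_surj: "c < k \<Longrightarrow> (\<lambda>h. h c) ` carrier D = carrier G"
proof (intro equalityI subsetI)
  fix g assume c: "c < k" and g: "g \<in> carrier G"
  show "g \<in> (\<lambda>h. h c) ` carrier D"
    using c g by (intro image_eqI[of _ _ "\<lambda>i\<in>{..<k}. g"]) (auto simp: carrier_D)
qed (auto simp: D_closed)

lemma generating_pair_component:
  assumes "generating_pair D X Y" "c < k"
  shows "generating_pair G (X c) (Y c)"
  using assms projection_generate[of X Y c] projection_surj[of c]
  by (auto simp: generating_pair_def D_closed)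

lemma generating_pair_not_linked:
  assumes XY: "generating_pair D X Y" and cd: "c < k" "d < k" "c \<noteq> d"
  shows "\<not> linked G (X c) (Y c) (X d) (Y d)"
proof
  assume "linked G (X c) (Y c) (X d) (Y d)"
  then obtain \<phi> where \<phi>: "\<phi> \<in> iso G G" "\<phi> (X c) = X d" "\<phi> (Y c) = Y d" by (auto simp: linked_def)
  then interpret \<phi>: group_hom G G \<phi> by unfold_locales (simp add: iso_def)
  interpret D: group D by (rule group_D)
  \<comment> \<open>\<open>M\<close> is the graph of \<open>\<phi>\<close> between components
    \<open>c\<close> and \<open>d\<close>. It is proper: an element that is nontrivial in component
    \<open>d\<close> alone lies outside.\<close>
  define M where "M = {h \<in> carrier D. h d = \<phi> (h c)}"
  have "subgroup M D"
    by (rule D.subgroupI) (auto simp: M_def cd D_inv D_closed intro!: exI[of _ "\<one>\<^bsub>D\<^esub>"])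
  moreover have "{X, Y} \<subseteq> M" using \<phi> XY by (auto simp: M_def generating_pair_def)
  ultimately have "carrier D \<subseteq> M" using D.generate_subgroup_incl[of "{X, Y}" M] XY by (simp add: generating_pair_def)
  moreover obtain g where g: "g \<in> carrier G" "g \<noteq> \<one>" using simple_not_triv by blast
  moreover have "(\<lambda>i\<in>{..<k}. if i = d then g else \<one>) \<in> carrier D" using g by (auto simp: carrier_D)
  ultimately show False using cd by (auto simp: M_def)
qed

text \<open>Goursat's argument: the values at \<open>c\<close> of elements of \<open>H\<close> that
  are trivial at \<open>d\<close> form a normal subgroup. If it were trivial, \<open>H\<close> would
  project to components \<open>c\<close>, \<open>d\<close> as the graph of an automorphism, which is
  a link; so by simplicity it is all of \<open>G\<close>.\<close>

lemma generating_pair_if_not_linked: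
  assumes XY: "X \<in> carrier D" "Y \<in> carrier D"
    and gen: "\<And>c. c < k \<Longrightarrow> generating_pair G (X c) (Y c)"
    and nl: "\<And>c d. \<lbrakk>c < k; d < k; c \<noteq> d\<rbrakk> \<Longrightarrow> \<not> linked G (X c) (Y c) (X d) (Y d)"
  shows "generating_pair D X Y"
proof -
  interpret D: group D by (rule group_D)
  define H where "H = generate D {X, Y}"
  have H: "subgroup H D" unfolding H_def using XY by (intro D.generate_is_subgroup) auto
  have X_in: "X \<in> H" "Y \<in> H" by (auto simp: H_def intro: generate.incl)
  have H_sub: "H \<subseteq> carrier D" by (rule subgroup.subset[OF H])
  note Hm = subgroup.m_closed[OF H] and Hi = subgroup.m_inv_closed[OF H] and H1 = subgroup.one_closed[OF H]
  have Hc: "h c \<in> carrier G" if "h \<in> H" "c < k" for h c using that H_sub D_closed by blast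
  have surj: "\<exists>h\<in>H. h c = g" if "c < k" "g \<in> carrier G" for c g
  proof -
    have "g \<in> (\<lambda>h. h c) ` generate D {X, Y}"
      using that gen[OF that(1)] unfolding generating_pair_def projection_generate[OF XY that(1)] by simp
    then show ?thesis by (auto simp: H_def)
  qed
  define K where "K c E = {h c | h. h \<in> H \<and> (\<forall>d\<in>E. h d = \<one>)}" for c E
  have K_normal: "K c E \<lhd> G" if c: "c < k" and E: "E \<subseteq> {..<k}" for c E
  proof (rule normal_invI)
    show "subgroup (K c E) G"
    proof (rule subgroupI)
      show "K c E \<subseteq> carrier G" using Hc c by (auto simp: K_def)
      show "K c E \<noteq> {}" using H1 E by (fastforce simp: K_def subset_iff intro!: exI[of _ "\<one>\<^bsub>D\<^esub>"])
    next
      fix a assume "a \<in> K c E"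
      then obtain h where h: "h \<in> H" "\<forall>d\<in>E. h d = \<one>" "a = h c" by (auto simp: K_def)
      then have "inv a = (inv\<^bsub>D\<^esub> h) c" "\<forall>d\<in>E. (inv\<^bsub>D\<^esub> h) d = \<one>"
        using H_sub c E by (auto simp: D_inv subset_iff)
      with h Hi show "inv a \<in> K c E" unfolding K_def by blast
    next
      fix a b assume "a \<in> K c E" "b \<in> K c E"
      then obtain h h' where h: "h \<in> H" "\<forall>d\<in>E. h d = \<one>" "a = h c" "h' \<in> H" "\<forall>d\<in>E. h' d = \<one>" "b = h' c"
        by (auto simp: K_def)
      then have "a \<otimes> b = (h \<otimes>\<^bsub>D\<^esub> h') c" "\<forall>d\<in>E. (h \<otimes>\<^bsub>D\<^esub> h') d = \<one>"
        using c E by (auto simp: subset_iff)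
      with h Hm show "a \<otimes> b \<in> K c E" unfolding K_def by blast
    qed
  next
    fix g a assume g: "g \<in> carrier G" and "a \<in> K c E"
    then obtain h where h: "h \<in> H" "\<forall>d\<in>E. h d = \<one>" "a = h c" by (auto simp: K_def)
    obtain h' where h': "h' \<in> H" "h' c = g" using surj c g by blast
    have "g \<otimes> a \<otimes> inv g = (h' \<otimes>\<^bsub>D\<^esub> h \<otimes>\<^bsub>D\<^esub> inv\<^bsub>D\<^esub> h') c"
      using h h' H_sub c by (auto simp: D_inv subset_iff)
    moreover have "(h' \<otimes>\<^bsub>D\<^esub> h \<otimes>\<^bsub>D\<^esub> inv\<^bsub>D\<^esub> h') d = \<one>" if "d \<in> E" for d
    proof -
      have "d < k" "h' d \<in> carrier G" using that E Hc h' by auto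
      then show ?thesis using h h' H_sub that by (auto simp: D_inv subset_iff)
    qed
    ultimately show "g \<otimes> a \<otimes> inv g \<in> K c E"
      using Hm Hi h h' unfolding K_def by blast
  qed
  have K_single: "K c {d} = carrier G" if cd: "c < k" "d < k" "c \<noteq> d" for c d
  proof (rule ccontr)
    assume "K c {d} \<noteq> carrier G"
    then have K1: "K c {d} = {\<one>}" using no_real_normal_subgroup[OF K_normal[of c "{d}"]] cd by auto
    have wd: "h c = h' c" if h: "h \<in> H" "h' \<in> H" "h d = h' d" for h h'
    proof -
      have "(h \<otimes>\<^bsub>D\<^esub> inv\<^bsub>D\<^esub> h') d = \<one>"
        using h cd H_sub Hc by (auto simp: D_inv subset_iff)
      then have "(h \<otimes>\<^bsub>D\<^esub> inv\<^bsub>D\<^esub> h') c \<in> K c {d}" using h Hm Hi unfolding K_def by blast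
      then have "h c \<otimes> inv (h' c) = \<one>" using K1 h cd H_sub by (auto simp: D_inv subset_iff)
      then show ?thesis using h cd Hc by (metis inv_equality inv_inv inv_closed)
    qed
    \<comment> \<open>By \<open>wd\<close> the value does not depend on the chosen
      \<open>h\<close>.\<close>
    define \<phi> where "\<phi> g = (SOME h. h \<in> H \<and> h d = g) c" for g
    have \<phi>: "\<phi> (h d) = h c" if h: "h \<in> H" for h
    proof -
      have "(SOME h'. h' \<in> H \<and> h' d = h d) \<in> H \<and> (SOME h'. h' \<in> H \<and> h' d = h d) d = h d"
        by (rule someI[of "\<lambda>h'. h' \<in> H \<and> h' d = h d" h]) (use h in blast)
      then show ?thesis using wd h by (simp add: \<phi>_def)
    qed
    have closed: "\<phi> a \<in> carrier G" if "a \<in> carrier G" for a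
      using surj[OF cd(2) that] \<phi> Hc cd by metis
    have "\<phi> \<in> hom G G"
    proof (rule homI)
      fix a b assume "a \<in> carrier G" "b \<in> carrier G"
      then obtain h h' where h: "h \<in> H" "h d = a" "h' \<in> H" "h' d = b" using surj cd by metis
      then show "\<phi> (a \<otimes> b) = \<phi> a \<otimes> \<phi> b" using \<phi>[OF Hm[OF h(1,3)]] \<phi>[OF h(1)] \<phi>[OF h(3)] cd by simp
    qed (rule closed)
    moreover have "\<phi> ` carrier G = carrier G"
    proof (intro equalityI subsetI)
      fix g assume "g \<in> carrier G"
      then obtain h where "h \<in> H" "h c = g" using surj cd by blast
      then show "g \<in> \<phi> ` carrier G" using \<phi> Hc cd by (metis imageI)
    qed (use closed in auto)
    ultimately have "\<phi> \<in> iso G G"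
      by (simp add: iso_iff endo_inj_surj finite_surj_inj eq_card_imp_inj_on)
    then have "linked G (X d) (Y d) (X c) (Y c)"
      using \<phi> X_in by (auto simp: linked_def)
    then show False using nl cd by blast
  qed
  have K_all: "K c E = carrier G" if "finite E" "c < k" "E \<subseteq> {..<k} - {c}" for c E
    using that
  proof (induction E rule: finite_induct)
    case empty
    then show ?case using surj Hc by (fastforce simp: K_def)
  next
    case (insert d E)
    have cd: "c < k" "d < k" "c \<noteq> d" and E: "insert d E \<subseteq> {..<k}" using insert.prems by auto
    obtain a b where ab: "a \<in> carrier G" "b \<in> carrier G" "a \<otimes> b \<noteq> b \<otimes> a" using nonabelian by blast
    have "a \<in> K c E" "b \<in> K c {d}" using insert ab K_single[OF cd] by auto
    then obtain h h' where h: "h \<in> H" "\<forall>d\<in>E. h d = \<one>" "a = h c" "h' \<in> H" "h' d = \<one>" "b = h' c"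
      by (auto simp: K_def)
    \<comment> \<open>A commutator is trivial wherever one of its factors is. So an element trivial
      on \<open>E\<close> and one trivial at \<open>d\<close> yield one trivial on both, and since
      \<open>a\<close> and \<open>b\<close> do not commute it stays nontrivial at
      \<open>c\<close>.\<close>
    define w where "w = (h \<otimes>\<^bsub>D\<^esub> h') \<otimes>\<^bsub>D\<^esub> inv\<^bsub>D\<^esub> (h' \<otimes>\<^bsub>D\<^esub> h)"
    have wH: "w \<in> H" using h Hm Hi by (simp add: w_def)
    have w_at: "w i = (h i \<otimes> h' i) \<otimes> inv (h' i \<otimes> h i)" if "i < k" for i
      using that h Hm H_sub by (simp add: w_def D_inv subset_iff)
    have "w i = \<one>" if "i \<in> insert d E" for i
      using that E h Hc by (auto simp: w_at subset_iff)
    then have "w c \<in> K c (insert d E)" using wH unfolding K_def by blast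
    moreover have "w c \<noteq> \<one>"
      using w_at[OF cd(1)] ab h by (metis inv_equality inv_inv inv_closed m_closed)
    ultimately show ?case using no_real_normal_subgroup[OF K_normal[OF cd(1) E]] by blast
  qed
  have "carrier D \<subseteq> H"
  proof
    fix f assume f: "f \<in> carrier D"
    \<comment> \<open>\<open>f\<close> is assembled from elements of \<open>H\<close> supported on a
      single component.\<close>
    have "(\<lambda>i\<in>{..<k}. if i < j then f i else \<one>) \<in> H" if "j \<le> k" for j
      using that
    proof (induction j)
      case 0
      have "(\<lambda>i\<in>{..<k}. if i < 0 then f i else \<one>) = \<one>\<^bsub>D\<^esub>" by (simp add: direct_power_def)
      then show ?case using H1 by simp
    next
      case (Suc j)
      have "f j \<in> K j ({..<k} - {j})" using K_all[of "{..<k} - {j}" j] Suc f by (simp add: D_closed)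
      then obtain h where h: "h \<in> H" "\<forall>d\<in>{..<k} - {j}. h d = \<one>" "h j = f j" by (auto simp: K_def)
      let ?g = "(\<lambda>i\<in>{..<k}. if i < j then f i else \<one>)"
      have gH: "?g \<in> H" by (rule Suc.IH) (use Suc.prems in simp)
      have "?g \<otimes>\<^bsub>D\<^esub> h \<in> H" by (rule Hm[OF gH h(1)])
      also have "?g \<otimes>\<^bsub>D\<^esub> h = (\<lambda>i\<in>{..<k}. if i < Suc j then f i else \<one>)"
      proof (rule D_eqI)
        show "?g \<otimes>\<^bsub>D\<^esub> h \<in> carrier D" using Hm[OF gH h(1)] H_sub by blast
        show "(\<lambda>i\<in>{..<k}. if i < Suc j then f i else \<one>) \<in> carrier D"
          using D_closed[OF f] by (simp add: carrier_D restrict_PiE_iff)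
        fix c assume c: "c < k"
        then have "f c \<in> carrier G" using f by (simp add: D_closed)
        then show "(?g \<otimes>\<^bsub>D\<^esub> h) c = (\<lambda>i\<in>{..<k}. if i < Suc j then f i else \<one>) c"
          using c h by (cases "c = j") auto
      qed
      finally show ?case .
    qed
    from this[of k] have "(\<lambda>i\<in>{..<k}. if i < k then f i else \<one>) \<in> H" by simp
    moreover have "(\<lambda>i\<in>{..<k}. if i < k then f i else \<one>) \<in> carrier D"
      using D_closed[OF f] by (simp add: carrier_D restrict_PiE_iff)
    then have "(\<lambda>i\<in>{..<k}. if i < k then f i else \<one>) = f"
      by (rule D_eqI) (simp_all add: f)
    ultimately show "f \<in> H" by simp
  qed
  then show ?thesis using XY H_sub by (auto simp: generating_pair_def H_def)
qed

text \<open>Each prescribed pair is linked to at most one component of \<open>(P, R)\<close>,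
  because those components are pairwise not linked. So at most \<open>s\<close> of them are spoiled,
  and \<open>k - s\<close> others are left to fill the remaining places.\<close>

lemma extend_generating_pair:
  assumes P: "generating_pair D P R" and s: "s \<le> k"
    and gen: "\<And>c. c < s \<Longrightarrow> generating_pair G (f c) (h c)"
    and nl: "\<And>c d. \<lbrakk>c < s; d < s; c \<noteq> d\<rbrakk> \<Longrightarrow> \<not> linked G (f c) (h c) (f d) (h d)"
  obtains X Y where "generating_pair D X Y" "\<And>c. c < s \<Longrightarrow> X c = f c \<and> Y c = h c"
proof -
  have P_gen: "generating_pair G (P c) (R c)" if "c < k" for c
    using generating_pair_component[OF P that] .
  have P_in: "P c \<in> carrier G" "R c \<in> carrier G" if "c < k" for c
    using P_gen[OF that] by (auto simp: generating_pair_def)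
  have f_in: "f c \<in> carrier G" "h c \<in> carrier G" if "c < s" for c
    using gen[OF that] by (auto simp: generating_pair_def)
  define bad where "bad = {p. p < k \<and> (\<exists>c<s. linked G (f c) (h c) (P p) (R p))}"
  define w where "w p = (SOME c. c < s \<and> linked G (f c) (h c) (P p) (R p))" for p
  have w: "w p < s \<and> linked G (f (w p)) (h (w p)) (P p) (R p)" if "p \<in> bad" for p
    unfolding w_def by (rule someI_ex) (use that in \<open>auto simp: bad_def\<close>)
  have "inj_on w bad"
  proof (rule inj_onI, rule ccontr)
    fix p p' assume p: "p \<in> bad" "p' \<in> bad" "w p = w p'" "p \<noteq> p'"
    then have "linked G (P p) (R p) (P p') (R p')"
      using w[OF p(1)] w[OF p(2)] linked_sym linked_trans f_in by metis
    then show False using generating_pair_not_linked[OF P] p by (auto simp: bad_def)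
  qed
  moreover have "w ` bad \<subseteq> {..<s}" using w by auto
  ultimately have "card bad \<le> s" using card_inj_on_le[of w bad "{..<s}"] by simp
  moreover have "card ({..<k} - bad) = k - card bad" by (subst card_Diff_subset) (auto simp: bad_def)
  ultimately have "card {s..<k} \<le> card ({..<k} - bad)" by simp
  then obtain e where e: "e ` {s..<k} \<subseteq> {..<k} - bad" "inj_on e {s..<k}"
    using card_le_inj[of "{s..<k}" "{..<k} - bad"] by auto
  have e': "e c < k" "e c \<notin> bad" if "s \<le> c" "c < k" for c using e that by force+
  define X where "X = (\<lambda>c\<in>{..<k}. if c < s then f c else P (e c))"
  define Y where "Y = (\<lambda>c\<in>{..<k}. if c < s then h c else R (e c))"
  have XYf: "X c = f c" "Y c = h c" if "c < s" for c using that s by (auto simp: X_def Y_def)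
  have XYP: "X c = P (e c)" "Y c = R (e c)" if "s \<le> c" "c < k" for c using that by (auto simp: X_def Y_def)
  have nl1: "\<not> linked G (X c) (Y c) (X d) (Y d)" if "c < s" "s \<le> d" "d < k" for c d
    using e'[OF that(2,3)] that XYf[of c] XYP[of d] by (auto simp: bad_def)
  have "generating_pair D X Y"
  proof (rule generating_pair_if_not_linked)
    show "X \<in> carrier D" "Y \<in> carrier D"
      using f_in P_in e' by (auto simp: carrier_D X_def Y_def)
    show gXY: "generating_pair G (X c) (Y c)" if "c < k" for c
      using that gen P_gen e' XYf XYP by (cases "c < s") auto
    fix c d assume cd: "c < k" "d < k" "c \<noteq> d"
    have XYin: "X c \<in> carrier G" "Y c \<in> carrier G" using gXY[OF cd(1)] by (auto simp: generating_pair_def)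
    consider "c < s" "d < s" | "c < s" "s \<le> d" | "s \<le> c" "d < s" | "s \<le> c" "s \<le> d" by linarith
    then show "\<not> linked G (X c) (Y c) (X d) (Y d)"
    proof cases
      case 1 then show ?thesis using nl cd XYf by simp
    next
      case 2 then show ?thesis using nl1 cd by simp
    next
      case 3 then show ?thesis using nl1[of d c] cd linked_sym XYin by blast
    next
      case 4
      then have "e c \<noteq> e d" using e(2) cd by (auto dest: inj_onD)
      then show ?thesis using 4 cd XYP e' generating_pair_not_linked[OF P] by simp
    qed
  qed
  with that XYf show thesis by blast
qed

text \<open>At component \<open>c\<close> the value of \<open>z\<close> is killed by both
  \<open>t\<close> and \<open>u\<close>, hence trivial, and as \<open>g c\<close> has order exactly
  \<open>t\<close> this forces \<open>t dvd i\<close>. In every component the \<open>u\<close>-th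
  power of \<open>z\<close> is then conjugate to a power of a \<open>(t * u)\<close>-th
  power.\<close>

lemma conj_powers_coprime_aux:
  assumes in_D: "g \<in> carrier D" "h \<in> carrier D" "a \<in> carrier D" "b \<in> carrier D"
    and z: "z = conj_by D (g [^]\<^bsub>D\<^esub> (i::nat)) a" "z = conj_by D (h [^]\<^bsub>D\<^esub> (j::nat)) b"
    and expo: "\<And>x. x \<in> carrier G \<Longrightarrow> x [^] (t * u) = \<one>" and cop: "coprime t u"
    and c: "c < k" "ord (g c) = t" "ord (h c) dvd u"
  shows "z [^]\<^bsub>D\<^esub> u = \<one>\<^bsub>D\<^esub>"
proof -
  interpret D: group D by (rule group_D)
  have zc: "z c' = conj_by G (g c' [^] i) (a c')" if "c' < k" for c'
    unfolding z(1) using in_D that by (simp add: D_conj_by D_pow)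
  have zh: "z c = conj_by G (h c [^] j) (b c)"
    unfolding z(2) using in_D c by (simp add: D_conj_by D_pow)
  have gi: "g c' \<in> carrier G" "h c' \<in> carrier G" "a c' \<in> carrier G" "b c' \<in> carrier G" if "c' < k" for c'
    using in_D that by (auto simp: D_closed)
  note gc = gi[OF c(1)]
  have "z c [^] t = conj_by G (g c [^] (t * i)) (a c)"
    using zc[OF c(1)] gc by (simp add: conj_by_pow nat_pow_pow mult.commute flip: conj_by_pow)
  also have "\<dots> = \<one>" using gc c(2) by (simp add: conj_by_eq_one_iff pow_eq_id)
  finally have 1: "z c [^] t = \<one>" .
  have "z c [^] u = conj_by G (h c [^] (j * u)) (b c)"
    using zh gc by (simp add: conj_by_pow nat_pow_pow flip: conj_by_pow)
  also have "\<dots> = \<one>" using gc c(3) by (simp add: conj_by_eq_one_iff pow_eq_id)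
  finally have 2: "z c [^] u = \<one>" .
  have zin: "z c \<in> carrier G" using zc c gc by simp
  have "ord (z c) dvd gcd t u" using 1 2 zin by (simp add: pow_eq_id)
  then have "z c = \<one>" using cop zin by (metis coprime_iff_gcd_eq_1 nat_pow_eone pow_eq_id)
  then have "g c [^] i = \<one>" using zc[OF c(1)] gc by (simp add: conj_by_eq_one_iff)
  then obtain m where m: "i = t * m" using c(2) gc by (auto simp: pow_eq_id)
  have zD: "z \<in> carrier D" using z in_D by simp
  show ?thesis
  proof (rule D_eqI)
    show "z [^]\<^bsub>D\<^esub> u \<in> carrier D" "\<one>\<^bsub>D\<^esub> \<in> carrier D" using zD by simp_all
    fix c' assume c': "c' < k"
    note g' = gi[OF c']
    have "z c' [^] u = conj_by G (g c' [^] (i * u)) (a c')"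
      using zc[OF c'] g' by (simp add: nat_pow_pow flip: conj_by_pow)
    also have "g c' [^] (i * u) = (g c' [^] (t * u)) [^] m"
      using g' by (simp add: nat_pow_pow m ac_simps)
    finally show "(z [^]\<^bsub>D\<^esub> u) c' = \<one>\<^bsub>D\<^esub> c'" using c' g' expo by (simp add: D_pow)
  qed
qed

lemma conj_powers_coprime:
  assumes in_D: "g \<in> carrier D" "h \<in> carrier D" "a \<in> carrier D" "b \<in> carrier D"
    and z: "z = conj_by D (g [^]\<^bsub>D\<^esub> (i::nat)) a" "z = conj_by D (h [^]\<^bsub>D\<^esub> (j::nat)) b"
    and expo: "\<And>x. x \<in> carrier G \<Longrightarrow> x [^] (t * u) = \<one>" and cop: "coprime t u"
    and c: "(\<exists>c<k. ord (g c) = t \<and> ord (h c) dvd u \<or> ord (h c) = t \<and> ord (g c) dvd u) \<or> (\<forall>c<k. ord (g c) dvd u)"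
  shows "z [^]\<^bsub>D\<^esub> u = \<one>\<^bsub>D\<^esub>"
  using c
proof
  assume "\<exists>c<k. ord (g c) = t \<and> ord (h c) dvd u \<or> ord (h c) = t \<and> ord (g c) dvd u"
  then show ?thesis
    using conj_powers_coprime_aux[OF in_D z expo cop]
      conj_powers_coprime_aux[OF in_D(2,1,4,3) z(2,1) expo cop] by blast
next
  assume *: "\<forall>c<k. ord (g c) dvd u"
  interpret D: group D by (rule group_D)
  show ?thesis
  proof (rule D_eqI)
    show "z [^]\<^bsub>D\<^esub> u \<in> carrier D" "\<one>\<^bsub>D\<^esub> \<in> carrier D" using z in_D by simp_all
    fix c assume c: "c < k"
    then have gc: "g c \<in> carrier G" "a c \<in> carrier G" using in_D by (auto simp: D_closed)
    have "z c [^] u = conj_by G (g c [^] (i * u)) (a c)"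
      unfolding z(1) using in_D c gc by (simp add: D_conj_by D_pow nat_pow_pow flip: conj_by_pow)
    also have "\<dots> = \<one>" using gc * c by (simp add: conj_by_eq_one_iff pow_eq_id)
    finally show "(z [^]\<^bsub>D\<^esub> u) c = \<one>\<^bsub>D\<^esub> c" using c by (simp add: D_pow)
  qed
qed

end

end

section \<open>Beauville structures from orders of elements\<close>

text \<open>The types \<open>0\<close>, \<open>1\<close>, \<open>2\<close> stand for the orders \<open>2\<close>, \<open>q - 1\<close>, \<open>q + 1\<close>.\<close>
definition type_order :: "nat \<Rightarrow> nat \<Rightarrow> nat" where
  "type_order q t = (if t = 0 then 2 else if t = 1 then q - 1 else q + 1)"

definition type_cofactor :: "nat \<Rightarrow> nat \<Rightarrow> nat" where
  "type_cofactor q t = (if t = 0 then (q - 1) * (q + 1) else if t = 1 then 2 * (q + 1) else 2 * (q - 1))"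

definition triple :: "('a, 'b) monoid_scheme \<Rightarrow> 'a \<Rightarrow> 'a \<Rightarrow> nat \<Rightarrow> 'a" where
  "triple G x y u = (if u = 0 then x else if u = 1 then y else x \<otimes>\<^bsub>G\<^esub> y)"

definition realizes :: "('a, 'b) monoid_scheme \<Rightarrow> nat \<Rightarrow> nat list \<Rightarrow> 'a \<Rightarrow> 'a \<Rightarrow> bool" where
  "realizes G q T x y \<longleftrightarrow> generating_pair G x y \<and> (\<forall>u\<in>{0, 1, 2}. group.ord G (triple G x y u) = type_order q (T ! u))"

definition pattern :: "nat list \<Rightarrow> bool" where
  "pattern T \<longleftrightarrow> length T = 3 \<and> (\<forall>u\<in>{0, 1, 2}. T ! u \<in> {0, 1, 2})"

lemma pattern_nth: "\<lbrakk>pattern T; u \<in> {0, 1, 2}\<rbrakk> \<Longrightarrow> T ! u \<in> {0, 1, 2}"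
  unfolding pattern_def by (elim conjE) (rule bspec)

text \<open>The flag \<open>w\<close> tells that there are no components beyond those listed, so that types that do not occur
  need not be separated.\<close>
definition separated :: "bool \<Rightarrow> nat list list \<Rightarrow> nat list list \<Rightarrow> bool" where
  "separated w s1 s2 \<longleftrightarrow> (\<forall>t\<in>{0, 1, 2}. \<forall>u\<in>{0, 1, 2}. \<forall>v\<in>{0, 1, 2}.
     (\<exists>(S1, S2)\<in>set (zip s1 s2). (S1 ! u = t) \<noteq> (S2 ! v = t)) \<or> (w \<and> (\<forall>S1\<in>set s1. S1 ! u \<noteq> t)))"

lemma coprime_pred_Suc_even:
  assumes "even q" "q \<ge> (4 :: nat)"
  shows "coprime 2 (q - 1)" "coprime 2 (q + 1)" "coprime (q - 1) (q + 1)"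
proof -
  show 2: "coprime 2 (q - 1)" and "coprime 2 (q + 1)" using assms by auto
  have "gcd (q - 1) (q + 1) = gcd (q - 1) 2"
    using gcd_add2[of "q - 1" 2] assms by (simp add: numeral_2_eq_2)
  then show "coprime (q - 1) (q + 1)" using 2 by (simp add: coprime_iff_gcd_eq_1 gcd.commute)
qed

text \<open>What the construction uses about \<open>L\<^sub>2(q)\<close>, apart from the existence
  of suitable generating pairs. It is invariant under isomorphism, so it can be verified for
  matrices and applied to the quotient \<open>PSL2\<close>.\<close>

locale L2_like = finite_nonabelian_simple_group +
  fixes q :: nat
  assumes even_q: "even q" and q_ge_4: "q \<ge> 4"
    and exponent: "x \<in> carrier G \<Longrightarrow> x [^] (2 * (q - 1) * (q + 1)) = \<one>"
    and inverted: "generating_pair G x y \<Longrightarrow> \<exists>g\<in>carrier G. conj_by G x g = inv x \<and> conj_by G y g = inv y"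
begin

lemma coprime_type_cofactor: "t \<in> {0, 1, 2} \<Longrightarrow> coprime (type_order q t) (type_cofactor q t)"
  and type_order_mult_cofactor: "t \<in> {0, 1, 2} \<Longrightarrow> type_order q t * type_cofactor q t = 2 * (q - 1) * (q + 1)"
proof -
  show "t \<in> {0, 1, 2} \<Longrightarrow> coprime (type_order q t) (type_cofactor q t)"
    using coprime_pred_Suc_even[OF even_q q_ge_4]
    by (auto simp: type_order_def type_cofactor_def coprime_commute simp del: mult_Suc_right)
  show "t \<in> {0, 1, 2} \<Longrightarrow> type_order q t * type_cofactor q t = 2 * (q - 1) * (q + 1)"
    by (auto simp: type_order_def type_cofactor_def)
qed

lemma type_order_dvd_cofactor: "\<lbrakk>a \<in> {0, 1, 2}; t \<in> {0, 1, 2}; a \<noteq> t\<rbrakk> \<Longrightarrow> type_order q a dvd type_cofactor q t"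
  by (auto simp: type_order_def type_cofactor_def simp del: mult_Suc_right)

lemma type_order_inj: "\<lbrakk>a \<in> {0, 1, 2}; t \<in> {0, 1, 2}; type_order q a = type_order q t\<rbrakk> \<Longrightarrow> a = t"
  using q_ge_4 by (auto simp: type_order_def)

lemma dvd_all_cofactors_eq_1:
  assumes "\<And>t. t \<in> {0, 1, 2} \<Longrightarrow> d dvd type_cofactor q t"
  shows "d = 1"
proof -
  have "d dvd type_cofactor q 0" "d dvd type_cofactor q 1" "d dvd type_cofactor q 2" using assms by auto
  moreover have "type_cofactor q 0 = type_order q 1 * type_order q 2" "type_cofactor q 1 = type_order q 0 * type_order q 2" "type_cofactor q 2 = type_order q 0 * type_order q 1"
    by (simp_all add: type_order_def type_cofactor_def)
  ultimately have d: "d dvd type_order q 1 * type_order q 2" "d dvd type_order q 0 * type_order q 2" "d dvd type_order q 0 * type_order q 1" by simp_all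
  have "coprime (type_order q 0) (type_order q 1 * type_order q 2)" "coprime (type_order q 1) (type_order q 0 * type_order q 2)"
    using coprime_type_cofactor[of 0] coprime_type_cofactor[of 1] by (simp_all add: type_order_def type_cofactor_def)
  then have "coprime d (type_order q 0)" "coprime d (type_order q 1)"
    using d(1,2) by (metis coprime_commute coprime_divisors dvd_refl)+
  then have "coprime d (type_order q 0 * type_order q 1)" by simp
  with d(3) show ?thesis using coprime_absorb_left nat_dvd_1_iff_1 by blast
qed

text \<open>Automorphisms preserve the orders of \<open>x\<close>, \<open>y\<close> and
  \<open>x \<otimes> y\<close>; this is how type lists certify inequivalence of pairs.\<close>

lemma linked_realizes:
  assumes "realizes G q T x y" "realizes G q T' x' y'" "pattern T" "pattern T'" "linked G x y x' y'"
  shows "T = T'"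
proof -
  obtain \<phi> where \<phi>: "\<phi> \<in> iso G G" "\<phi> x = x'" "\<phi> y = y'" using assms(5) by (auto simp: linked_def)
  interpret \<phi>: group_hom G G \<phi> using \<phi>(1) by unfold_locales (simp add: iso_def)
  have xy: "x \<in> carrier G" "y \<in> carrier G" using assms(1) by (auto simp: realizes_def generating_pair_def)
  have inj: "inj_on \<phi> (carrier G)" using \<phi>(1) by (simp add: iso_iff)
  have ord: "ord (\<phi> g) = ord g" if g: "g \<in> carrier G" for g
  proof (rule ord_unique_iff)
    show "\<phi> g \<in> carrier G" using g by simp
    fix n :: nat
    have "\<phi> g [^] n = \<one> \<longleftrightarrow> \<phi> (g [^] n) = \<phi> \<one>" using g by (simp add: \<phi>.hom_nat_pow)
    also have "\<dots> \<longleftrightarrow> g [^] n = \<one>" using inj_on_eq_iff[OF inj, of "g [^] n" \<one>] g by simp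
    finally show "\<phi> g [^] n = \<one> \<longleftrightarrow> ord g dvd n" using pow_eq_id[OF g] by simp
  qed
  have "T ! u = T' ! u" if u: "u \<in> {0, 1, 2}" for u
  proof (rule type_order_inj)
    have "triple G x' y' u = \<phi> (triple G x y u)" using \<phi> xy by (auto simp: triple_def)
    moreover have "triple G x y u \<in> carrier G" using xy by (auto simp: triple_def)
    ultimately show "type_order q (T ! u) = type_order q (T' ! u)" using assms(1,2) u ord unfolding realizes_def by metis
  qed (rule pattern_nth[OF assms(3) u] pattern_nth[OF assms(4) u])+
  then show ?thesis using assms(3,4) unfolding pattern_def
    by (intro nth_equalityI) (auto simp: numeral_3_eq_3 less_Suc_eq numeral_2_eq_2)
qed

context
  fixes k :: nat
begin

lemma Sigma_inter:
  assumes XY: "X1 \<in> carrier (D k)" "Y1 \<in> carrier (D k)" "X2 \<in> carrier (D k)" "Y2 \<in> carrier (D k)"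
    and sep: "\<And>t u v. \<lbrakk>t \<in> {0, 1, 2}; u \<in> {0, 1, 2}; v \<in> {0, 1, 2}\<rbrakk> \<Longrightarrow>
      (\<exists>c<k. ord (triple (D k) X1 Y1 u c) = type_order q t \<and> ord (triple (D k) X2 Y2 v c) dvd type_cofactor q t
           \<or> ord (triple (D k) X2 Y2 v c) = type_order q t \<and> ord (triple (D k) X1 Y1 u c) dvd type_cofactor q t)
      \<or> (\<forall>c<k. ord (triple (D k) X1 Y1 u c) dvd type_cofactor q t)"
  shows "Beauville_Sigma (D k) X1 Y1 \<inter> Beauville_Sigma (D k) X2 Y2 = {\<one>\<^bsub>D k\<^esub>}"
proof -
  interpret D: group "D k" by (rule group_D)
  have tc: "triple (D k) X Y u \<in> carrier (D k)" if "X \<in> carrier (D k)" "Y \<in> carrier (D k)" for X Y u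
    using that by (simp add: triple_def)
  have ex: "\<exists>u\<in>{0, 1, 2}. \<exists>i a. a \<in> carrier (D k) \<and> z = conj_by (D k) (triple (D k) X Y u [^]\<^bsub>D k\<^esub> (i::nat)) a"
    if "z \<in> Beauville_Sigma (D k) X Y" for X Y z
    using that unfolding Beauville_Sigma_def by (force simp: triple_def)
  have one: "\<one>\<^bsub>D k\<^esub> \<in> Beauville_Sigma (D k) X Y" if "X \<in> carrier (D k)" for X Y
  proof -
    have "order (D k) > 0" using D.order_gt_0_iff_finite by simp
    then show ?thesis unfolding Beauville_Sigma_def
      using D.pow_order_eq_1[OF that] by (force intro!: bexI[of _ "order (D k)"] bexI[of _ "\<one>\<^bsub>D k\<^esub>"])
  qed
  have "z = \<one>\<^bsub>D k\<^esub>" if z: "z \<in> Beauville_Sigma (D k) X1 Y1" "z \<in> Beauville_Sigma (D k) X2 Y2" for z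
  proof -
    obtain u i a where 1: "u \<in> {0, 1, 2}" "a \<in> carrier (D k)" "z = conj_by (D k) (triple (D k) X1 Y1 u [^]\<^bsub>D k\<^esub> (i::nat)) a"
      using ex[OF z(1)] by blast
    obtain v j b where 2: "v \<in> {0, 1, 2}" "b \<in> carrier (D k)" "z = conj_by (D k) (triple (D k) X2 Y2 v [^]\<^bsub>D k\<^esub> (j::nat)) b"
      using ex[OF z(2)] by blast
    have zc: "z \<in> carrier (D k)" using 1 tc XY by simp
    \<comment> \<open>Each coprime factor is removed from the order of \<open>z\<close> separately;
      only \<open>1\<close> divides all three cofactors.\<close>
    have "D.ord z dvd type_cofactor q t" if t: "t \<in> {0, 1, 2}" for t
    proof -
      have "z [^]\<^bsub>D k\<^esub> type_cofactor q t = \<one>\<^bsub>D k\<^esub>"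
        by (rule conj_powers_coprime[OF tc[OF XY(1,2)] tc[OF XY(3,4)] 1(2) 2(2) 1(3) 2(3) _ coprime_type_cofactor[OF t] sep[OF t 1(1) 2(1)]])
          (simp only: type_order_mult_cofactor[OF t] exponent)
      then show ?thesis using D.pow_eq_id[OF zc] by simp
    qed
    then have "D.ord z = 1" by (rule dvd_all_cofactors_eq_1)
    then show ?thesis using D.ord_eq_1[OF zc] by simp
  qed
  then show ?thesis using one XY by blast
qed

lemma Beauville_group_if_separated:
  assumes P: "generating_pair (D k) P R" and s: "length s1 = s" "length s2 = s" "s \<le> k"
    and pat: "\<And>c. c < s \<Longrightarrow> pattern (s1 ! c) \<and> pattern (s2 ! c)"
    and real1: "\<And>c. c < s \<Longrightarrow> realizes G q (s1 ! c) (f1 c) (h1 c)"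
    and nl1: "\<And>c d. \<lbrakk>c < s; d < s; c \<noteq> d\<rbrakk> \<Longrightarrow> \<not> linked G (f1 c) (h1 c) (f1 d) (h1 d)"
    and real2: "\<And>c. c < s \<Longrightarrow> realizes G q (s2 ! c) (f2 c) (h2 c)"
    and nl2: "\<And>c d. \<lbrakk>c < s; d < s; c \<noteq> d\<rbrakk> \<Longrightarrow> \<not> linked G (f2 c) (h2 c) (f2 d) (h2 d)"
    and sep: "separated (s = k) s1 s2"
  shows "Beauville_group (D k)"
proof -
  obtain X1 Y1 where XY1: "generating_pair (D k) X1 Y1" "\<And>c. c < s \<Longrightarrow> X1 c = f1 c \<and> Y1 c = h1 c"
    using extend_generating_pair[OF P s(3), of f1 h1] real1 nl1 unfolding realizes_def by metis
  obtain X2 Y2 where XY2: "generating_pair (D k) X2 Y2" "\<And>c. c < s \<Longrightarrow> X2 c = f2 c \<and> Y2 c = h2 c"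
    using extend_generating_pair[OF P s(3), of f2 h2] real2 nl2 unfolding realizes_def by metis
  have in_D: "X1 \<in> carrier (D k)" "Y1 \<in> carrier (D k)" "X2 \<in> carrier (D k)" "Y2 \<in> carrier (D k)"
    using XY1 XY2 by (auto simp: generating_pair_def)
  have at: "triple (D k) X Y u c = triple G (X c) (Y c) u" if "c < k" for X Y u c
    using that by (simp add: triple_def)
  have o1: "ord (triple (D k) X1 Y1 u c) = type_order q (s1 ! c ! u)" if "c < s" "u \<in> {0, 1, 2}" for u c
    using real1[OF that(1)] that XY1(2) s(3) by (auto simp: at realizes_def)
  have o2: "ord (triple (D k) X2 Y2 u c) = type_order q (s2 ! c ! u)" if "c < s" "u \<in> {0, 1, 2}" for u c
    using real2[OF that(1)] that XY2(2) s(3) by (auto simp: at realizes_def)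
  have "Beauville_Sigma (D k) X1 Y1 \<inter> Beauville_Sigma (D k) X2 Y2 = {\<one>\<^bsub>D k\<^esub>}"
  proof (rule Sigma_inter[OF in_D])
    fix t u v :: nat assume tuv: "t \<in> {0, 1, 2}" "u \<in> {0, 1, 2}" "v \<in> {0, 1, 2}"
    have ent: "s1 ! c ! u \<in> {0, 1, 2}" "s2 ! c ! v \<in> {0, 1, 2}" if "c < s" for c
      using pattern_nth pat[OF that] tuv(2,3) by simp_all
    have "(\<exists>(S1, S2)\<in>set (zip s1 s2). (S1 ! u = t) \<noteq> (S2 ! v = t)) \<or> (s = k \<and> (\<forall>S1\<in>set s1. S1 ! u \<noteq> t))"
      using sep tuv unfolding separated_def by blast
    then consider (ex) c where "c < s" "(s1 ! c ! u = t) \<noteq> (s2 ! c ! v = t)"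
      | (all) "s = k" "\<forall>c<s. s1 ! c ! u \<noteq> t"
      using s(1,2) by (force simp: set_zip)
    then show "(\<exists>c<k. ord (triple (D k) X1 Y1 u c) = type_order q t \<and> ord (triple (D k) X2 Y2 v c) dvd type_cofactor q t
           \<or> ord (triple (D k) X2 Y2 v c) = type_order q t \<and> ord (triple (D k) X1 Y1 u c) dvd type_cofactor q t)
      \<or> (\<forall>c<k. ord (triple (D k) X1 Y1 u c) dvd type_cofactor q t)"
    proof cases
      case ex
      then have "ord (triple (D k) X1 Y1 u c) = type_order q t \<and> ord (triple (D k) X2 Y2 v c) dvd type_cofactor q t
           \<or> ord (triple (D k) X2 Y2 v c) = type_order q t \<and> ord (triple (D k) X1 Y1 u c) dvd type_cofactor q t"
        using o1[OF ex(1) tuv(2)] o2[OF ex(1) tuv(3)] type_order_dvd_cofactor ent[OF ex(1)] tuv(1) by metis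
      moreover have "c < k" using ex(1) s(3) by simp
      ultimately show ?thesis by blast
    next
      case all
      then have "\<forall>c<k. ord (triple (D k) X1 Y1 u c) dvd type_cofactor q t"
        using o1[OF _ tuv(2)] type_order_dvd_cofactor ent tuv(1) by metis
      then show ?thesis by blast
    qed
  qed
  then have "Beauville_structure (D k) {(X1, Y1), (X2, Y2)}"
    using XY1(1) XY2(1) unfolding Beauville_structure_def by blast
  then show ?thesis unfolding Beauville_group_def using group_D by auto
qed

lemma Beauville_group_if_distinct_patterns:
  assumes P: "generating_pair (D k) P R" and s: "length s1 = length s2" "length s2 \<le> k"
    and d: "distinct s1" "distinct s2"
    and pat: "\<And>T. T \<in> set s1 \<union> set s2 \<Longrightarrow> pattern T \<and> (\<exists>x y. realizes G q T x y)"
    and sep: "separated (length s2 = k) s1 s2"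
  shows "Beauville_group (D k)"
proof -
  define f where "f T = (SOME x. \<exists>y. realizes G q T x y)" for T
  define h where "h T = (SOME y. realizes G q T (f T) y)" for T
  have fh: "realizes G q T (f T) (h T)" if "T \<in> set s1 \<union> set s2" for T
  proof -
    have "\<exists>y. realizes G q T (f T) y" unfolding f_def by (rule someI_ex) (use pat[OF that] in blast)
    then show ?thesis unfolding h_def by (rule someI_ex)
  qed
  have nl: "\<not> linked G (f T) (h T) (f T') (h T')" if "T \<in> set s1 \<union> set s2" "T' \<in> set s1 \<union> set s2" "T \<noteq> T'" for T T'
    using linked_realizes[OF fh[OF that(1)] fh[OF that(2)]] pat that by blast
  show ?thesis
  proof (rule Beauville_group_if_separated[OF P s(1) refl s(2)])
    fix c assume "c < length s2"
    then have in_set: "s1 ! c \<in> set s1" "s2 ! c \<in> set s2" using s(1) by simp_all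
    then show "pattern (s1 ! c) \<and> pattern (s2 ! c)" using pat by blast
    show "realizes G q (s1 ! c) (f (s1 ! c)) (h (s1 ! c))" "realizes G q (s2 ! c) (f (s2 ! c)) (h (s2 ! c))"
      using fh in_set by blast+
    fix e assume "e < length s2" "c \<noteq> e"
    with \<open>c < length s2\<close> have "s1 ! c \<noteq> s1 ! e" "s2 ! c \<noteq> s2 ! e" "s1 ! e \<in> set s1" "s2 ! e \<in> set s2"
      using s(1) d by (simp_all add: nth_eq_iff_index_eq)
    then show "\<not> linked G (f (s1 ! c)) (h (s1 ! c)) (f (s1 ! e)) (h (s1 ! e))"
      "\<not> linked G (f (s2 ! c)) (h (s2 ! c)) (f (s2 ! e)) (h (s2 ! e))"
      using nl in_set by blast+
  qed (rule sep)
qed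

lemma purely_strongly_real_if_Beauville:
  assumes "Beauville_group (D k)"
  shows "purely_strongly_real_Beauville_group (D k)"
proof -
  interpret D: group "D k" by (rule group_D)
  have inv: "\<exists>g\<in>carrier (D k). conj_by (D k) X g = inv\<^bsub>D k\<^esub> X \<and> conj_by (D k) Y g = inv\<^bsub>D k\<^esub> Y"
    if gen: "generating_pair (D k) X Y" for X Y
  proof -
    have XY: "X \<in> carrier (D k)" "Y \<in> carrier (D k)" using gen by (auto simp: generating_pair_def)
    have "\<exists>g\<in>carrier G. conj_by G (X c) g = inv (X c) \<and> conj_by G (Y c) g = inv (Y c)" if "c < k" for c
      by (rule inverted) (rule generating_pair_component[OF gen that])
    then obtain g where g: "\<And>c. c < k \<Longrightarrow> g c \<in> carrier G \<and> conj_by G (X c) (g c) = inv (X c) \<and> conj_by G (Y c) (g c) = inv (Y c)"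
      by metis
    define h where "h = (\<lambda>c\<in>{..<k}. g c)"
    have h: "h \<in> carrier (D k)" using g by (simp add: carrier_D h_def restrict_PiE_iff)
    have hc: "h c = g c" if "c < k" for c using that by (simp add: h_def)
    have "conj_by (D k) X h = inv\<^bsub>D k\<^esub> X"
      by (rule D_eqI[of _ k]) (use XY h in \<open>simp_all add: D_conj_by D_inv hc g\<close>)
    moreover have "conj_by (D k) Y h = inv\<^bsub>D k\<^esub> Y"
      by (rule D_eqI[of _ k]) (use XY h in \<open>simp_all add: D_conj_by D_inv hc g\<close>)
    ultimately show ?thesis using h by blast
  qed
  \<comment> \<open>\<open>auto\<close> consists of extensional maps, so the identity has to be
    restricted to the carrier.\<close>
  define \<phi> where "\<phi> = (\<lambda>x\<in>carrier (D k). x)"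
  have \<phi>: "\<phi> \<in> auto (D k)"
    by (simp add: auto_def Bij_def \<phi>_def hom_def bij_betw_def inj_on_def)
  have "strongly_real (D k) S" if st: "Beauville_structure (D k) S" for S
  proof -
    obtain x1 y1 x2 y2 where S: "S = {(x1, y1), (x2, y2)}"
      and gen: "generating_pair (D k) x1 y1" "generating_pair (D k) x2 y2"
      using st unfolding Beauville_structure_def by blast
    have "\<exists>g\<in>carrier (D k). conj_by (D k) (\<phi> x) g = inv\<^bsub>D k\<^esub> x \<and> conj_by (D k) (\<phi> y) g = inv\<^bsub>D k\<^esub> y"
      if "generating_pair (D k) x y" for x y
      using inv[OF that] that by (simp add: \<phi>_def generating_pair_def)
    with gen \<phi> show ?thesis unfolding strongly_real_def S by blast
  qed
  with assms show ?thesis by (simp add: purely_strongly_real_Beauville_group_def)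
qed

end

text \<open>The type lists were found by a computer search. For \<open>k = 2\<close>, two components of the same type \<open>[1,2,2]\<close> are
  needed; they are inequivalent since \<open>y\<close> and \<open>x y\<close> are conjugate in one of them only.\<close>
theorem purely_strongly_real_direct_power:
  assumes k: "k > 0" "(q, k) \<noteq> (4, 1)" and P: "generating_pair (direct_power G k) P R"
    and real: "\<And>T. T \<in> {[2,1,0], [2,1,1], [1,0,2], [0,1,2], [1,2,2], [0,2,1], [2,2,1], [1,2,1], [2,2,2], [1,1,2]}
      \<Longrightarrow> \<exists>x y. realizes G q T x y"
    and real111: "q > 4 \<Longrightarrow> \<exists>x y. realizes G q [1,1,1] x y"
    and real122: "realizes G q [1,2,2] x y" "realizes G q [1,2,2] x' y'"
      "\<exists>g\<in>carrier G. x \<otimes> y = conj_by G y g" "\<not> (\<exists>g\<in>carrier G. x' \<otimes> y' = conj_by G y' g)"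
  shows "purely_strongly_real_Beauville_group (direct_power G k)"
proof (rule purely_strongly_real_if_Beauville)
  let ?R = "{[2,1,0], [2,1,1], [1,0,2], [0,1,2], [1,2,2], [0,2,1], [2,2,1], [1,2,1], [2,2,2], [1,1,2]}"
  have R: "pattern T \<and> (\<exists>x y. realizes G q T x y)" if "T \<in> ?R" for T
  proof
    show "pattern T" using that by (auto simp: pattern_def)
  qed (rule real[OF that])
  consider "k = 1" | "k = 2" | "k = 3" | "k \<ge> 4" using k by linarith
  then show "Beauville_group (direct_power G k)"
  proof cases
    case 1
    then have "q > 4" using k q_ge_4 by auto
    have R1: "pattern [1,1,1] \<and> (\<exists>x y. realizes G q [1,1,1] x y)"
      using real111[OF \<open>q > 4\<close>] by (simp add: pattern_def)
    show ?thesis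
    proof (rule Beauville_group_if_distinct_patterns[OF P, of "[[1,1,1]]" "[[2,2,2]]"])
      fix T :: "nat list" assume "T \<in> set [[1,1,1]] \<union> set [[2,2,2]]"
      then have "T = [1,1,1] \<or> T \<in> ?R" by auto
      then show "pattern T \<and> (\<exists>x y. realizes G q T x y)" using R1 R by blast
    qed (use 1 in \<open>simp_all add: separated_def\<close>)
  next
    case 2
    let ?s1 = "[[0,1,2], [0,2,1]]" and ?s2 = "[[1,2,2], [1,2,2]]"
    obtain a b where ab: "realizes G q [0,1,2] a b" using real[of "[0,1,2]"] by auto
    obtain a' b' where ab': "realizes G q [0,2,1] a' b'" using real[of "[0,2,1]"] by auto
    have in_G: "a \<in> carrier G" "b \<in> carrier G" "x \<in> carrier G" "y \<in> carrier G"
      using ab real122(1) by (auto simp: realizes_def generating_pair_def)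
    have nl: "\<not> linked G a b a' b'" using linked_realizes[OF ab ab'] by (auto simp: pattern_def)
    have nl': "\<not> linked G x y x' y'"
    proof
      assume "linked G x y x' y'"
      then obtain \<phi> where \<phi>: "\<phi> \<in> iso G G" "\<phi> x = x'" "\<phi> y = y'" by (auto simp: linked_def)
      interpret \<phi>: group_hom G G \<phi> using \<phi>(1) by unfold_locales (simp add: iso_def)
      obtain g where g: "g \<in> carrier G" "x \<otimes> y = conj_by G y g" using real122(3) by blast
      have "\<phi> (x \<otimes> y) = \<phi> (conj_by G y g)" using g by simp
      then have "x' \<otimes> y' = conj_by G y' (\<phi> g)" using in_G g(1) \<phi> by (simp add: conj_by_def)
      then show False using real122(4) g(1) by (metis \<phi>.hom_closed)
    qed
    show ?thesis
    proof (rule Beauville_group_if_separated[OF P, of ?s1 2 ?s2])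
      fix c :: nat assume "c < 2"
      then have c: "c = 0 \<or> c = 1" by auto
      then show "pattern (?s1 ! c) \<and> pattern (?s2 ! c)" by (auto simp: pattern_def)
      show "realizes G q (?s1 ! c) (if c = 0 then a else a') (if c = 0 then b else b')"
        using c ab ab' by auto
      show "realizes G q (?s2 ! c) (if c = 0 then x else x') (if c = 0 then y else y')"
        using c real122(1,2) by auto
      fix d :: nat assume "d < 2" "c \<noteq> d"
      then have "c = 0 \<and> d = 1 \<or> c = 1 \<and> d = 0" using c by auto
      then show "\<not> linked G (if c = 0 then a else a') (if c = 0 then b else b') (if d = 0 then a else a') (if d = 0 then b else b')"
        "\<not> linked G (if c = 0 then x else x') (if c = 0 then y else y') (if d = 0 then x else x') (if d = 0 then y else y')"
        using nl nl' linked_sym ab' real122(2) by (auto simp: realizes_def generating_pair_def)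
    qed (use 2 in \<open>simp_all add: separated_def\<close>)
  next
    case 3
    let ?s1 = "[[2,2,2], [2,2,1], [1,0,2]]" and ?s2 = "[[1,1,2], [2,1,1], [1,2,1]]"
    show ?thesis
    proof (rule Beauville_group_if_distinct_patterns[OF P, of ?s1 ?s2])
      fix T :: "nat list" assume "T \<in> set ?s1 \<union> set ?s2"
      then have "T \<in> ?R" by auto
      then show "pattern T \<and> (\<exists>x y. realizes G q T x y)" by (rule R)
    qed (use 3 in \<open>simp_all add: separated_def\<close>)
  next
    case 4
    \<comment> \<open>For \<open>k > 4\<close> the other components are arbitrary, so every type has
      to be separated for every choice of columns, as these four components do.\<close>
    let ?s1 = "[[2,1,0], [2,1,1], [1,0,2], [0,1,2]]" and ?s2 = "[[1,2,2], [0,2,1], [2,2,1], [1,2,1]]"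
    show ?thesis
    proof (rule Beauville_group_if_distinct_patterns[OF P, of ?s1 ?s2])
      fix T :: "nat list" assume "T \<in> set ?s1 \<union> set ?s2"
      then have "T \<in> ?R" by auto
      then show "pattern T \<and> (\<exists>x y. realizes G q T x y)" by (rule R)
    qed (use 4 in \<open>simp_all add: separated_def\<close>)
  qed
qed

end

section \<open>Transport along isomorphisms\<close>

lemma (in group_hom) ord_image_iso:
  assumes "h \<in> iso G H" "x \<in> carrier G"
  shows "H.ord (h x) = G.ord x"
proof (rule H.ord_unique_iff)
  show "h x \<in> carrier H" using assms by simp
  have inj: "inj_on h (carrier G)" using assms(1) by (simp add: Group.iso_iff)
  fix n :: nat
  have "h x [^]\<^bsub>H\<^esub> n = \<one>\<^bsub>H\<^esub> \<longleftrightarrow> h (x [^]\<^bsub>G\<^esub> n) = h \<one>\<^bsub>G\<^esub>" using assms by (simp add: hom_nat_pow)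
  also have "\<dots> \<longleftrightarrow> x [^]\<^bsub>G\<^esub> n = \<one>\<^bsub>G\<^esub>" using inj_on_eq_iff[OF inj, of "x [^]\<^bsub>G\<^esub> n" "\<one>\<^bsub>G\<^esub>"] assms by simp
  finally show "h x [^]\<^bsub>H\<^esub> n = \<one>\<^bsub>H\<^esub> \<longleftrightarrow> G.ord x dvd n" using G.pow_eq_id[OF assms(2)] by simp
qed

lemma (in group_hom) hom_conj_by:
  "\<lbrakk>x \<in> carrier G; g \<in> carrier G\<rbrakk> \<Longrightarrow> h (conj_by G x g) = conj_by H (h x) (h g)"
  by (simp add: conj_by_def)

lemma (in group_hom) generating_pair_image:
  assumes "h \<in> iso G H" "generating_pair G x y"
  shows "generating_pair H (h x) (h y)"
proof -
  have xy: "{x, y} \<subseteq> carrier G" "generate G {x, y} = carrier G"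
    using assms(2) by (auto simp: generating_pair_def)
  have "generate H {h x, h y} = h ` carrier G" using generate_img[OF xy(1)] xy(2) by simp
  also have "\<dots> = carrier H" using assms(1) by (simp add: Group.iso_iff)
  finally show ?thesis using xy(1) by (simp add: generating_pair_def)
qed

lemma (in group_hom) realizes_image:
  assumes "h \<in> iso G H" "realizes G q T x y"
  shows "realizes H q T (h x) (h y)"
proof -
  have xy: "x \<in> carrier G" "y \<in> carrier G" using assms(2) by (auto simp: realizes_def generating_pair_def)
  then have "triple H (h x) (h y) u = h (triple G x y u)" "triple G x y u \<in> carrier G" for u
    by (simp_all add: triple_def)
  then show ?thesis using assms generating_pair_image ord_image_iso by (simp add: realizes_def)
qed

lemma (in L2_like) L2_like_image:
  assumes H: "group H" and h: "h \<in> iso G H"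
  shows "L2_like H q"
proof -
  interpret H: group H by (rule H)
  interpret h: group_hom G H h using h by unfold_locales (simp add: iso_def)
  obtain i where i: "i \<in> iso H G" "\<And>x. x \<in> carrier H \<Longrightarrow> i x \<in> carrier G \<and> h (i x) = x"
  proof
    show "inv_into (carrier G) h \<in> iso H G" by (rule iso_set_sym[OF h])
    fix x assume "x \<in> carrier H"
    then have "x \<in> h ` carrier G" using h by (simp add: Group.iso_iff)
    then show "inv_into (carrier G) h x \<in> carrier G \<and> h (inv_into (carrier G) h x) = x"
      by (simp add: inv_into_into f_inv_into_f)
  qed
  interpret i: group_hom H G i using i(1) by unfold_locales (simp add: iso_def)
  interpret SH: simple_group H by (rule iso_simple[OF H h])
  show ?thesis
  proof unfold_locales
    show "finite (carrier H)" using h finite_carrier by (metis finite_imageI Group.iso_iff)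
    obtain a b where "a \<in> carrier G" "b \<in> carrier G" "a \<otimes> b \<noteq> b \<otimes> a" using nonabelian by blast
    moreover have "inj_on h (carrier G)" using h by (simp add: Group.iso_iff)
    ultimately have "h (a \<otimes> b) \<noteq> h (b \<otimes> a)"
      using inj_onD[of h "carrier G" "a \<otimes> b" "b \<otimes> a"] by auto
    with \<open>a \<in> carrier G\<close> \<open>b \<in> carrier G\<close>
    show "\<exists>a\<in>carrier H. \<exists>b\<in>carrier H. a \<otimes>\<^bsub>H\<^esub> b \<noteq> b \<otimes>\<^bsub>H\<^esub> a"
      by (intro bexI[of _ "h a"] bexI[of _ "h b"]) simp_all
    show "even q" "4 \<le> q" by (rule even_q q_ge_4)+
    show "x [^]\<^bsub>H\<^esub> (2 * (q - 1) * (q + 1)) = \<one>\<^bsub>H\<^esub>" if "x \<in> carrier H" for x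
      using i(2)[OF that] exponent[of "i x"] h.hom_nat_pow[of "i x" "2 * (q - 1) * (q + 1)"] by simp
    show "\<exists>g\<in>carrier H. conj_by H x g = inv\<^bsub>H\<^esub> x \<and> conj_by H y g = inv\<^bsub>H\<^esub> y" if gen: "generating_pair H x y" for x y
    proof -
      have xy: "x \<in> carrier H" "y \<in> carrier H" using gen by (auto simp: generating_pair_def)
      obtain g where g: "g \<in> carrier G" "conj_by G (i x) g = inv (i x)" "conj_by G (i y) g = inv (i y)"
        using inverted[OF i.generating_pair_image[OF i(1) gen]] by blast
      have "conj_by H x (h g) = inv\<^bsub>H\<^esub> x" "conj_by H y (h g) = inv\<^bsub>H\<^esub> y"
        using h.hom_conj_by[of "i x" g] h.hom_conj_by[of "i y" g] i(2)[OF xy(1)] i(2)[OF xy(2)] g by simp_all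
      then show ?thesis using h.hom_closed[OF g(1)] by blast
    qed
  qed
qed

section \<open>Matrices over a field of even order\<close>

definition mat2 :: "'a \<Rightarrow> 'a \<Rightarrow> 'a \<Rightarrow> 'a \<Rightarrow> 'a::zero ^ 2 ^ 2" where
  "mat2 a b c d = vector [vector [a, b], vector [c, d]]"

lemma mat2_nth [simp]:
  "mat2 a b c d $ 1 $ 1 = a" "mat2 a b c d $ 1 $ 2 = b"
  "mat2 a b c d $ 2 $ 1 = c" "mat2 a b c d $ 2 $ 2 = d"
  by (simp_all add: mat2_def)

lemma mat2_eq_iff [simp]:
  "mat2 a b c d = mat2 a' b' c' d' \<longleftrightarrow> a = a' \<and> b = b' \<and> c = c' \<and> d = d'"
  by (metis mat2_nth)

lemma mat2_cases: obtains a b c d where "A = mat2 a b c d"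
proof
  show "A = mat2 (A $ 1 $ 1) (A $ 1 $ 2) (A $ 2 $ 1) (A $ 2 $ 2)"
    by (simp add: vec_eq_iff forall_2)
qed

lemma mat2_mult [simp]:
  "mat2 a b c d ** mat2 a' b' c' d' =
   mat2 (a * a' + b * c') (a * b' + b * d') (c * a' + d * c') (c * b' + d * (d' :: 'a :: semiring_1))"
  by (simp add: vec_eq_iff forall_2 matrix_matrix_mult_def sum_2)

lemma mat2_one: "mat 1 = mat2 1 0 0 (1 :: 'a :: zero_neq_one)"
  by (simp add: vec_eq_iff forall_2 mat_def)

lemma det_mat2 [simp]: "det (mat2 a b c d) = a * d - b * (c :: 'a :: comm_ring_1)"
  by (simp add: det_2)

lemma trace_mat2 [simp]: "trace (mat2 a b c d) = a + d"
  by (simp add: trace_def sum_2)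

section \<open>Generation of \<open>SL2\<close> by transvections\<close>

lemma SL2_simps [simp]:
  "A \<in> carrier SL2 \<longleftrightarrow> det A = 1" "A \<otimes>\<^bsub>SL2\<^esub> B = A ** B" "\<one>\<^bsub>SL2\<^esub> = mat 1"
  by (simp_all add: SL2_def)

lemma inv_SL2:
  assumes "det (mat2 a b c d) = (1 :: 'f :: field)"
  shows "inv\<^bsub>SL2\<^esub> (mat2 a b c d) = mat2 d (- b) (- c) a"
  using assms by (intro group.inv_equality[OF group_SL2]) (simp_all add: mat2_one algebra_simps)

lemma SL2_subgroup_mult:
  "\<lbrakk>subgroup H SL2; A \<in> H; B \<in> H\<rbrakk> \<Longrightarrow> A ** B \<in> H"
  using subgroup.m_closed[of H SL2 A B] by simp

lemma SL2_subgroup_inv: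
  assumes "subgroup H SL2" "mat2 a b c d \<in> H"
  shows "mat2 d (- b) (- c) (a :: 'f :: field) \<in> H"
proof -
  have "det (mat2 a b c d) = 1"
    using subgroup.mem_carrier[OF assms] by simp
  with subgroup.m_inv_closed[OF assms] inv_SL2 show ?thesis by metis
qed

lemma SL2_subgroup_det: "\<lbrakk>subgroup H SL2; A \<in> H\<rbrakk> \<Longrightarrow> det A = 1"
  using subgroup.mem_carrier by fastforce

text \<open>A matrix with \<open>b \<noteq> 0\<close> is a product of a lower, an upper and a lower
  transvection; for \<open>b = 0\<close> a column operation first makes the upper right entry equal
  to \<open>a\<close>, which is then nonzero.\<close>

lemma SL2_eq_if_transvections:
  assumes H: "subgroup H SL2"
    and L: "\<And>e. mat2 1 0 e 1 \<in> H" and U: "\<And>e. mat2 1 e 0 1 \<in> H"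
  shows "H = carrier (SL2 :: ('f::field ^ 2 ^ 2) monoid)"
proof
  show "H \<subseteq> carrier SL2" by (rule subgroup.subset[OF H])
  note m = SL2_subgroup_mult[OF H]
  have *: "mat2 a b c d \<in> H" if d: "a * d - b * c = 1" and b: "b \<noteq> 0" for a b c d
  proof -
    have "mat2 a b c d = (mat2 1 0 ((d - 1) / b) 1 ** mat2 1 b 0 1) ** mat2 1 0 ((a - 1) / b) 1"
      using b d by (simp add: field_simps)
    with m L U show ?thesis by metis
  qed
  show "carrier SL2 \<subseteq> H"
  proof
    fix A :: "'f ^ 2 ^ 2" assume A: "A \<in> carrier SL2"
    obtain a b c d where A': "A = mat2 a b c d" by (rule mat2_cases)
    have d: "a * d - b * c = 1" using A by (simp add: A')
    show "A \<in> H"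
    proof (cases "b = 0")
      case True
      then have "a \<noteq> 0" using d by auto
      then have "mat2 a a c (c + d) \<in> H" using d True by (intro *) (simp_all add: algebra_simps)
      moreover have "A = mat2 a a c (c + d) ** mat2 1 (- 1) 0 1"
        using True by (simp add: A')
      ultimately show ?thesis using m U by metis
    qed (use * d A' in auto)
  qed
qed

text \<open>Clearing the diagonal of the given element by lower transvections leaves an antidiagonal
  one, and conjugation by it exchanges lower and upper transvections.\<close>

lemma SL2_eq_if_lower_transvections:
  assumes H: "subgroup H SL2"
    and L: "\<And>e. mat2 1 0 e 1 \<in> H" and B: "mat2 a b c d \<in> H" "b \<noteq> 0"
  shows "H = carrier (SL2 :: ('f::field ^ 2 ^ 2) monoid)"
proof (rule SL2_eq_if_transvections[OF H L])
  note m = SL2_subgroup_mult[OF H]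
  have d: "a * d - b * c = 1" using SL2_subgroup_det[OF H B(1)] by simp
  have "(mat2 1 0 (- d / b) 1 ** mat2 a b c d) ** mat2 1 0 (- a / b) 1 \<in> H"
    using m L B by metis
  moreover have "(mat2 1 0 (- d / b) 1 ** mat2 a b c d) ** mat2 1 0 (- a / b) 1 = mat2 0 b (- 1 / b) 0"
    using d B(2) by (simp add: divide_simps) (simp add: algebra_simps)
  ultimately have w: "mat2 0 b (- 1 / b) 0 \<in> H" by metis
  fix e
  have "(mat2 0 b (- 1 / b) 0 ** mat2 1 0 (- e / (b * b)) 1) ** mat2 0 (- b) (1 / b) 0 \<in> H"
    using m w L SL2_subgroup_inv[OF H w] by (metis (no_types, opaque_lifting) add.inverse_inverse divide_minus_left)
  then show "mat2 1 e 0 1 \<in> H" using B(2) by simp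
qed

lemma det_mult_one: "\<lbrakk>det A = 1; det B = 1\<rbrakk> \<Longrightarrow> det (A ** B) = (1 :: 'f :: field)"
  by (simp add: det_mul)

lemma SL2_pow_diag: "x \<noteq> 0 \<Longrightarrow> mat2 x 0 0 (1 / x) [^]\<^bsub>SL2\<^esub> (n::nat) = mat2 (x ^ n) 0 0 (1 / (x :: 'f::field) ^ n)"
  by (induction n) (simp_all add: mat2_one field_simps)

section \<open>Arithmetic in characteristic two\<close>

locale even_field =
  fixes F :: "'f::{field,finite} itself" and q :: nat
  assumes card_F: "CARD('f) = q" and q_pow: "\<exists>n. q = 2 ^ n" and q_ge_4: "q \<ge> 4"
begin

abbreviation G :: "('f ^ 2 ^ 2) monoid" where "G \<equiv> SL2"

sublocale G: group G by (rule group_SL2)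

lemma two_eq_0: "(2 :: 'f) = 0"
proof -
  obtain n where "q = 2 ^ n" using q_pow by blast
  moreover have "of_nat q = (0 :: 'f)" using CHAR_dvd_CARD[where 'a = 'f] by (simp add: card_F of_nat_eq_0_iff_char_dvd)
  ultimately show ?thesis by simp
qed

lemma dbl [simp]: "x + x = (0 :: 'f)"
  using two_eq_0 by (metis mult_2 mult_zero_left)

lemma dbl' [simp]: "x + (x + y) = (y :: 'f)"
  by (metis add.assoc add_0 dbl)

text \<open>With the next rule this erases all signs, so polynomial identities are settled by
  multiplying out and cancelling equal summands.\<close>

lemma neg [simp]: "- x = (x :: 'f)"
  by (metis add_eq_0_iff dbl)

lemma diff [simp]: "x - y = x + (y :: 'f)"
  by (metis neg add_uminus_conv_diff)

lemma add_eq_0 [simp]: "x + y = 0 \<longleftrightarrow> x = (y :: 'f)"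
  by (metis add_eq_0_iff neg)

lemmas poly2 = distrib_left distrib_right ac_simps

lemmas ring2 = poly2 dbl dbl' neg diff
  add_0_left add_0_right mult_1_left mult_1_right mult_zero_left mult_zero_right

text \<open>Squaring is additive in characteristic two, hence injective, hence onto. Square roots
  are what allows determinants to be scaled to one.\<close>

lemma sqrt_exists: obtains s where "s * s = (x :: 'f)"
proof -
  have "inj (\<lambda>s::'f. s * s)"
  proof (rule injI)
    fix x y :: 'f assume "x * x = y * y"
    then have "(x + y) * (x + y) = 0" by (simp add: algebra_simps)
    then show "x = y" by simp
  qed
  then have "surj (\<lambda>s::'f. s * s)" by (simp add: finite_UNIV_inj_surj)
  with that show ?thesis by (metis surjD)
qed

lemma sqrt_exists_nz:
  assumes "x \<noteq> (0 :: 'f)" obtains s where "s * s = x" "s \<noteq> 0"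
  using sqrt_exists[of x] assms by (metis mult_zero_left)

lemma obtain_not_in:
  fixes A :: "'f set"
  assumes "card A < q" obtains x where "x \<notin> A"
  using assms card_F by (metis UNIV_eq_I less_irrefl)

lemma ex_not_0_1: obtains x where "x \<noteq> 0" "x \<noteq> (1 :: 'f)"
  using obtain_not_in[of "{0, 1}"] q_ge_4 by auto

section \<open>Subgroups containing a split torus\<close>

lemma lower_transvections_if_torus:
  assumes H: "subgroup H G" and T: "\<And>x. x \<noteq> 0 \<Longrightarrow> mat2 x 0 0 (1 / x) \<in> H"
    and Y: "mat2 y 0 f (1 / y) \<in> H" "y \<noteq> 0" "f \<noteq> 0"
  shows "mat2 1 0 e 1 \<in> H"
proof (cases "e = 0")
  case True
  then show ?thesis using T[of 1] by simp
next
  case False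
  note m = SL2_subgroup_mult[OF H]
  \<comment> \<open>Removing the diagonal of the given matrix with the torus leaves the entry
    \<open>f / y\<close>, which conjugation by \<open>mat2 s 0 0 (1 / s)\<close> divides by
    \<open>s * s\<close>.\<close>
  obtain s where s: "s * s = f / (y * e)" "s \<noteq> 0" 
    using sqrt_exists_nz[of "f / (y * e)"] Y False by auto
  have "(mat2 s 0 0 (1 / s) ** (mat2 y 0 f (1 / y) ** mat2 (1 / y) 0 0 y)) ** mat2 (1 / s) 0 0 s \<in> H"
    using T[of s] T[of "1 / s"] T[of "1 / y"] s Y by (intro m) simp_all
  moreover have "f / (s * s * y) = e" unfolding s(1) using False Y by simp
  ultimately show ?thesis using s(2) Y by (simp add: field_simps)
qed

text \<open>The conditions say that the element fixes neither coordinate axis and does not swap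
  them, which excludes the two Borel subgroups around the torus and its normalizer.\<close>

lemma SL2_eq_if_torus:
  assumes H: "subgroup H G" and T: "\<And>x. x \<noteq> 0 \<Longrightarrow> mat2 x 0 0 (1 / x) \<in> H"
    and B: "mat2 a b c d \<in> H" "b \<noteq> 0" "c \<noteq> 0" "a \<noteq> 0 \<or> d \<noteq> 0"
  shows "H = carrier G"
proof -
  note m = SL2_subgroup_mult[OF H]
  have case0: "H = carrier G" if B: "mat2 0 b c d \<in> H" "d \<noteq> 0" for b c d
  proof -
    obtain x :: 'f where x: "x \<noteq> 0" "x \<noteq> 1" by (rule ex_not_0_1)
    have bc: "b * c = 1" using SL2_subgroup_det[OF H B(1)] by simp
    then have nz: "b \<noteq> 0" "c \<noteq> 0" by auto
    \<comment> \<open>With zero in the upper left corner, conjugating a torus element gives a lower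
      triangular matrix; \<open>x \<noteq> 1\<close> keeps its off-diagonal entry nonzero.\<close>
    have "(mat2 0 b c d ** mat2 x 0 0 (1 / x)) ** mat2 d b c 0 \<in> H"
      using T[OF x(1)] B SL2_subgroup_inv[OF H B(1)] by (intro m) simp_all
    also have "(mat2 0 b c d ** mat2 x 0 0 (1 / x)) ** mat2 d b c 0
      = mat2 (1 / x) 0 (c * d * (x + 1 / x)) (1 / (1 / x))"
      using x bc by (simp add: field_simps)
    finally have "mat2 (1 / x) 0 (c * d * (x + 1 / x)) (1 / (1 / x)) \<in> H" .
    moreover have "x + 1 / x \<noteq> 0"
    proof
      assume "x + 1 / x = 0"
      then have "x * x + 1 = 0" using x by (simp add: field_simps)
      then have "(x + 1) * (x + 1) = 0" by (simp add: algebra_simps)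
      then show False using x by simp
    qed
    ultimately have "mat2 1 0 e 1 \<in> H" for e
      using lower_transvections_if_torus[OF H T, of "1 / x"] nz that x by simp
    then show ?thesis using SL2_eq_if_lower_transvections[OF H _ B(1) nz(1)] by blast
  qed
  have det: "a * d + b * c = 1" using SL2_subgroup_det[OF H B(1)] by simp
  consider "a = 0" "d \<noteq> 0" | "d = 0" "a \<noteq> 0" | "a \<noteq> 0" "d \<noteq> 0" using B by auto
  then show ?thesis
  proof cases
    case 1
    then show ?thesis using case0 B(1) by blast
  next
    case 2
    then show ?thesis using case0[of b c a] SL2_subgroup_inv[OF H B(1)] by simp
  next
    case 3
    \<comment> \<open>Chosen so that the upper left entry \<open>a * a * x + b * c / x\<close> of
      the product below vanishes, which leads back to \<open>case0\<close>.\<close>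
    obtain x where x: "x * x = b * c / (a * a)" "x \<noteq> 0"
      using sqrt_exists_nz[of "b * c / (a * a)"] B 3 by auto
    have "(mat2 a b c d ** mat2 x 0 0 (1 / x)) ** mat2 a b c d \<in> H" (is "?P \<in> H")
      using m T x B by blast
    moreover have "?P = mat2 (a * a * x + b * c / x) (b * (a * x + d / x)) (c * (a * x + d / x)) (b * c * x + d * d / x)"
      by (simp add: algebra_simps)
    moreover have "a * a * x + b * c / x = (a * a * (x * x) + b * c) / x" using x(2) by (simp add: field_simps)
    then have "a * a * x + b * c / x = 0" using 3 by (simp add: x(1))
    moreover have "b * c * x + d * d / x = (b * c * (x * x) + d * d) / x" using x(2) by (simp add: field_simps)
    then have "b * c * x + d * d / x = (b * c + a * d) * (b * c + a * d) / (a * a * x)"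
      unfolding x(1) using 3 x(2) by (simp add: field_simps)
    then have "b * c * x + d * d / x \<noteq> 0" using det x(2) 3 by (simp add: add.commute)
    ultimately show ?thesis using case0 by metis
  qed
qed

section \<open>Traces and conjugacy classes\<close>

lemma conj_companion:
  assumes "det (A :: 'f ^ 2 ^ 2) = 1" "A \<noteq> mat 1"
  obtains P where "det P = 1" "A ** P = P ** mat2 0 1 1 (trace A)"
proof -
  obtain a b c d where A: "A = mat2 a b c d" by (rule mat2_cases)
  have det: "a * d + b * c = 1" using assms A by simp
  have "b \<noteq> 0 \<or> c \<noteq> 0 \<or> a \<noteq> d"
  proof (rule ccontr)
    assume "\<not> ?thesis"
    then have "b = 0" "c = 0" "a = d" by auto
    with det have "(a + 1) * (a + 1) = 0" by (simp add: algebra_simps)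
    then show False using \<open>b = 0\<close> \<open>c = 0\<close> \<open>a = d\<close> assms A by (simp add: mat2_one)
  qed
  \<comment> \<open>\<open>?D\<close> is the determinant with columns \<open>v\<close> and
    \<open>A v\<close>, so \<open>v\<close> is a vector that is not an eigenvector. In the basis
    \<open>v\<close>, \<open>A v\<close> the matrix takes companion form by Cayley-Hamilton.\<close>
  then obtain v1 v2 where nz: "v1 * (c * v1 + d * v2) + v2 * (a * v1 + b * v2) \<noteq> 0" (is "?D \<noteq> 0")
  proof (elim disjE)
    assume "b \<noteq> 0" then show thesis using that[of 0 1] by simp
  next
    assume "c \<noteq> 0" then show thesis using that[of 1 0] by simp
  next
    assume "a \<noteq> d"
    show thesis
    proof (cases "b = 0 \<and> c = 0")
      case True
      then show ?thesis using that[of 1 1] \<open>a \<noteq> d\<close> by simp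
    next
      case False
      then show ?thesis using that[of 1 0] that[of 0 1] by auto
    qed
  qed
  then obtain s where s: "s * s = 1 / ?D" using sqrt_exists by blast
  define P where "P = mat2 (s * v1) (s * (a * v1 + b * v2)) (s * v2) (s * (c * v1 + d * v2))"
  have "det P = s * s * ?D" by (simp add: P_def algebra_simps)
  then have 1: "det P = 1" using nz by (simp add: s)
  have bc: "b * c = 1 + a * d" using dbl'[of "a * d" "b * c"] det by (simp add: add.commute)
  have *: "z * (b * c) = z + z * (a * d)" for z unfolding bc by (simp only: ring2)
  have "a * (s * (a * v1 + b * v2)) + b * (s * (c * v1 + d * v2))
      = s * v1 * (b * c) + (a * (s * (a * v1 + b * v2)) + b * (s * (d * v2)))"
    by (simp only: ring2)
  also have "\<dots> = s * v1 + s * (a * v1 + b * v2) * (a + d)"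
    unfolding * by (simp only: ring2)
  finally have 2: "a * (s * (a * v1 + b * v2)) + b * (s * (c * v1 + d * v2))
      = s * v1 + s * (a * v1 + b * v2) * (a + d)" .
  have "c * (s * (a * v1 + b * v2)) + d * (s * (c * v1 + d * v2))
      = s * v2 * (b * c) + (c * (s * (a * v1)) + d * (s * (c * v1 + d * v2)))"
    by (simp only: ring2)
  also have "\<dots> = s * v2 + s * (c * v1 + d * v2) * (a + d)"
    unfolding * by (simp only: ring2)
  finally have 3: "c * (s * (a * v1 + b * v2)) + d * (s * (c * v1 + d * v2))
      = s * v2 + s * (c * v1 + d * v2) * (a + d)" .
  have "A ** P = P ** mat2 0 1 1 (trace A)"
    unfolding A P_def mat2_mult trace_mat2 2 3 by (simp add: ac_simps distrib_left)
  with 1 that show thesis by blast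
qed

text \<open>Both are conjugate to the same companion matrix by matrices of determinant one, so
  outside the identity the trace determines the class. Prescribing a trace thus prescribes an
  order.\<close>

lemma conj_same_trace:
  assumes "A \<in> carrier G" "B \<in> carrier G" "A \<noteq> mat 1" "B \<noteq> mat 1" "trace A = trace B"
  obtains P where "P \<in> carrier G" "B = conj_by G A P"
proof -
  let ?C = "mat2 0 1 1 (trace A)"
  obtain P where P: "det P = 1" "A ** P = P ** ?C"
    using conj_companion[of A] assms by (metis SL2_simps(1))
  obtain Q where Q: "det Q = 1" "B ** Q = Q ** ?C"
    using conj_companion[of B] assms by (metis SL2_simps(1))
  have PQ: "P \<in> carrier G" "Q \<in> carrier G" "?C \<in> carrier G" using P Q by simp_all
  have A: "A = conj_by G ?C P"
    using P(2) PQ assms by (intro G.eq_conj_byI) simp_all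
  have B: "B = conj_by G ?C Q"
    using Q(2) PQ assms by (intro G.eq_conj_byI) simp_all
  have "conj_by G A (inv\<^bsub>G\<^esub> P) = ?C"
    using G.conj_by_inverse[OF PQ(3) PQ(1)] unfolding A[symmetric] .
  then have "B = conj_by G A (Q \<otimes>\<^bsub>G\<^esub> inv\<^bsub>G\<^esub> P)"
    using B G.conj_by_conj_by[OF assms(1) G.inv_closed[OF PQ(1)] PQ(2)] by simp
  moreover have "Q \<otimes>\<^bsub>G\<^esub> inv\<^bsub>G\<^esub> P \<in> carrier G"
    using PQ by (intro G.m_closed G.inv_closed)
  ultimately show thesis by (rule that[rotated])
qed

lemma ord_same_trace:
  assumes "A \<in> carrier G" "B \<in> carrier G" "A \<noteq> mat 1" "B \<noteq> mat 1" "trace A = trace B"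
  shows "G.ord A = G.ord B"
proof -
  obtain P where "P \<in> carrier G" "B = conj_by G A P" by (rule conj_same_trace[OF assms])
  then show ?thesis using G.ord_conj_by[OF assms(1)] by simp
qed

lemma finite_G [simp]: "finite (carrier G)"
  by (rule finite)

section \<open>Elements of order \<open>q - 1\<close> and \<open>q + 1\<close>\<close>

lemma ex_primitive:
  obtains g :: 'f where "g \<noteq> 0" "\<And>x. x \<noteq> 0 \<Longrightarrow> \<exists>i. x = g ^ i" "\<And>n. g ^ n = 1 \<longleftrightarrow> (q - 1) dvd n"
proof -
  \<comment> \<open>The field type is repackaged as a \<open>ring\<close> record, to which the
    cyclicity of finite multiplicative groups applies.\<close>
  define R :: "'f ring" where "R = \<lparr>carrier = UNIV, monoid.mult = (*), one = 1, zero = 0, add = (+)\<rparr>"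
  have car: "carrier R = UNIV" "\<zero>\<^bsub>R\<^esub> = 0" "\<one>\<^bsub>R\<^esub> = 1" by (simp_all add: R_def)
  have "cring R"
  proof (rule cringI)
    show "abelian_group R"
      by (rule abelian_groupI) (auto simp: R_def algebra_simps)
    show "comm_monoid R"
      by (rule comm_monoidI) (auto simp: R_def algebra_simps)
  qed (auto simp: R_def algebra_simps)
  then interpret R: cring R .
  have "field R"
  proof (rule R.cring_fieldI)
    show "Units R = carrier R - {\<zero>\<^bsub>R\<^esub>}"
    proof (intro equalityI subsetI)
      fix x assume "x \<in> carrier R - {\<zero>\<^bsub>R\<^esub>}"
      then have "(1 / x) \<otimes>\<^bsub>R\<^esub> x = \<one>\<^bsub>R\<^esub>" "x \<otimes>\<^bsub>R\<^esub> (1 / x) = \<one>\<^bsub>R\<^esub>" by (simp_all add: R_def)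
      then show "x \<in> Units R" by (auto simp: Units_def car)
    qed (auto simp: Units_def R_def)
  qed
  then interpret R: field R .
  have pow: "x [^]\<^bsub>R\<^esub> n = x ^ n" for x :: 'f and n :: nat
    by (induction n) (simp_all add: R_def)
  interpret M: group "mult_of R" by (rule R.field_mult_group)
  have fin: "finite (carrier (mult_of R))" by (simp add: car)
  obtain g where g: "g \<in> carrier (mult_of R)"
    "carrier (mult_of R) = {g [^]\<^bsub>R\<^esub> i | i::nat. i \<in> UNIV}"
    using R.finite_field_mult_group_has_gen by (auto simp: car)
  have "M.ord g = order (mult_of R)"
    using M.ord_generator[OF fin g(1)] g(2) by (simp add: nat_pow_mult_of)
  also have "\<dots> = q - 1" by (simp add: R.order_mult_of order_def car card_F)
  finally have o: "M.ord g = q - 1" .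
  show thesis
  proof
    show "g \<noteq> 0" using g(1) by (simp add: car)
    fix x :: 'f assume "x \<noteq> 0"
    then have "x \<in> carrier (mult_of R)" by (simp add: car)
    then show "\<exists>i. x = g ^ i" unfolding g(2) pow by blast
  next
    fix n
    show "g ^ n = 1 \<longleftrightarrow> (q - 1) dvd n"
      using M.pow_eq_id[OF g(1), of n] o by (simp add: nat_pow_mult_of pow car)
  qed
qed

lemma power_q [simp]: "x ^ q = (x :: 'f)"
proof (cases "x = 0")
  case False
  obtain g :: 'f where "\<And>x. x \<noteq> 0 \<Longrightarrow> \<exists>i. x = g ^ i" "\<And>n. g ^ n = 1 \<longleftrightarrow> (q - 1) dvd n"
    using ex_primitive by metis
  with False have "x ^ (q - 1) = 1" by (metis dvd_refl mult.commute power_mult power_one)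
  moreover have "x ^ q = x ^ (q - 1) * x" using q_ge_4 by (metis Suc_pred' mult.commute not_numeral_le_zero power_Suc zero_less_iff_neq_zero)
  ultimately show ?thesis by simp
qed (use q_ge_4 in simp)

lemma ex_no_artin_schreier_root: "\<exists>c::'f. \<forall>x. x * x + x + c \<noteq> 0"
proof -
  have "\<not> inj (\<lambda>x::'f. x * x + x)"
  proof
    assume "inj (\<lambda>x::'f. x * x + x)"
    then have "(0::'f) = 1" by (rule injD) simp
    then show False by simp
  qed
  then have "\<not> surj (\<lambda>x::'f. x * x + x)" using finite_UNIV_surj_inj[OF finite] by blast
  then show ?thesis unfolding surj_def add_eq_0 by metis
qed

text \<open>\<open>K\<close> adjoins a root \<open>w\<close> of \<open>X^2 + X + c\<close> to the
  field, with \<open>(x, y)\<close> standing for \<open>x + y w\<close>, and \<open>m\<close> is its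
  regular representation, so \<open>det (m u)\<close> is the norm. For a generator \<open>g\<close>
  of the multiplicative group, the \<open>(q - 1)\<close>-th power has norm one and order
  \<open>q + 1\<close>.\<close>

lemma ex_ord_Suc_q: obtains A where "A \<in> carrier G" "G.ord A = q + 1"
proof -
  obtain c :: 'f where c: "\<And>x. x * x + x + c \<noteq> 0" using ex_no_artin_schreier_root by blast
  define K :: "('f \<times> 'f) ring" where "K = \<lparr>carrier = UNIV,
     monoid.mult = (\<lambda>(x, y) (x', y'). (x * x' + c * y * y', x * y' + x' * y + y * y')),
     one = (1, 0), zero = (0, 0), add = (\<lambda>(x, y) (x', y'). (x + x', y + y'))\<rparr>"
  define m :: "'f \<times> 'f \<Rightarrow> 'f ^ 2 ^ 2" where "m = (\<lambda>(x, y). mat2 x (c * y) y (x + y))"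
  have N: "det (m u) \<noteq> 0" if "u \<noteq> (0, 0)" for u
  proof
    assume *: "det (m u) = 0"
    obtain x y where u: "u = (x, y)" by (cases u)
    have e: "x * x + x * y + c * y * y = 0" using * by (simp add: u m_def poly2)
    show False
    proof (cases "y = 0")
      case True
      then show False using e that u by simp
    next
      case False
      have "(x / y) * (x / y) + x / y + c = (x * x + x * y + c * y * y) / (y * y)"
        using False by (simp add: field_simps)
      then show False using c[of "x / y"] e by simp
    qed
  qed
  have car: "carrier K = UNIV" "\<zero>\<^bsub>K\<^esub> = (0, 0)" "\<one>\<^bsub>K\<^esub> = (1, 0)" by (simp_all add: K_def)
  have "cring K"
  proof (rule cringI)
    show "abelian_group K"
      by (rule abelian_groupI) (auto simp: K_def ring2)
    show "comm_monoid K"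
      by (rule comm_monoidI) (auto simp: K_def ring2)
  qed (auto simp: K_def ring2)
  then interpret K: cring K .
  have "field K"
  proof (rule K.cring_fieldI)
    show "Units K = carrier K - {\<zero>\<^bsub>K\<^esub>}"
    proof (intro equalityI subsetI)
      fix u assume "u \<in> Units K"
      then show "u \<in> carrier K - {\<zero>\<^bsub>K\<^esub>}" by (auto simp: Units_def K_def)
    next
      fix u assume u: "u \<in> carrier K - {\<zero>\<^bsub>K\<^esub>}"
      obtain x y where xy: "u = (x, y)" by (cases u)
      define n where "n = x * x + x * y + c * y * y"
      have "n \<noteq> 0" using N[of u] u by (simp add: xy m_def n_def K_def poly2)
      then have "x * ((x + y) / n) + c * y * (y / n) = 1" "x * (y / n) + (x + y) / n * y + y * (y / n) = 0"
      proof -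
        assume n: "n \<noteq> 0"
        have "x * ((x + y) / n) + c * y * (y / n) = (x * (x + y) + c * y * y) / n"
          by (simp add: add_divide_distrib distrib_left distrib_right)
        also have "x * (x + y) + c * y * y = n" by (simp only: n_def ring2)
        finally show "x * ((x + y) / n) + c * y * (y / n) = 1" using n by simp
        have "x * (y / n) + (x + y) / n * y + y * (y / n) = (x * y + (x + y) * y + y * y) / n"
          by (simp add: add_divide_distrib distrib_left distrib_right)
        also have "x * y + (x + y) * y + y * y = 0" by (simp only: ring2)
        finally show "x * (y / n) + (x + y) / n * y + y * (y / n) = 0" by simp
      qed
      then have "((x + y) / n, y / n) \<otimes>\<^bsub>K\<^esub> u = \<one>\<^bsub>K\<^esub>" "u \<otimes>\<^bsub>K\<^esub> ((x + y) / n, y / n) = \<one>\<^bsub>K\<^esub>"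
        by (simp_all add: xy K_def poly2)
      then show "u \<in> Units K" by (auto simp: Units_def car)
    qed
  qed
  then interpret K: field K .
  interpret M: group "mult_of K" by (rule K.field_mult_group)
  have fin: "finite (carrier (mult_of K))" by (simp add: car)
  obtain g where g: "g \<in> carrier (mult_of K)"
    "carrier (mult_of K) = {g [^]\<^bsub>K\<^esub> i | i::nat. i \<in> UNIV}"
    using K.finite_field_mult_group_has_gen by (auto simp: car)
  have "M.ord g = order (mult_of K)"
    using M.ord_generator[OF fin g(1)] g(2) by (simp add: nat_pow_mult_of)
  also have "\<dots> = q * q - 1" by (simp add: K.order_mult_of order_def car card_F flip: UNIV_Times_UNIV)
  also have "\<dots> = (q - 1) * (q + 1)" using q_ge_4 by (simp add: algebra_simps)
  finally have o: "M.ord g = (q - 1) * (q + 1)" .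
  have m_mult: "m (u \<otimes>\<^bsub>K\<^esub> v) = m u ** m v" for u v
    by (cases u; cases v) (simp add: m_def K_def poly2)
  have m_one: "m u = mat 1 \<longleftrightarrow> u = \<one>\<^bsub>K\<^esub>" for u
    by (cases u) (auto simp: m_def K_def mat2_one)
  define A where "A = m (g [^]\<^bsub>K\<^esub> (q - 1))"
  have "det (m (g [^]\<^bsub>K\<^esub> n)) = det (m g) ^ n" for n :: nat
    by (induction n) (simp_all add: m_mult det_mul, simp add: m_def car)
  then have "det A = det (m g) ^ (q - 1)" by (simp add: A_def)
  moreover have "det (m g) \<noteq> 0" using N g(1) by (simp add: car)
  then have "det (m g) ^ (q - 1) = 1"
    using power_q[of "det (m g)"] q_ge_4
    by (metis One_nat_def Suc_pred' mult_cancel_right1 not_numeral_le_zero power_Suc2 zero_less_iff_neq_zero)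
  ultimately have A: "A \<in> carrier G" by simp
  have pow: "A [^]\<^bsub>G\<^esub> n = m (g [^]\<^bsub>K\<^esub> ((q - 1) * n))" for n :: nat
  proof (induction n)
    case 0
    then show ?case using m_one[of "\<one>\<^bsub>K\<^esub>"] by simp
  next
    case (Suc n)
    have *: "(q - 1) * Suc n = (q - 1) * n + (q - 1)" by simp
    have "g [^]\<^bsub>K\<^esub> ((q - 1) * Suc n) = g [^]\<^bsub>K\<^esub> ((q - 1) * n) \<otimes>\<^bsub>K\<^esub> g [^]\<^bsub>K\<^esub> (q - 1)"
      unfolding * by (rule K.nat_pow_mult[symmetric]) (simp add: car)
    then show ?case using Suc by (simp add: A_def m_mult)
  qed
  have "G.ord A = q + 1"
  proof (rule G.ord_unique_iff[OF A])
    fix n :: nat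
    have "A [^]\<^bsub>G\<^esub> n = \<one>\<^bsub>G\<^esub> \<longleftrightarrow> g [^]\<^bsub>K\<^esub> ((q - 1) * n) = \<one>\<^bsub>K\<^esub>"
      by (simp add: pow m_one)
    also have "\<dots> \<longleftrightarrow> (q - 1) * (q + 1) dvd (q - 1) * n"
      using M.pow_eq_id[OF g(1), of "(q - 1) * n"] o by (simp add: nat_pow_mult_of)
    also have "\<dots> \<longleftrightarrow> q + 1 dvd n"
      by (rule nat_mult_dvd_cancel1) (use q_ge_4 in simp)
    finally show "A [^]\<^bsub>G\<^esub> n = \<one>\<^bsub>G\<^esub> \<longleftrightarrow> q + 1 dvd n" .
  qed
  with A that show thesis by blast
qed

text \<open>Since \<open>A\<^sup>2 = t A + 1\<close>, squaring repeatedly gives \<open>A ^ (2 ^ j) = t ^ (2 ^ j - 1) A + s\<close>, and for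
  \<open>2 ^ j = q\<close> the coefficient of \<open>A\<close> is \<open>1\<close>.\<close>
lemma pow_two_power:
  assumes "t \<noteq> 0"
  shows "\<exists>s. \<forall>a b c d. a * d + b * c = 1 \<longrightarrow> a + d = t \<longrightarrow>
    mat2 a b c d [^]\<^bsub>G\<^esub> ((2::nat) ^ j) =
      mat2 (t ^ (2 ^ j) / t * a + s) (t ^ (2 ^ j) / t * b) (t ^ (2 ^ j) / t * c) (t ^ (2 ^ j) / t * d + s)"
proof (induction j)
  case 0
  show ?case using assms by (intro exI[of _ 0]) (simp add: mat2_one)
next
  case (Suc j)
  then obtain s where IH: "\<And>a b c d. \<lbrakk>a * d + b * c = 1; a + d = t\<rbrakk> \<Longrightarrow>
    mat2 a b c d [^]\<^bsub>G\<^esub> ((2::nat) ^ j) =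
      mat2 (t ^ (2 ^ j) / t * a + s) (t ^ (2 ^ j) / t * b) (t ^ (2 ^ j) / t * c) (t ^ (2 ^ j) / t * d + s)"
    by blast
  define u where "u = t ^ (2 ^ j) / t"
  have u2: "t ^ (2 ^ Suc j) / t = u * u * t"
    using assms by (simp add: u_def power_mult power2_eq_square field_simps)
  show ?case
  proof (intro exI[of _ "u * u + s * s"] allI impI)
    fix a b c d assume det: "a * d + b * c = 1" and tr: "a + d = t"
    have A: "mat2 a b c d \<in> carrier G" using det by simp
    have "mat2 a b c d [^]\<^bsub>G\<^esub> ((2::nat) ^ Suc j) = (mat2 a b c d [^]\<^bsub>G\<^esub> ((2::nat) ^ j)) \<otimes>\<^bsub>G\<^esub> (mat2 a b c d [^]\<^bsub>G\<^esub> ((2::nat) ^ j))"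
      by (subst G.nat_pow_mult[OF A]) (simp add: mult_2)
    also have "\<dots> = mat2 (u * a + s) (u * b) (u * c) (u * d + s) ** mat2 (u * a + s) (u * b) (u * c) (u * d + s)"
      unfolding IH[OF det tr] u_def SL2_simps(2) ..
    also have "\<dots> = mat2 (u * u * t * a + (u * u + s * s)) (u * u * t * b) (u * u * t * c) (u * u * t * d + (u * u + s * s))"
    proof -
      have *: "u * u = u * u * (a * d) + u * u * (b * c)" by (simp flip: distrib_left add: det)
      show ?thesis
        unfolding mat2_mult mat2_eq_iff tr[symmetric]
        by (subst (2 6) *) (simp add: poly2)
    qed
    finally show "mat2 a b c d [^]\<^bsub>G\<^esub> ((2::nat) ^ Suc j) =
      mat2 (t ^ (2 ^ Suc j) / t * a + (u * u + s * s)) (t ^ (2 ^ Suc j) / t * b) (t ^ (2 ^ Suc j) / t * c) (t ^ (2 ^ Suc j) / t * d + (u * u + s * s))"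
      unfolding u2 .
  qed
qed

lemma SL2_exponent:
  assumes A: "A \<in> carrier G"
  shows "A [^]\<^bsub>G\<^esub> (2 * (q - 1) * (q + 1)) = \<one>\<^bsub>G\<^esub>"
proof -
  obtain a b c d where A': "A = mat2 a b c d" by (rule mat2_cases)
  have det: "a * d + b * c = 1" using A by (simp add: A')
  show ?thesis
  proof (cases "a = d")
    case True
    have "a * a + b * c = 1" "b * c + a * a = 1" using det True by (simp_all add: add.commute)
    then have "A [^]\<^bsub>G\<^esub> (2::nat) = \<one>\<^bsub>G\<^esub>"
      by (simp add: A' True numeral_2_eq_2 mat2_one mult.commute flip: distrib_left)
    then show ?thesis unfolding G.pow_eq_id[OF A] by (metis dvd_mult2 mult.assoc)
  next
    case False
    then have t: "a + d \<noteq> 0" by simp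
    obtain n where n: "q = 2 ^ n" using q_pow by blast
    obtain s where s: "\<And>a' b' c' d'. \<lbrakk>a' * d' + b' * c' = 1; a' + d' = a + d\<rbrakk> \<Longrightarrow>
      mat2 a' b' c' d' [^]\<^bsub>G\<^esub> q = mat2 (a' + s) b' c' (d' + s)"
      using pow_two_power[OF t, of n] t by (auto simp flip: n)
    have Aq: "A [^]\<^bsub>G\<^esub> q = mat2 (a + s) b c (d + s)" using s[OF det] A' by simp
    moreover have "A [^]\<^bsub>G\<^esub> q \<in> carrier G" by (rule G.nat_pow_closed[OF A])
    ultimately have "(a + s) * (d + s) + b * c = 1" by simp
    \<comment> \<open>The \<open>q\<close>-th power has the same trace as \<open>A\<close>, and
      \<open>s\<close> depends on the trace only, so the next \<open>q\<close>-th power adds the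
      same \<open>s\<close> again and cancels it.\<close>
    then have "mat2 (a + s) b c (d + s) [^]\<^bsub>G\<^esub> q = mat2 (a + s + s) b c (d + s + s)"
      by (rule s) (simp add: poly2)
    then have "A [^]\<^bsub>G\<^esub> (q * q) = A"
      using G.nat_pow_pow[OF A, of q q] Aq by (simp add: A' add.assoc)
    moreover have "q * q = Suc ((q - 1) * (q + 1))" using q_ge_4 by (simp add: algebra_simps)
    ultimately have "A [^]\<^bsub>G\<^esub> ((q - 1) * (q + 1)) \<otimes>\<^bsub>G\<^esub> A = A" by (metis G.nat_pow_Suc)
    then have "A [^]\<^bsub>G\<^esub> ((q - 1) * (q + 1)) = \<one>\<^bsub>G\<^esub>"
      using G.r_cancel_one[OF A G.nat_pow_closed[OF A]] by blast
    then show ?thesis unfolding G.pow_eq_id[OF A] by (metis dvd_mult mult.assoc)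
  qed
qed

text \<open>The stabilizer \<open>P\<close> of a line is proper, since the two elementary
  transvections fix different lines. The eigenvector conditions are cross-multiplied, so no
  eigenvalue has to be named.\<close>

lemma generating_pair_no_common_eigenvector:
  assumes gen: "generating_pair G (mat2 a b c d) (mat2 a' b' c' d')" and v: "v \<noteq> 0 \<or> w \<noteq> 0"
    and A: "w * (a * v + b * w) = v * (c * v + d * w)" and B: "w * (a' * v + b' * w) = v * (c' * v + d' * w)"
  shows False
proof -
  define P where "P = {mat2 e f g h | e f g h. e * h + f * g = 1 \<and>
    (\<exists>m. e * v + f * w = m * v \<and> g * v + h * w = m * w)}"
  have eig: "\<exists>m. x = m * v \<and> y = m * w" if "w * x = v * y" for x y
  proof (cases "v = 0")
    case True
    with v that show ?thesis by (intro exI[of _ "y / w"]) auto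
  next
    case False
    with that show ?thesis by (intro exI[of _ "x / v"]) (simp add: field_simps)
  qed
  have "subgroup P G"
  proof (rule G.subgroupI)
    show "P \<subseteq> carrier G" by (auto simp: P_def)
    have "mat2 1 0 0 1 \<in> P" by (auto simp: P_def)
    then show "P \<noteq> {}" by blast
  next
    fix X assume "X \<in> P"
    then obtain e f g h m where X: "X = mat2 e f g h" "e * h + f * g = 1"
      and m: "e * v + f * w = m * v" "g * v + h * w = m * w" unfolding P_def by blast
    have "m * (h * v + f * w) = h * (m * v) + f * (m * w)" by (simp add: poly2)
    also have "\<dots> = (e * h + f * g) * v" unfolding m[symmetric] by (simp add: poly2)
    finally have 1: "m * (h * v + f * w) = v" using X by simp
    have "m * (g * v + e * w) = g * (m * v) + e * (m * w)" by (simp add: poly2)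
    also have "\<dots> = (e * h + f * g) * w" unfolding m[symmetric] by (simp add: poly2)
    finally have 2: "m * (g * v + e * w) = w" using X by simp
    have "m \<noteq> 0" using 1 2 v by auto
    then have "h * v + f * w = 1 / m * v" "g * v + e * w = 1 / m * w"
      using 1 2 by (simp_all add: field_simps)
    then have "\<exists>m. h * v + f * w = m * v \<and> g * v + e * w = m * w" by blast
    then have "mat2 h f g e \<in> P" using X by (simp add: P_def mult.commute)
    moreover have "inv\<^bsub>G\<^esub> X = mat2 h f g e" unfolding X(1) by (subst inv_SL2) (use X in simp_all)
    ultimately show "inv\<^bsub>G\<^esub> X \<in> P" by simp
  next
    fix X Y assume "X \<in> P" "Y \<in> P"
    then obtain e f g h m e' f' g' h' m' where X: "X = mat2 e f g h" "e * h + f * g = 1"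
      and m: "e * v + f * w = m * v" "g * v + h * w = m * w"
      and Y: "Y = mat2 e' f' g' h'" "e' * h' + f' * g' = 1"
      and m': "e' * v + f' * w = m' * v" "g' * v + h' * w = m' * w" unfolding P_def by blast
    have "det X = 1" "det Y = 1" using X Y by simp_all
    then have "det (X ** Y) = 1" by (rule det_mult_one)
    then have "(e * e' + f * g') * (g * f' + h * h') + (e * f' + f * h') * (g * e' + h * g') = 1"
      by (simp add: X(1) Y(1))
    moreover have "(e * e' + f * g') * v + (e * f' + f * h') * w = e * (e' * v + f' * w) + f * (g' * v + h' * w)"
      by (simp add: poly2)
    then have "(e * e' + f * g') * v + (e * f' + f * h') * w = m' * (e * v + f * w)"
      unfolding m' by (simp add: poly2)
    then have "(e * e' + f * g') * v + (e * f' + f * h') * w = (m' * m) * v"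
      unfolding m by (simp add: poly2)
    moreover have "(g * e' + h * g') * v + (g * f' + h * h') * w = g * (e' * v + f' * w) + h * (g' * v + h' * w)"
      by (simp add: poly2)
    then have "(g * e' + h * g') * v + (g * f' + h * h') * w = m' * (g * v + h * w)"
      unfolding m' by (simp add: poly2)
    then have "(g * e' + h * g') * v + (g * f' + h * h') * w = (m' * m) * w"
      unfolding m by (simp add: poly2)
    ultimately show "X \<otimes>\<^bsub>G\<^esub> Y \<in> P" unfolding X(1) Y(1) P_def SL2_simps(2) mat2_mult
      by blast
  qed
  moreover have "{mat2 a b c d, mat2 a' b' c' d'} \<subseteq> P"
    using gen eig[OF A] eig[OF B] by (auto simp: P_def generating_pair_def)
  ultimately have "carrier G \<subseteq> P"
    using G.generate_subgroup_incl gen unfolding generating_pair_def by metis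
  moreover have "mat2 1 0 1 1 \<in> carrier G" "mat2 1 1 0 1 \<in> carrier G" by simp_all
  ultimately have "mat2 1 0 1 1 \<in> P" "mat2 1 1 0 1 \<in> P" by blast+
  then show False using v by (auto simp: P_def)
qed

text \<open>If \<open>A B + B A\<close> is singular, its kernel contains a common eigenline of \<open>A\<close> and \<open>B\<close>.\<close>
lemma generating_pair_inverted:
  assumes gen: "generating_pair G A B"
  shows "\<exists>g\<in>carrier G. conj_by G A g = inv\<^bsub>G\<^esub> A \<and> conj_by G B g = inv\<^bsub>G\<^esub> B"
proof -
  have AB: "A \<in> carrier G" "B \<in> carrier G" using gen by (auto simp: generating_pair_def)
  obtain a b c d where A: "A = mat2 a b c d" by (rule mat2_cases)
  obtain a' b' c' d' where B: "B = mat2 a' b' c' d'" by (rule mat2_cases)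
  have det: "a * d + b * c = 1" "a' * d' + b' * c' = 1" using AB A B by simp_all
  \<comment> \<open>Entries of \<open>A B + B A\<close>; its trace is zero, so both diagonal entries
    are \<open>p\<close>.\<close>
  define p m1 m2 where "p = b * c' + c * b'" and "m1 = a * b' + b * d' + a' * b + b' * d"
    and "m2 = c * a' + d * c' + c' * a + d' * c"
  \<comment> \<open>The traces of \<open>A (A B + B A)\<close> and
    \<open>B (A B + B A)\<close>.\<close>
  have trA: "(a + d) * p + b * m2 + c * m1 = 0" and trB: "(a' + d') * p + b' * m2 + c' * m1 = 0"
    unfolding p_def m1_def m2_def by (simp_all add: poly2)
  have D: "p * p + m1 * m2 \<noteq> 0"
  proof
    assume "p * p + m1 * m2 = 0"
    then have pp: "p * p = m1 * m2" by simp
    \<comment> \<open>When the determinant vanishes, \<open>(m1, p)\<close> and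
      \<open>(p, m2)\<close> lie in the kernel; by \<open>l1\<close> and \<open>l2\<close> each is
      zero or a common eigenvector.\<close>
    have l1: "p * (a * m1 + b * p) + m1 * (c * m1 + d * p) = m1 * ((a + d) * p + b * m2 + c * m1) + b * (p * p + m1 * m2)" for a b c d
      by (simp add: poly2)
    have l2: "m2 * (a * p + b * m2) + p * (c * p + d * m2) = m2 * ((a + d) * p + b * m2 + c * m1) + c * (p * p + m1 * m2)" for a b c d
      by (simp add: poly2)
    have "p = 0" "m1 = 0" "m2 = 0"
      using generating_pair_no_common_eigenvector[OF gen[unfolded A B], of m1 p]
        l1[of a b c d] l1[of a' b' c' d'] trA trB
        generating_pair_no_common_eigenvector[OF gen[unfolded A B], of p m2]
        l2[of a b c d] l2[of a' b' c' d'] unfolding pp by auto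
    then have "A \<otimes>\<^bsub>G\<^esub> B = B \<otimes>\<^bsub>G\<^esub> A"
      by (simp add: A B p_def m1_def m2_def ac_simps)
    from G.generating_pair_comm[OF gen this, of "mat2 1 0 1 1" "mat2 1 1 0 1"]
    show False by simp
  qed
  then obtain s where s: "s * s = 1 / (p * p + m1 * m2)" using sqrt_exists by blast
  define g where "g = mat2 (s * p) (s * m1) (s * m2) (s * p)"
  have "det g = (s * s) * (p * p + m1 * m2)" by (simp add: g_def poly2)
  then have g: "g \<in> carrier G" using D by (simp add: s)
  have inv: "inv\<^bsub>G\<^esub> A = mat2 d b c a" "inv\<^bsub>G\<^esub> B = mat2 d' b' c' a'"
    unfolding A B by (subst inv_SL2; use det in simp)+
  have "A = conj_by G (inv\<^bsub>G\<^esub> A) g"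
  proof (rule G.eq_conj_byI[OF AB(1) G.inv_closed[OF AB(1)] g])
    show "A \<otimes>\<^bsub>G\<^esub> g = g \<otimes>\<^bsub>G\<^esub> inv\<^bsub>G\<^esub> A"
      unfolding inv unfolding A g_def SL2_simps(2) mat2_mult mat2_eq_iff p_def m1_def m2_def
      by (simp add: poly2)
  qed
  then have 1: "conj_by G A (inv\<^bsub>G\<^esub> g) = inv\<^bsub>G\<^esub> A"
    using G.conj_by_inverse[OF G.inv_closed[OF AB(1)] g] by simp
  have "B = conj_by G (inv\<^bsub>G\<^esub> B) g"
  proof (rule G.eq_conj_byI[OF AB(2) G.inv_closed[OF AB(2)] g])
    show "B \<otimes>\<^bsub>G\<^esub> g = g \<otimes>\<^bsub>G\<^esub> inv\<^bsub>G\<^esub> B"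
      unfolding inv unfolding B g_def SL2_simps(2) mat2_mult mat2_eq_iff p_def m1_def m2_def
      by (simp add: poly2)
  qed
  then have 2: "conj_by G B (inv\<^bsub>G\<^esub> g) = inv\<^bsub>G\<^esub> B"
    using G.conj_by_inverse[OF G.inv_closed[OF AB(2)] g] by simp
  from 1 2 show ?thesis using G.inv_closed[OF g] by blast
qed

text \<open>A nontrivial normal subgroup contains a companion matrix. Its commutator with a diagonal
  matrix is lower triangular, and the commutators of that with lower transvections run through all
  lower transvections.\<close>

lemma simple_G: "simple_group G"
proof (unfold_locales)
  define T :: "'f ^ 2 ^ 2" where "T = mat2 1 1 0 1"
  have "card {mat 1, T} = 2" by (simp add: T_def mat2_one)
  moreover have "{mat 1, T} \<subseteq> carrier G" by (simp add: T_def)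
  then have "card {mat 1, T} \<le> card (carrier G)" by (rule card_mono[OF finite_G])
  ultimately show "1 < order G" by (simp add: order_def)
next
  fix N assume N: "N \<lhd> G"
  then have sub: "subgroup N G" by (rule normal_imp_subgroup)
  interpret N: normal N G by (rule N)
  note m = SL2_subgroup_mult[OF sub]
  show "N = carrier G \<or> N = {\<one>\<^bsub>G\<^esub>}"
  proof (rule disjCI)
    assume "N \<noteq> {\<one>\<^bsub>G\<^esub>}"
    then obtain A where A: "A \<in> N" "A \<noteq> \<one>\<^bsub>G\<^esub>" using N.one_closed by blast
    define t where "t = trace A"
    have Ac: "A \<in> carrier G" using A N.subset by blast
    have comp: "mat2 0 1 1 t \<in> carrier G" "mat2 0 1 1 t \<noteq> mat 1" by (simp_all add: mat2_one)
    obtain P where P: "P \<in> carrier G" "mat2 0 1 1 t = conj_by G A P"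
      by (rule conj_same_trace[OF Ac comp(1) _ comp(2)]) (use A in \<open>auto simp: t_def\<close>)
    have C: "mat2 0 1 1 t \<in> N" unfolding P(2) conj_by_def by (rule N.inv_op_closed2[OF P(1) A(1)])
    \<comment> \<open>Here \<open>q > 2\<close> is essential: \<open>SL\<^sub>2(2)\<close> is
      solvable.\<close>
    obtain x :: 'f where x: "x \<noteq> 0" "x \<noteq> 1" by (rule ex_not_0_1)
    have conj: "mat2 u v w z ** X ** mat2 z v w u \<in> N" if "X \<in> N" "u * z + v * w = 1" for u v w z X
      using N.inv_op_closed2[of "mat2 u v w z" X] that by (simp add: inv_SL2)
    have "(mat2 x 0 0 (1 / x) ** mat2 0 1 1 t ** mat2 (1 / x) 0 0 x) ** mat2 t 1 1 0 \<in> N"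
      by (intro m conj C) (use x SL2_subgroup_inv[OF sub C] in simp_all)
    then have Y: "mat2 (x * x) 0 (t / (x * x) + t) (1 / (x * x)) \<in> N"
      using x by (simp add: add.commute)
    have xx: "x * x \<noteq> 1" "x * x \<noteq> 0"
    proof -
      have "(x + 1) * (x + 1) = x * x + 1" by (simp add: poly2)
      moreover have "(x + 1) * (x + 1) \<noteq> 0" using x by simp
      ultimately show "x * x \<noteq> 1" "x * x \<noteq> 0" using x by auto
    qed
    define y where "y = x * x"
    define g where "g = t / (x * x) + t"
    have y: "mat2 y 0 g (1 / y) \<in> N" "y \<noteq> 0" "y \<noteq> 1" using Y xx by (simp_all add: y_def g_def)
    have "mat2 1 0 f 1 \<in> N" for f
    proof -
      \<comment> \<open>The commutator below multiplies \<open>e\<close> by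
        \<open>(1 + y * y) / (y * y)\<close>.\<close>
      define e where "e = f * y * y / (1 + y * y)"
      have "(y + 1) * (y + 1) = 1 + y * y" by (simp add: poly2)
      moreover have "(y + 1) * (y + 1) \<noteq> 0" using y by simp
      ultimately have nz: "1 + y * y \<noteq> 0" by simp
      have "mat2 y 0 g (1 / y) ** (mat2 1 0 e 1 ** mat2 (1 / y) 0 g y ** mat2 1 0 e 1) \<in> N"
        by (intro m conj) (use y SL2_subgroup_inv[OF sub y(1)] in simp_all)
      moreover have "mat2 y 0 g (1 / y) ** (mat2 1 0 e 1 ** mat2 (1 / y) 0 g y ** mat2 1 0 e 1)
        = mat2 1 0 (e * ((1 + y * y) / (y * y))) 1"
        using y(2) by (simp add: distrib_left distrib_right add_divide_distrib add.assoc two_eq_0)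
      moreover have "e * ((1 + y * y) / (y * y)) = f" using nz y(2) by (simp add: e_def)
      ultimately show ?thesis by simp
    qed
    then show "N = carrier G" using SL2_eq_if_lower_transvections[OF sub _ C] by simp
  qed
qed

section \<open>Generating pairs with prescribed traces\<close>

definition gen_traces :: "'f \<Rightarrow> 'f \<Rightarrow> 'f \<Rightarrow> bool" where
  "gen_traces r s t \<longleftrightarrow> (\<exists>A B. generating_pair G A B \<and> trace A = r \<and> trace B = s \<and> trace (A ** B) = t)"

lemma gen_traces_swap: "gen_traces r s t \<Longrightarrow> gen_traces s r t"
  unfolding gen_traces_def using G.generating_pair_swap trace_mul_sym by metis

text \<open>Inversion preserves traces in \<open>SL2\<close>, so \<open>A B\<close> and the inverse
  of \<open>B\<close> have the required traces. Together with the swap this gives all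
  permutations.\<close>

lemma gen_traces_rot: "gen_traces r s t \<Longrightarrow> gen_traces t s r"
proof -
  assume "gen_traces r s t"
  then obtain A B where AB: "generating_pair G A B" "trace A = r" "trace B = s" "trace (A ** B) = t"
    by (auto simp: gen_traces_def)
  obtain a b c d where B: "B = mat2 a b c d" by (rule mat2_cases)
  have c: "A \<in> carrier G" "B \<in> carrier G" using AB by (auto simp: generating_pair_def)
  then have "inv\<^bsub>G\<^esub> B = mat2 d b c a" unfolding B by (subst inv_SL2) simp_all
  then have "trace (inv\<^bsub>G\<^esub> B) = s" using AB B by (simp add: add.commute)
  moreover have "(A \<otimes>\<^bsub>G\<^esub> B) \<otimes>\<^bsub>G\<^esub> inv\<^bsub>G\<^esub> B = A"
    using c by (metis G.inv_solve_right G.m_closed G.inv_closed G.m_assoc G.r_inv G.r_one)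
  ultimately show ?thesis
    using G.generating_pair_mult_inv[OF AB(1)] AB unfolding gen_traces_def SL2_simps by metis
qed

lemma trace_square:
  assumes "A \<in> carrier G" shows "trace (A ** A) = trace A * trace A"
proof -
  obtain a b c d where "A = mat2 a b c d" by (rule mat2_cases)
  then show ?thesis by (simp add: poly2)
qed

lemma trace_cube:
  assumes "A \<in> carrier G" shows "trace (A ** A ** A) = trace A * trace A * trace A + trace A"
proof -
  obtain a b c d where A: "A = mat2 a b c d" by (rule mat2_cases)
  have det: "a * d + b * c = 1" using assms A by simp
  have "trace (A ** A ** A) = (a + d) * (a + d) * (a + d) + (a + d) * (a * d + b * c)"
    unfolding A by (simp add: poly2)
  then show ?thesis by (simp add: det A)
qed

end

text \<open>\<open>\<alpha>\<close> and \<open>\<tau>\<close> are traces of generators of a split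
  and of a nonsplit torus, which have orders \<open>q - 1\<close> and \<open>q + 1\<close>.\<close>

locale even_field_elements = even_field F q for F :: "'f::{field,finite} itself" and q +
  fixes l \<alpha> \<tau> :: 'f
  assumes l_nz: "l \<noteq> 0" and l_prim: "x \<noteq> 0 \<Longrightarrow> \<exists>i. x = l ^ i" and l_ord: "l ^ n = 1 \<longleftrightarrow> (q - 1) dvd n"
    and \<alpha>: "\<alpha> = l + 1 / l" and \<tau>: "\<exists>A \<in> carrier SL2. trace A = \<tau> \<and> group.ord SL2 A = q + 1"
begin

abbreviation L where "L \<equiv> mat2 l 0 0 (1 / l)"

lemma L_in: "L \<in> carrier G" using l_nz by simp

lemma l_ne_1: "l \<noteq> 1"
  using l_ord[of 1] q_ge_4 by simp

lemma L_ne_1: "L \<noteq> mat 1" using l_ne_1 by (simp add: mat2_one)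

lemma ord_L: "G.ord L = q - 1"
proof (rule G.ord_unique_iff[OF L_in])
  fix n :: nat
  show "L [^]\<^bsub>G\<^esub> n = \<one>\<^bsub>G\<^esub> \<longleftrightarrow> q - 1 dvd n"
    using SL2_pow_diag[OF l_nz, of n] l_ord[of n] l_nz by (auto simp: mat2_one)
qed

lemma ord_\<alpha>: "\<lbrakk>A \<in> carrier G; A \<noteq> mat 1; trace A = \<alpha>\<rbrakk> \<Longrightarrow> G.ord A = q - 1"
  using ord_same_trace[OF _ L_in _ L_ne_1] ord_L \<alpha> by simp

lemma ord_\<tau>: "\<lbrakk>A \<in> carrier G; A \<noteq> mat 1; trace A = \<tau>\<rbrakk> \<Longrightarrow> G.ord A = q + 1"
proof -
  assume A: "A \<in> carrier G" "A \<noteq> mat 1" "trace A = \<tau>"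
  obtain A0 where A0: "A0 \<in> carrier G" "trace A0 = \<tau>" "G.ord A0 = q + 1" using \<tau> by blast
  then have "A0 \<noteq> mat 1" using q_ge_4 G.ord_eq_1[OF A0(1)] by auto
  then show ?thesis using ord_same_trace A A0 by metis
qed

lemma ord_0:
  assumes "A \<in> carrier G" "A \<noteq> mat 1" "trace A = 0" shows "G.ord A = 2"
proof -
  define U :: "'f ^ 2 ^ 2" where "U = mat2 1 1 0 1"
  have U: "U \<in> carrier G" "U \<noteq> mat 1" "trace U = 0" by (simp_all add: U_def mat2_one)
  have "U [^]\<^bsub>G\<^esub> (2::nat) = \<one>\<^bsub>G\<^esub>" by (simp add: U_def mat2_one numeral_2_eq_2)
  then have "G.ord U dvd 2" using G.pow_eq_id[OF U(1)] by simp
  moreover have "G.ord U \<noteq> 1" using G.ord_eq_1[OF U(1)] U by simp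
  ultimately have "G.ord U = 2" by (metis prime_nat_iff two_is_prime_nat)
  then show ?thesis using ord_same_trace assms U by metis
qed

lemma coprime_orders: "coprime (q - 1) (q + 1)" "coprime 2 (q - 1)" "coprime 2 (q + 1)"
proof -
  obtain n where n: "q = 2 ^ n" using q_pow by blast
  then have "n > 0" using q_ge_4 by (cases n) auto
  then have "even q" using n by simp
  then show "coprime (q - 1) (q + 1)" "coprime 2 (q - 1)" "coprime 2 (q + 1)"
    using coprime_pred_Suc_even q_ge_4 by blast+
qed

lemma ex_ord_\<tau>: obtains A where "A \<in> carrier G" "A \<noteq> mat 1" "trace A = \<tau>" "G.ord A = q + 1"
proof -
  obtain A where A: "A \<in> carrier G" "trace A = \<tau>" "G.ord A = q + 1" using \<tau> by blast
  then have "A \<noteq> mat 1" using q_ge_4 G.ord_eq_1[OF A(1)] by auto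
  with A that show thesis by blast
qed

lemma ord_square:
  assumes "A \<in> carrier G" "coprime 2 (G.ord A)"
  shows "G.ord (A ** A) = G.ord A"
proof (rule G.ord_unique_iff)
  show "A ** A \<in> carrier G" using assms by (simp add: det_mul)
  fix n :: nat
  have "A ** A = A [^]\<^bsub>G\<^esub> (2::nat)" by (simp add: numeral_2_eq_2)
  then have "(A ** A) [^]\<^bsub>G\<^esub> n = A [^]\<^bsub>G\<^esub> (2 * n)" by (simp only: G.nat_pow_pow[OF assms(1)])
  then show "(A ** A) [^]\<^bsub>G\<^esub> n = \<one>\<^bsub>G\<^esub> \<longleftrightarrow> G.ord A dvd n"
    using G.pow_eq_id[OF assms(1)] assms(2) by (simp add: coprime_dvd_mult_right_iff coprime_commute)
qed

lemma ne_1_if_trace_nz: "trace A \<noteq> 0 \<Longrightarrow> A \<noteq> mat 1" for A :: "'f ^ 2 ^ 2"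
  by (auto simp: mat2_one)

lemma trace_mult_self_ord:
  assumes "A \<in> carrier G" "A \<noteq> mat 1" "trace A = r * r" "B \<in> carrier G" "B \<noteq> mat 1" "trace B = r"
    and "coprime 2 (G.ord B)"
  shows "G.ord A = G.ord B"
proof -
  have BB: "B ** B \<in> carrier G" using assms by (simp add: det_mul)
  have o: "G.ord (B ** B) = G.ord B" by (rule ord_square) (use assms in auto)
  then have "B ** B \<noteq> mat 1" using G.ord_eq_1[OF BB] G.ord_eq_1[OF assms(4)] assms(5) by simp
  then show ?thesis
    using ord_same_trace[OF assms(1) BB assms(2)] trace_square[OF assms(4)] assms o by simp
qed

lemma ord_\<tau>2: "\<lbrakk>A \<in> carrier G; A \<noteq> mat 1; trace A = \<tau> * \<tau>\<rbrakk> \<Longrightarrow> G.ord A = q + 1"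
  by (rule ex_ord_\<tau>) (metis trace_mult_self_ord coprime_orders(3))

lemma ord_\<alpha>2: "\<lbrakk>A \<in> carrier G; A \<noteq> mat 1; trace A = \<alpha> * \<alpha>\<rbrakk> \<Longrightarrow> G.ord A = q - 1"
  using trace_mult_self_ord[OF _ _ _ L_in L_ne_1] ord_L \<alpha> coprime_orders(2) by simp

abbreviation companion :: "'f \<Rightarrow> 'f ^ 2 ^ 2" where "companion t \<equiv> mat2 0 1 1 t"

lemma companion_in: "companion t \<in> carrier G" "companion t \<noteq> mat 1" "trace (companion t) = t"
  by (simp_all add: mat2_one)

text \<open>\<open>companion t\<close> is a nontrivial element of arbitrary trace, so coinciding
  traces would give it two different orders.\<close>

lemma trace_nz: "\<alpha> \<noteq> 0" "\<tau> \<noteq> 0"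
  using ord_0[OF companion_in] ord_\<alpha>[OF companion_in] ord_\<tau>[OF companion_in] q_ge_4 by force+

lemma trace_distinct: "\<alpha> \<noteq> \<tau>" "\<tau> \<noteq> \<alpha> * \<alpha>" "\<alpha> \<noteq> \<tau> * \<tau>"
  using ord_\<alpha>[OF companion_in] ord_\<tau>[OF companion_in] ord_\<alpha>2[OF companion_in] ord_\<tau>2[OF companion_in] q_ge_4 by force+

text \<open>Otherwise the cube of an element of order \<open>q + 1\<close> would have order
  \<open>q - 1 > 1\<close>, against coprimality. This is the nondegeneracy required for the traces
  \<open>\<alpha>\<close>, \<open>\<tau>\<close>, \<open>\<tau> * \<tau>\<close>.\<close>

lemma \<alpha>_ne_cube: "\<alpha> \<noteq> \<tau> * \<tau> * \<tau> + \<tau>"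
proof
  assume *: "\<alpha> = \<tau> * \<tau> * \<tau> + \<tau>"
  obtain A where A: "A \<in> carrier G" "A \<noteq> mat 1" "trace A = \<tau>" "G.ord A = q + 1" by (rule ex_ord_\<tau>)
  have c: "A ** A ** A \<in> carrier G" using A by (simp add: det_mul)
  have tr: "trace (A ** A ** A) = \<alpha>" using trace_cube[OF A(1)] A * by simp
  then have "G.ord (A ** A ** A) = q - 1" using ord_\<alpha>[OF c] ne_1_if_trace_nz trace_nz by simp
  moreover have "A ** A ** A = A [^]\<^bsub>G\<^esub> (3::nat)" by (simp add: numeral_3_eq_3 matrix_mul_assoc)
  then have "(A ** A ** A) [^]\<^bsub>G\<^esub> (q + 1) = \<one>\<^bsub>G\<^esub>"
    by (simp only: G.nat_pow_pow[OF A(1)] G.pow_eq_id[OF A(1)] A(4) dvd_triv_right)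
  then have "G.ord (A ** A ** A) dvd q + 1" by (rule iffD1[OF G.pow_eq_id[OF c]])
  ultimately have "q - 1 dvd q + 1" by simp
  then have "q - 1 = 1" using coprime_orders(1) by (metis coprime_absorb_left nat_dvd_1_iff_1)
  then show False using q_ge_4 by simp
qed

lemma ord_comp_1: "G.ord (companion 1) dvd 3"
proof -
  have "companion 1 [^]\<^bsub>G\<^esub> (3::nat) = \<one>\<^bsub>G\<^esub>" by (simp add: numeral_3_eq_3 mat2_one)
  then show ?thesis using G.pow_eq_id[OF companion_in(1)] by metis
qed

lemma \<tau>_ne_1: "\<tau> \<noteq> 1"
proof
  assume "\<tau> = 1"
  then have "q + 1 dvd 3" using ord_comp_1 ord_\<tau>[OF companion_in] by simp
  then show False using q_ge_4 by (auto dest: dvd_imp_le)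
qed

lemma \<alpha>_ne_1: "q > 4 \<Longrightarrow> \<alpha> \<noteq> 1"
proof
  assume "\<alpha> = 1" "q > 4"
  then have "q - 1 dvd 3" using ord_comp_1 ord_\<alpha>[OF companion_in] by simp
  then show False using \<open>q > 4\<close> by (auto dest: dvd_imp_le)
qed

lemma power_q_minus_1: "x \<noteq> 0 \<Longrightarrow> x ^ (q - 1) = 1" for x :: 'f
  using l_prim[of x] l_ord[of "q - 1"] by (metis dvd_refl mult.commute power_mult power_one)

text \<open>A root \<open>x\<close> would make \<open>mat2 x 0 0 (1 / x)\<close> an element of trace
  \<open>\<tau>\<close>, whose order would be \<open>q + 1\<close> and divide
  \<open>q - 1\<close>.\<close>

lemma \<tau>_irreducible: "x * x + \<tau> * x + 1 \<noteq> 0"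
proof
  assume *: "x * x + \<tau> * x + 1 = 0"
  then have x: "x \<noteq> 0" by auto
  let ?T = "mat2 x 0 0 (1 / x)"
  have "\<tau> * x = x * x + 1" using * by (metis add_eq_0 add.assoc add.commute)
  then have "\<tau> = x + 1 / x" using x by (simp add: field_simps)
  then have T: "?T \<in> carrier G" "trace ?T = \<tau>" using x by simp_all
  have "?T \<noteq> mat 1" using ne_1_if_trace_nz[of ?T] T(2) trace_nz by metis
  then have "G.ord ?T = q + 1" using ord_\<tau> T by blast
  moreover have "?T [^]\<^bsub>G\<^esub> (q - 1) = \<one>\<^bsub>G\<^esub>" using SL2_pow_diag[OF x] power_q_minus_1[OF x] by (simp add: mat2_one)
  ultimately have "q + 1 dvd q - 1" using G.pow_eq_id[OF T(1)] by metis
  then show False using q_ge_4 by (auto dest: dvd_imp_le)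
qed

lemma torus_in_if_L_in:
  assumes "subgroup H G" "L \<in> H" "x \<noteq> 0"
  shows "mat2 x 0 0 (1 / x) \<in> H"
proof -
  obtain i where "x = l ^ i" using l_prim assms by blast
  then show ?thesis
    using G.subgroup_nat_pow_closed[OF assms(1,2), of i] SL2_pow_diag[OF l_nz] by simp
qed

text \<open>By Fricke's identity the expression in \<open>nonsing\<close> is the trace of the
  commutator, which vanishes exactly when the two matrices have a common eigenvector. The condition
  \<open>st\<close> keeps \<open>B\<close> out of the normalizer of the torus.\<close>

lemma gen_traces_\<alpha>:
  assumes nonsing: "\<alpha> * \<alpha> + s * s + t * t + \<alpha> * s * t \<noteq> 0" and st: "s \<noteq> 0 \<or> t \<noteq> 0"
  shows "gen_traces \<alpha> s t"
proof -
  \<comment> \<open>\<open>a\<close> and \<open>d\<close> solve \<open>a + d = s\<close> and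
    \<open>l * a + d / l = t\<close>.\<close>
  define a where "a = (t + s / l) / \<alpha>"
  define d where "d = (t + s * l) / \<alpha>"
  define B where "B = mat2 a (a * d + 1) 1 d"
  have B: "B \<in> carrier G" by (simp add: B_def poly2)
  have "a + d = (s * (l + 1 / l)) / \<alpha>"
    by (simp add: a_def d_def poly2 flip: add_divide_distrib)
  then have tr: "trace B = s" using trace_nz by (simp add: B_def \<alpha>[symmetric])
  have "l * a + 1 / l * d = ((t * l + s) + (t / l + s)) / \<alpha>"
    using l_nz by (simp add: a_def d_def distrib_left add_divide_distrib mult.commute)
  also have "(t * l + s) + (t / l + s) = t * \<alpha>" by (simp add: \<alpha> poly2)
  finally have trLB: "trace (L ** B) = t" using trace_nz by (simp add: B_def)
  have "a * d = (t * t + t * s * (l + 1 / l) + s * s) / (\<alpha> * \<alpha>)"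
    using l_nz by (simp add: a_def d_def poly2)
  then have "a * d + 1 = (\<alpha> * \<alpha> + s * s + t * t + \<alpha> * s * t) / (\<alpha> * \<alpha>)"
    using trace_nz by (simp add: \<alpha>[symmetric] add_divide_distrib ac_simps)
  then have b: "a * d + 1 \<noteq> 0" using nonsing trace_nz by simp
  have ad: "a \<noteq> 0 \<or> d \<noteq> 0"
  proof (rule ccontr)
    assume "\<not> ?thesis"
    then have "a = 0" "d = 0" by auto
    then have "s = 0" "t = 0" using tr trLB by (simp_all add: B_def)
    with st show False by simp
  qed
  let ?H = "generate G {L, B}"
  have H: "subgroup ?H G" using L_in B by (intro G.generate_is_subgroup) auto
  have in_H: "L \<in> ?H" "B \<in> ?H" by (auto intro: generate.incl)
  have "mat2 a (a * d + 1) 1 d \<in> ?H" using in_H(2) by (simp only: B_def)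
  then have "?H = carrier G"
    using SL2_eq_if_torus[OF H torus_in_if_L_in[OF H in_H(1)] _ b _ ad] by simp
  then have "generating_pair G L B" using L_in B by (simp add: generating_pair_def)
  moreover have "trace L = \<alpha>" by (simp add: \<alpha>)
  ultimately show ?thesis using tr trLB unfolding gen_traces_def by blast
qed

text \<open>The matrices \<open>u + v S\<close> with \<open>u = x + y C\<close> and \<open>v = z + w C\<close> in the field generated by the companion
  matrix \<open>C\<close> of \<open>X\<^sup>2 + \<tau> X + 1\<close>; conjugation by the permutation matrix \<open>S\<close> is the Frobenius of this field,
  so the determinant is \<open>N u + N v\<close> for the norm \<open>N\<close>.\<close>
definition E :: "'f \<Rightarrow> 'f \<Rightarrow> 'f \<Rightarrow> 'f \<Rightarrow> 'f ^ 2 ^ 2" where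
  "E x y z w = mat2 (x + w) (y + z) (y + z + \<tau> * w) (x + \<tau> * y + w)"

definition N :: "'f \<Rightarrow> 'f \<Rightarrow> 'f" where "N x y = x * x + \<tau> * x * y + y * y"

lemma det_E: "det (E x y z w) = N x y + N z w"
  unfolding E_def det_mat2 N_def by (simp add: poly2)

lemma trace_E: "trace (E x y z w) = \<tau> * y"
  unfolding E_def trace_mat2 by (simp add: poly2)

lemma E_mult:
  "E x y z w ** E x' y' z' w' =
   E (x * x' + y * y' + z * z' + \<tau> * z * w' + w * w')
     (x * y' + x' * y + \<tau> * y * y' + z * w' + w * z')
     (x * z' + y * w' + z * x' + \<tau> * z * y' + w * y')
     (x * w' + y * z' + \<tau> * y * w' + z * y' + w * x')"
  unfolding E_def mat2_mult mat2_eq_iff by (simp add: poly2)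

lemma N_mult: "N (x * x' + y * y') (x * y' + x' * y + \<tau> * y * y') = N x y * N x' y'"
  unfolding N_def by (simp add: poly2)

text \<open>\<open>C\<close> has trace \<open>\<tau>\<close>, so \<open>(x + \<tau> y) + y C\<close>
  is the Frobenius conjugate of \<open>x + y C\<close>.\<close>

lemma N_conj: "N (x + \<tau> * y) y = N x y"
  unfolding N_def by (simp add: poly2)

lemma N_scale: "N (c * x) (c * y) = c * c * N x y"
  unfolding N_def by (simp add: poly2)

lemma square_inj: "a * a = b * b \<longleftrightarrow> a = (b :: 'f)"
proof
  assume "a * a = b * b"
  then have "(a + b) * (a + b) = 0" by (simp add: poly2)
  then show "a = b" by simp
qed simp

text \<open>The slope embeds the elements of norm one into the projective line, with
  \<open>None\<close> as the point at infinity: slope and norm fix \<open>x * x\<close>, and square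
  roots are unique.\<close>

lemma card_norm_one: "card {(x, y). N x y = 1} \<le> q + 1"
proof -
  let ?f = "\<lambda>(x, y). if x = 0 then None else Some (y / x)"
  have "inj_on ?f {(x, y). N x y = 1}"
  proof (rule inj_onI)
    fix u u' assume "u \<in> {(x, y). N x y = 1}" "u' \<in> {(x, y). N x y = 1}" and eq: "?f u = ?f u'"
    then obtain x y x' y' where u: "u = (x, y)" "u' = (x', y')" and N: "N x y = 1" "N x' y' = 1" by auto
    show "u = u'"
    proof (cases "x = 0")
      case True
      then have "x' = 0" using eq u by (auto split: if_splits)
      then show ?thesis using N True u square_inj[of y y'] by (simp add: N_def)
    next
      case False
      then have x': "x' \<noteq> 0" and s: "y / x = y' / x'" using eq u by (auto split: if_splits)
      have "N x y = x * x * N 1 (y / x)" using N_scale[of x 1 "y / x"] False by simp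
      moreover have "N x' y' = x' * x' * N 1 (y / x)" using N_scale[of x' 1 "y' / x'"] x' s by simp
      ultimately have "x * x * N 1 (y / x) = x' * x' * N 1 (y / x)" "N 1 (y / x) \<noteq> 0" using N by auto
      then have "x = x'" using square_inj by simp
      then show ?thesis using s x' u by simp
    qed
  qed
  then have "card {(x, y). N x y = 1} \<le> card (UNIV :: 'f option set)"
    by (rule card_inj_on_le) auto
  then show ?thesis by (simp add: card_UNIV_option card_F)
qed

lemma ord_C: "E 0 1 0 0 \<in> carrier G" "G.ord (E 0 1 0 0) = q + 1"
proof -
  have "E 0 1 0 0 = companion \<tau>" by (simp add: E_def)
  then show "E 0 1 0 0 \<in> carrier G" "G.ord (E 0 1 0 0) = q + 1"
    using ord_\<tau>[OF companion_in] companion_in by simp_all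
qed

text \<open>The \<open>q + 1\<close> powers of \<open>C\<close> have norm one, and
  \<open>card_norm_one\<close> leaves room for no others.\<close>

lemma powers_of_C: "{E x y 0 0 | x y. N x y = 1} = generate G {E 0 1 0 0}"
  and card_norm_one_eq: "card {(x, y). N x y = 1} = q + 1"
proof -
  let ?C = "E 0 1 0 0" and ?N = "{(x, y). N x y = 1}"
  have pow: "?C [^]\<^bsub>G\<^esub> n \<in> (\<lambda>(x, y). E x y 0 0) ` ?N" for n :: nat
  proof (induction n)
    case 0
    have "mat 1 = E 1 0 0 0" by (simp add: E_def mat2_one)
    then show ?case by (force simp: N_def)
  next
    case (Suc n)
    then obtain x y where xy: "?C [^]\<^bsub>G\<^esub> n = E x y 0 0" "N x y = 1" by auto
    then have "?C [^]\<^bsub>G\<^esub> Suc n = E y (x + \<tau> * y) 0 0" by (simp add: E_mult)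
    moreover have "N y (x + \<tau> * y) = 1" using xy(2) by (simp add: N_def poly2)
    ultimately show ?case by force
  qed
  have gen: "generate G {?C} = {?C [^]\<^bsub>G\<^esub> k | k. k \<in> (UNIV :: nat set)}"
    by (rule G.generate_pow_on_finite_carrier[OF finite_G ord_C(1)])
  have c: "card (generate G {?C}) = q + 1" using G.generate_pow_card[OF ord_C(1)] ord_C(2) by simp
  have sub: "generate G {?C} \<subseteq> (\<lambda>(x, y). E x y 0 0) ` ?N" using pow gen by auto
  have le: "card ((\<lambda>(x, y). E x y 0 0) ` ?N) \<le> card ?N" by (rule card_image_le) simp
  have "generate G {?C} = (\<lambda>(x, y). E x y 0 0) ` ?N"
    by (rule card_seteq[OF finite sub]) (use c le card_norm_one in simp)
  then show "{E x y 0 0 | x y. N x y = 1} = generate G {?C}" by auto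
  show "card ?N = q + 1"
    using c le card_norm_one card_mono[OF finite sub] by simp
qed

text \<open>For \<open>\<kappa>\<close> of norm one, multiplying on both sides by the square root of \<open>\<kappa>\<close> turns \<open>u + v S\<close> into \<open>\<kappa> u + v S\<close>.\<close>
lemma rotate:
  assumes H: "subgroup H G" and C: "E 0 1 0 0 \<in> H" and B: "E x y z w \<in> H"
    and N: "N x y = r" "N x' y' = r" "r \<noteq> 0"
  shows "E x' y' z w \<in> H"
proof -
  \<comment> \<open>\<open>k1 + k2 C\<close> is the quotient of \<open>x' + y' C\<close> by
    \<open>x + y C\<close>, computed with the conjugate and the norm \<open>r\<close>.\<close>
  define k1 k2 where "k1 = (x' * (x + \<tau> * y) + y' * y) / r" and "k2 = (x' * y + y' * x) / r"
  have "N (x' * (x + \<tau> * y) + y' * y) (x' * y + (x + \<tau> * y) * y' + \<tau> * y' * y) = r * r"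
    using N_mult[of x' "x + \<tau> * y" y' y] N N_conj by simp
  moreover have "x' * y + (x + \<tau> * y) * y' + \<tau> * y' * y = x' * y + y' * x" by (simp add: poly2)
  ultimately have "N (r * k1) (r * k2) = r * r" using N(3) by (simp add: k1_def k2_def)
  then have Nk: "N k1 k2 = 1" using N_scale N(3) by simp
  \<comment> \<open>\<open>l1 + l2 C\<close> is to be its square root:
    \<open>(l1 + l2 C)^2 = l1^2 + l2^2 + \<tau> l2^2 C\<close>.\<close>
  obtain l2 where l2: "l2 * l2 = k2 / \<tau>" by (rule sqrt_exists)
  obtain l1 where l1: "l1 * l1 = k1 + k2 / \<tau>" by (rule sqrt_exists)
  have sq1: "l1 * l1 + l2 * l2 = k1" unfolding l1 l2 by (simp add: add.assoc)
  have sq2: "\<tau> * l2 * l2 = k2" using l2 trace_nz by (simp add: mult.assoc)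
  have "N l1 l2 * N l1 l2 = 1"
    using N_mult[of l1 l1 l2 l2] Nk by (simp add: sq1 sq2)
  then have "N l1 l2 = 1" using square_inj[of "N l1 l2" 1] by simp
  then have "E l1 l2 0 0 \<in> generate G {E 0 1 0 0}" using powers_of_C by blast
  then have in_H: "E l1 l2 0 0 \<in> H" using G.generate_subgroup_incl[OF _ H, of "{E 0 1 0 0}"] C by blast
  have "E l1 l2 0 0 ** E x y z w ** E l1 l2 0 0 = E (k1 * x + k2 * y) (k1 * y + k2 * x + \<tau> * k2 * y) (N l1 l2 * z) (N l1 l2 * w)"
    unfolding E_mult sq1[symmetric] sq2[symmetric] N_def by (simp add: poly2)
  moreover have "k1 * x + k2 * y = x' * (N x y / r)" "k1 * y + k2 * x + \<tau> * k2 * y = y' * (N x y / r)"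
    unfolding k1_def k2_def N_def by (simp_all add: poly2 add_divide_distrib)
  ultimately have "E l1 l2 0 0 ** E x y z w ** E l1 l2 0 0 = E x' y' z w"
    using N \<open>N l1 l2 = 1\<close> by simp
  then show ?thesis using SL2_subgroup_mult[OF H] in_H B by metis
qed

lemma trace_conj_by:
  assumes "A \<in> carrier G" "P \<in> carrier G" shows "trace (conj_by G A P) = trace A"
proof -
  have "trace (conj_by G A P) = trace ((P \<otimes>\<^bsub>G\<^esub> A) ** inv\<^bsub>G\<^esub> P)" by (simp add: conj_by_def)
  also have "\<dots> = trace (inv\<^bsub>G\<^esub> P \<otimes>\<^bsub>G\<^esub> (P \<otimes>\<^bsub>G\<^esub> A))" by (subst trace_mul_sym) simp
  also have "inv\<^bsub>G\<^esub> P \<otimes>\<^bsub>G\<^esub> (P \<otimes>\<^bsub>G\<^esub> A) = A"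
    using assms G.m_assoc[of "inv\<^bsub>G\<^esub> P" P A] G.l_inv G.l_one G.inv_closed by metis
  finally show ?thesis .
qed

text \<open>After conjugating \<open>D\<close> to \<open>L\<close>, the torus criterion applies to
  the conjugate of \<open>C\<close>: its characteristic polynomial is irreducible, so it is not
  triangular, and its trace is nonzero, so it is not antidiagonal.\<close>

lemma SL2_eq_if_conj_L_and_C:
  assumes H: "subgroup H G" and C: "E 0 1 0 0 \<in> H" and D: "D \<in> H" "trace D = \<alpha>"
  shows "H = carrier G"
proof -
  have Dc: "D \<in> carrier G" using subgroup.mem_carrier[OF H D(1)] .
  have D1: "D \<noteq> mat 1" using D trace_nz ne_1_if_trace_nz by auto
  obtain P where P: "P \<in> carrier G" "L = conj_by G D P"
    by (rule conj_same_trace[OF Dc L_in D1 L_ne_1]) (use D \<alpha> in auto)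
  define K where "K = {X \<in> carrier G. conj_by G X (inv\<^bsub>G\<^esub> P) \<in> H}"
  have K: "subgroup K G" unfolding K_def using G.subgroup_conj_vimage[OF H G.inv_closed[OF P(1)]] .
  have in_K: "conj_by G X P \<in> K" if "X \<in> H" for X
    using that subgroup.mem_carrier[OF H that] P G.conj_by_inverse G.conj_by_closed unfolding K_def by simp
  have L: "L \<in> K" using in_K[OF D(1)] P by simp
  define Y where "Y = conj_by G (E 0 1 0 0) P"
  have Y: "Y \<in> K" "Y \<in> carrier G" using in_K[OF C] ord_C(1) P by (simp_all add: Y_def G.conj_by_closed del: SL2_simps)
  obtain a b c d where Ymat: "Y = mat2 a b c d" by (rule mat2_cases)
  have det: "a * d + b * c = 1" using Y by (simp add: Ymat)
  have tr: "a + d = \<tau>"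
    using trace_conj_by[OF ord_C(1) P(1)] by (simp add: trace_E Ymat[unfolded Y_def])
  have *: "a * a + \<tau> * a + 1 = a * d + 1" unfolding tr[symmetric] by (simp add: poly2)
  have b: "b \<noteq> 0" and c: "c \<noteq> 0" using \<tau>_irreducible[of a] det unfolding * by auto
  have ad: "a \<noteq> 0 \<or> d \<noteq> 0" using tr trace_nz by auto
  have "K = carrier G"
    by (rule SL2_eq_if_torus[OF K torus_in_if_L_in[OF K L] Y(1)[unfolded Ymat] b c ad])
  show ?thesis
  proof (rule antisym[OF subgroup.subset[OF H] subsetI])
    fix X assume X: "X \<in> carrier G"
    then have "conj_by G X P \<in> K" using \<open>K = carrier G\<close> P(1) G.conj_by_closed by simp
    then show "X \<in> H" using G.conj_by_inverse[OF X P(1)] by (simp add: K_def)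
  qed
qed

text \<open>The Artin-Schreier subgroup, of index two: \<open>a \<notin> AS\<close> iff \<open>X\<^sup>2 + \<alpha> X + a\<close> is irreducible.\<close>
definition AS :: "'f set" where "AS = range (\<lambda>x. x * x + \<alpha> * x)"

lemma AS_add: "\<lbrakk>a \<in> AS; b \<in> AS\<rbrakk> \<Longrightarrow> a + b \<in> AS"
proof -
  assume "a \<in> AS" "b \<in> AS"
  then obtain x y where "a = x * x + \<alpha> * x" "b = y * y + \<alpha> * y" by (auto simp: AS_def)
  then have "a + b = (x + y) * (x + y) + \<alpha> * (x + y)" by (simp add: poly2)
  then show ?thesis by (auto simp: AS_def)
qed

lemma AS_0: "0 \<in> AS" by (auto simp: AS_def intro!: rev_image_eqI[of 0])

lemma AS_add_iff: "a \<in> AS \<Longrightarrow> a + b \<in> AS \<longleftrightarrow> b \<in> AS"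
  using AS_add[of a "a + b"] AS_add[of a b] by auto

lemma card_le_two:
  fixes f :: "'f \<Rightarrow> 'f" and A :: "'f set"
  assumes "\<And>x x'. \<lbrakk>x \<in> A; x' \<in> A\<rbrakk> \<Longrightarrow> x' = x \<or> x' = f x"
  shows "card A \<le> 2"
proof (cases "A = {}")
  case False
  then obtain x where "x \<in> A" by blast
  then have "A \<subseteq> {x, f x}" using assms by blast
  then have "card A \<le> card {x, f x}" by (rule card_mono[rotated]) simp
  then show ?thesis by (simp add: card_insert_if split: if_splits)
qed simp

text \<open>The map is additive and not injective: a missed value gives a second coset, and fibres
  have at most two elements.\<close>

lemma card_AS: "2 * card AS = q"
proof (rule antisym)
  have "\<not> inj (\<lambda>x. x * x + \<alpha> * x)"
  proof
    assume "inj (\<lambda>x. x * x + \<alpha> * x)"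
    then have "0 = \<alpha>" by (rule injD) simp
    then show False using trace_nz by simp
  qed
  then have "AS \<noteq> UNIV" using finite_UNIV_surj_inj[OF finite] by (auto simp: AS_def)
  then obtain c where c: "c \<notin> AS" by blast
  have "AS \<inter> (+) c ` AS = {}" using c AS_add_iff by (auto simp: add.commute)
  then have "card (AS \<union> (+) c ` AS) = card AS + card ((+) c ` AS)" by (intro card_Un_disjoint) simp_all
  also have "card ((+) c ` AS) = card AS" by (rule card_image) simp
  finally show "2 * card AS \<le> q" using card_mono[OF finite subset_UNIV, of "AS \<union> (+) c ` AS"] card_F by simp
next
  have fib: "card {x. x * x + \<alpha> * x = a} \<le> 2" for a
  proof (rule card_le_two[where f = "\<lambda>x. x + \<alpha>"])
    fix x x' assume "x \<in> {x. x * x + \<alpha> * x = a}" "x' \<in> {x. x * x + \<alpha> * x = a}"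
    then have "(x * x + \<alpha> * x) + (x' * x' + \<alpha> * x') = 0" by simp
    also have "(x * x + \<alpha> * x) + (x' * x' + \<alpha> * x') = (x' + x) * (x' + (x + \<alpha>))" by (simp add: poly2)
    finally show "x' = x \<or> x' = x + \<alpha>" by simp
  qed
  have "q = card (\<Union>a\<in>AS. {x. x * x + \<alpha> * x = a})"
    unfolding card_F[symmetric] by (rule arg_cong[of _ _ card]) (auto simp: AS_def)
  also have "\<dots> \<le> (\<Sum>a\<in>AS. card {x. x * x + \<alpha> * x = a})" by (rule card_UN_le) simp
  also have "\<dots> \<le> (\<Sum>a\<in>AS. 2)" by (rule sum_mono) (rule fib)
  finally show "q \<le> 2 * card AS" by simp
qed

text \<open>Otherwise \<open>AS\<close> and its translates by \<open>a\<close> and \<open>b\<close>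
  would be three disjoint sets of \<open>q / 2\<close> elements each.\<close>

lemma AS_not_add:
  assumes "a \<notin> AS" "b \<notin> AS" shows "a + b \<in> AS"
proof (rule ccontr)
  assume ab: "a + b \<notin> AS"
  have "AS \<inter> (+) a ` AS = {}" using assms(1) AS_add_iff by (auto simp: add.commute)
  moreover have "(AS \<union> (+) a ` AS) \<inter> (+) b ` AS = {}"
  proof -
    have "b + y \<noteq> a + x" if "x \<in> AS" "y \<in> AS" for x y
    proof
      assume "b + y = a + x"
      then have "a + b = (b + y) + (x + b)" by (simp add: ac_simps)
      also have "\<dots> = y + x" by (simp add: poly2)
      finally show False using ab AS_add that by metis
    qed
    moreover have "b + y \<notin> AS" if "y \<in> AS" for y using assms(2) AS_add_iff[OF that] by (simp add: add.commute)
    ultimately show ?thesis by (auto simp: eq_commute)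
  qed
  ultimately have "card ((AS \<union> (+) a ` AS) \<union> (+) b ` AS) = card AS + card ((+) a ` AS) + card ((+) b ` AS)"
    by (subst card_Un_disjoint; simp)+
  moreover have "card ((+) a ` AS) = card AS" "card ((+) b ` AS) = card AS" by (simp_all add: card_image)
  moreover have "card ((AS \<union> (+) a ` AS) \<union> (+) b ` AS) \<le> q"
    using card_mono[OF finite subset_UNIV] card_F by metis
  ultimately show False using card_AS q_ge_4 by simp
qed

text \<open>There are more than \<open>q / 2\<close> traces of elements of norm one, so they do not all lie in an affine hyperplane.\<close>
lemma ex_norm_one_not_AS:
  assumes "\<mu> \<noteq> 0"
  shows "\<exists>x y. N x y = 1 \<and> 1 + \<mu> * (\<tau> * y) \<notin> AS"
proof (rule ccontr)
  assume no: "\<not> ?thesis"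
  define Y where "Y = snd ` {(x, y). N x y = 1}"
  have fib: "card {x. N x y = 1} \<le> 2" for y
  proof (rule card_le_two[where f = "\<lambda>x. x + \<tau> * y"])
    fix x x' assume "x \<in> {x. N x y = 1}" "x' \<in> {x. N x y = 1}"
    then have "N x y + N x' y = 0" by simp
    also have "N x y + N x' y = (x' + x) * (x' + (x + \<tau> * y))" unfolding N_def by (simp add: poly2)
    finally show "x' = x \<or> x' = x + \<tau> * y" by simp
  qed
  have "card {(x, y). N x y = 1} = card (\<Union>y\<in>Y. (\<lambda>x. (x, y)) ` {x. N x y = 1})"
    by (rule arg_cong[of _ _ card]) (force simp: Y_def)
  also have "\<dots> \<le> (\<Sum>y\<in>Y. card ((\<lambda>x. (x, y)) ` {x. N x y = 1}))" by (rule card_UN_le) (simp add: Y_def)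
  also have "\<dots> \<le> (\<Sum>y\<in>Y. 2)"
  proof (rule sum_mono)
    fix y
    have "card ((\<lambda>x. (x, y)) ` {x. N x y = 1}) \<le> card {x. N x y = 1}" by (rule card_image_le) simp
    then show "card ((\<lambda>x. (x, y)) ` {x. N x y = 1}) \<le> 2" using fib[of y] by simp
  qed
  finally have "q + 1 \<le> 2 * card Y" using card_norm_one_eq by simp
  moreover have "inj_on (\<lambda>y. 1 + \<mu> * (\<tau> * y)) Y" using assms trace_nz by (auto simp: inj_on_def)
  then have "card Y \<le> card AS" by (rule card_inj_on_le) (use no in \<open>auto simp: Y_def\<close>)
  ultimately show False using card_AS by simp
qed

text \<open>A suitable product in \<open>H\<close> has a component \<open>u\<close> such that \<open>X\<^sup>2 + \<alpha> X + N u\<close> is irreducible. Then some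
  element of the same norm has trace \<open>\<alpha>\<close>, so \<open>H\<close> contains a split torus.\<close>
lemma SL2_eq_if_nonsplit:
  assumes H: "subgroup H G" and C: "E 0 1 0 0 \<in> H" and B: "E x y z w \<in> H"
    and N: "N x y = r" "r \<noteq> 0" "r \<noteq> 1"
  shows "H = carrier G"
proof -
  have det: "N z w = 1 + r"
    using SL2_subgroup_det[OF H B] dbl'[of r "N z w"] unfolding det_E N by (simp add: add.commute)
  \<comment> \<open>\<open>r \<noteq> 0\<close> and \<open>r \<noteq> 1\<close> make the coefficient
    \<open>r * (1 + r)\<close> nonzero; \<open>?n\<close> anticipates the norm in
    \<open>nP\<close>.\<close>
  obtain l1 l2 where l: "N l1 l2 = 1" "1 + r * (1 + r) * (\<tau> * l2) \<notin> AS" (is "?n \<notin> _")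
    using ex_norm_one_not_AS[of "r * (1 + r)"] N by auto
  \<comment> \<open>The conjugate of \<open>u = x + y C\<close> times \<open>l = l1 + l2 C\<close>.
    Multiplied by \<open>u\<close> it gives \<open>r l\<close>, so the first component of the
    product below is \<open>r l + N z w\<close>.\<close>
  define u1 u2 where "u1 = (x + \<tau> * y) * l1 + y * l2" and "u2 = (x + \<tau> * y) * l2 + l1 * y + \<tau> * y * l2"
  have "N u1 u2 = r" using N_mult[of "x + \<tau> * y" l1 y l2] N_conj N l by (simp add: u1_def u2_def)
  then have "E u1 u2 z w \<in> H" using rotate[OF H C B N(1) _ N(2)] by blast
  then have "E x y z w ** E u1 u2 z w \<in> H" using SL2_subgroup_mult[OF H] B by blast
  then obtain p3 p4 where "E (x * u1 + y * u2 + z * z + \<tau> * z * w + w * w) (x * u2 + u1 * y + \<tau> * y * u2 + z * w + w * z) p3 p4 \<in> H"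
    unfolding E_mult by blast
  moreover have "x * u1 + y * u2 + z * z + \<tau> * z * w + w * w = N x y * l1 + N z w"
    unfolding u1_def u2_def N_def by (simp add: poly2)
  moreover have "x * u2 + u1 * y + \<tau> * y * u2 + z * w + w * z = N x y * l2"
    unfolding u1_def u2_def N_def by (simp add: poly2)
  ultimately have P: "E (r * l1 + (1 + r)) (r * l2) p3 p4 \<in> H" by (simp add: N det)
  have "N (r * l1 + (1 + r)) (r * l2) = r * r * N l1 l2 + (1 + r) * (1 + r) + r * (1 + r) * (\<tau> * l2)"
    unfolding N_def by (simp add: poly2)
  also have "\<dots> = ?n" unfolding l(1) by (simp add: poly2)
  finally have nP: "N (r * l1 + (1 + r)) (r * l2) = ?n" .
  have n0: "?n \<noteq> 0" using l(2) AS_0 by metis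
  \<comment> \<open>The second coordinate \<open>\<alpha> / \<tau>\<close> gives trace
    \<open>\<alpha>\<close>. With first coordinate \<open>v\<close> the norm is
    \<open>v * v + \<alpha> * v\<close> plus this constant; as \<open>?n\<close> lies outside
    \<open>AS\<close> too, some \<open>v\<close> attains it.\<close>
  have "\<alpha> / \<tau> * (\<alpha> / \<tau>) \<notin> AS"
  proof
    assume "\<alpha> / \<tau> * (\<alpha> / \<tau>) \<in> AS"
    then obtain v where v: "v * v + \<alpha> * v = \<alpha> / \<tau> * (\<alpha> / \<tau>)" by (auto simp: AS_def)
    have "(v * \<tau> / \<alpha>) * (v * \<tau> / \<alpha>) + \<tau> * (v * \<tau> / \<alpha>) = (v * v + \<alpha> * v) * (\<tau> / \<alpha> * (\<tau> / \<alpha>))"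
      using trace_nz by (simp add: distrib_left distrib_right add_divide_distrib mult.commute mult.left_commute)
    also have "\<dots> = 1" unfolding v using trace_nz by simp
    finally show False using \<tau>_irreducible[of "v * \<tau> / \<alpha>"] by simp
  qed
  then obtain v where v: "?n + \<alpha> / \<tau> * (\<alpha> / \<tau>) = v * v + \<alpha> * v"
    using AS_not_add[OF l(2)] by (auto simp: AS_def)
  have "N v (\<alpha> / \<tau>) = (v * v + \<alpha> * v) + \<alpha> / \<tau> * (\<alpha> / \<tau>)"
    using trace_nz by (simp add: N_def mult.commute)
  also have "\<dots> = ?n" unfolding v[symmetric] by (simp only: add.assoc dbl add_0_right)
  finally have "E v (\<alpha> / \<tau>) p3 p4 \<in> H" using rotate[OF H C P nP _ n0] by blast
  then show ?thesis
    by (rule SL2_eq_if_conj_L_and_C[OF H C]) (use trace_nz in \<open>simp add: trace_E\<close>)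
qed

text \<open>No member of the triple has order \<open>q - 1\<close>; the matrices \<open>E\<close>
  were introduced for this case.\<close>

lemma gen_traces_\<tau>: "gen_traces \<tau> \<tau> \<tau>"
proof -
  obtain s where s: "s * s = 1 + \<tau>" by (rule sqrt_exists)
  \<comment> \<open>The coordinate \<open>1\<close> gives \<open>B\<close> trace
    \<open>\<tau>\<close>, \<open>1 + \<tau>\<close> does the same for the product with
    \<open>C\<close>, and \<open>s\<close> corrects the determinant.\<close>
  define B where "B = E (1 + \<tau>) 1 s 0"
  have N1: "N (1 + \<tau>) 1 = \<tau>" unfolding N_def by (simp add: poly2)
  have "N s 0 = 1 + \<tau>" using s by (simp add: N_def)
  then have B: "B \<in> carrier G" using N1 by (simp add: B_def det_E two_eq_0)
  let ?H = "generate G {E 0 1 0 0, B}"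
  have H: "subgroup ?H G" using ord_C(1) B by (intro G.generate_is_subgroup) auto
  have C_in: "E 0 1 0 0 \<in> ?H" and "B \<in> ?H" by (auto intro: generate.incl)
  then have B_in: "E (1 + \<tau>) 1 s 0 \<in> ?H" unfolding B_def by simp
  have "?H = carrier G"
    by (rule SL2_eq_if_nonsplit[OF H C_in B_in N1 trace_nz(2) \<tau>_ne_1])
  then have "generating_pair G (E 0 1 0 0) B" using ord_C(1) B by (simp add: generating_pair_def)
  moreover have "trace (E 0 1 0 0 ** B) = \<tau>" unfolding B_def E_mult trace_E by (simp add: two_eq_0)
  ultimately show ?thesis unfolding gen_traces_def by (metis B_def trace_E mult_1_right)
qed

end

section \<open>Realization of the type lists\<close>

context even_field_elements
begin

sublocale G: L2_like G q
proof -
  interpret simple_group G by (rule simple_G)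
  show "L2_like G q"
  proof unfold_locales
    show "\<exists>a\<in>carrier G. \<exists>b\<in>carrier G. a \<otimes>\<^bsub>G\<^esub> b \<noteq> b \<otimes>\<^bsub>G\<^esub> a"
      by (intro bexI[of _ "mat2 1 1 0 1"] bexI[of _ "mat2 1 0 1 1"]) simp_all
    show "even q" using coprime_orders(3) q_ge_4 by auto
  qed (use q_ge_4 SL2_exponent generating_pair_inverted in auto)
qed

lemma ord_by_trace:
  "\<lbrakk>A \<in> carrier G; A \<noteq> mat 1; trace A = \<alpha>\<rbrakk> \<Longrightarrow> G.ord A = type_order q 1"
  "\<lbrakk>A \<in> carrier G; A \<noteq> mat 1; trace A = \<tau>\<rbrakk> \<Longrightarrow> G.ord A = type_order q 2"
  "\<lbrakk>A \<in> carrier G; A \<noteq> mat 1; trace A = \<tau> * \<tau>\<rbrakk> \<Longrightarrow> G.ord A = type_order q 2"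
  "\<lbrakk>A \<in> carrier G; A \<noteq> mat 1; trace A = 0\<rbrakk> \<Longrightarrow> G.ord A = type_order q 0"
  by (simp_all add: type_order_def ord_\<alpha> ord_\<tau> ord_\<tau>2 ord_0)

definition tr :: "nat \<Rightarrow> 'f" where
  "tr t = (if t = 0 then 0 else if t = 1 then \<alpha> else \<tau>)"

text \<open>Type \<open>2\<close> admits the trace \<open>\<tau> * \<tau>\<close> besides
  \<open>\<tau>\<close>, as squaring preserves odd orders. This supplies the second pair of type
  \<open>[1,2,2]\<close>.\<close>

lemma realizes_if_traces:
  assumes gen: "generating_pair G A B"
    and t: "trace A \<in> {tr a, if a = 2 then \<tau> * \<tau> else tr a}" "trace B \<in> {tr b, if b = 2 then \<tau> * \<tau> else tr b}"
      "trace (A ** B) \<in> {tr c, if c = 2 then \<tau> * \<tau> else tr c}"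
    and abc: "a \<in> {0, 1, 2}" "b \<in> {0, 1, 2}" "c \<in> {0, 1, 2}"
  shows "realizes G q [a, b, c] A B"
proof -
  have AB: "A \<in> carrier G" "B \<in> carrier G" "A ** B \<in> carrier G"
    using gen by (auto simp: generating_pair_def det_mul)
  note ne = G.generating_pair_ne_one[OF gen, unfolded SL2_simps]
  have *: "G.ord X = type_order q e"
    if "X \<in> carrier G" "X \<noteq> mat 1" "trace X \<in> {tr e, if e = 2 then \<tau> * \<tau> else tr e}" "e \<in> {0, 1, 2}" for X e
    using that(3,4) ord_by_trace[OF that(1,2)] by (auto simp: tr_def split: if_splits)
  show ?thesis
    using gen *[OF AB(1) ne(1) t(1) abc(1)] *[OF AB(2) ne(2) t(2) abc(2)] *[OF AB(3) ne(3) t(3) abc(3)]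
    by (simp add: realizes_def triple_def)
qed

lemma realizes_if_gen_traces:
  assumes "gen_traces (tr a) (tr b) (tr c)" "a \<in> {0, 1, 2}" "b \<in> {0, 1, 2}" "c \<in> {0, 1, 2}"
  shows "\<exists>x y. realizes G q [a, b, c] x y"
  using assms realizes_if_traces unfolding gen_traces_def by (metis insertI1)

lemma gen_traces_list:
  "gen_traces \<alpha> 0 \<tau>" "gen_traces \<alpha> \<tau> 0" "gen_traces 0 \<alpha> \<tau>" "gen_traces \<tau> \<alpha> 0" "gen_traces 0 \<tau> \<alpha>"
  "gen_traces \<alpha> \<alpha> \<tau>" "gen_traces \<tau> \<alpha> \<alpha>" "gen_traces \<alpha> \<tau> \<alpha>" "gen_traces \<alpha> \<tau> \<tau>" "gen_traces \<tau> \<tau> \<alpha>"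
  "gen_traces \<alpha> \<tau> (\<tau> * \<tau>)"
proof -
  have ne: "\<alpha> * \<alpha> + \<tau> * \<tau> \<noteq> 0" using trace_distinct square_inj by simp
  show 1: "gen_traces \<alpha> 0 \<tau>" by (rule gen_traces_\<alpha>) (use ne trace_nz in simp_all)
  show 2: "gen_traces \<alpha> \<tau> 0" by (rule gen_traces_\<alpha>) (use ne trace_nz in simp_all)
  show 3: "gen_traces 0 \<alpha> \<tau>" by (rule gen_traces_swap[OF 1])
  show 4: "gen_traces \<tau> \<alpha> 0" by (rule gen_traces_swap[OF 2])
  show 5: "gen_traces 0 \<tau> \<alpha>" by (rule gen_traces_rot[OF 2])
  \<comment> \<open>Here and below the commutator expression factors, and the inequalities between
    traces make each factor nonzero.\<close>
  have "\<alpha> * \<alpha> + \<alpha> * \<alpha> + \<tau> * \<tau> + \<alpha> * \<alpha> * \<tau> = \<tau> * (\<tau> + \<alpha> * \<alpha>)" by (simp only: ring2)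
  then show 6: "gen_traces \<alpha> \<alpha> \<tau>" by (intro gen_traces_\<alpha>) (use trace_distinct trace_nz in simp_all)
  show 7: "gen_traces \<tau> \<alpha> \<alpha>" by (rule gen_traces_rot[OF 6])
  show 8: "gen_traces \<alpha> \<tau> \<alpha>" by (rule gen_traces_swap[OF 7])
  have "\<alpha> * \<alpha> + \<tau> * \<tau> + \<tau> * \<tau> + \<alpha> * \<tau> * \<tau> = \<alpha> * (\<alpha> + \<tau> * \<tau>)" by (simp only: ring2)
  then show 9: "gen_traces \<alpha> \<tau> \<tau>" by (intro gen_traces_\<alpha>) (use trace_distinct trace_nz in simp_all)
  show 10: "gen_traces \<tau> \<tau> \<alpha>" by (rule gen_traces_rot[OF 9])
  have "\<alpha> * \<alpha> + \<tau> * \<tau> + \<tau> * \<tau> * (\<tau> * \<tau>) + \<alpha> * \<tau> * (\<tau> * \<tau>) = (\<alpha> + \<tau>) * (\<alpha> + (\<tau> * \<tau> * \<tau> + \<tau>))"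
    by (simp only: ring2)
  moreover have "\<dots> \<noteq> 0" using trace_distinct(1) \<alpha>_ne_cube by simp
  ultimately show 11: "gen_traces \<alpha> \<tau> (\<tau> * \<tau>)" by (intro gen_traces_\<alpha>) (use trace_nz in simp_all)
qed

lemma purely_strongly_real_iso:
  assumes H: "group H" and h: "h \<in> iso G H" and k: "k > 0" "(q, k) \<noteq> (4, 1)"
    and P: "generating_pair (direct_power H k) P R"
  shows "purely_strongly_real_Beauville_group (direct_power H k)"
proof -
  interpret H: L2_like H q by (rule G.L2_like_image[OF H h])
  interpret h: group_hom G H h using h by unfold_locales (simp add: iso_def)
  have img: "\<exists>x y. realizes H q T x y" if "\<exists>x y. realizes G q T x y" for T
    using that h.realizes_image[OF h] by blast
  have real: "\<exists>x y. realizes G q [a, b, c] x y" if "gen_traces (tr a) (tr b) (tr c)" "{a, b, c} \<subseteq> {0, 1, 2}" for a b c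
    using realizes_if_gen_traces[OF that(1)] that(2) by simp
  obtain A B where AB: "generating_pair G A B" "trace A = \<alpha>" "trace B = \<tau>" "trace (A ** B) = \<tau>"
    using gen_traces_list(9) unfolding gen_traces_def by blast
  obtain A' B' where AB': "generating_pair G A' B'" "trace A' = \<alpha>" "trace B' = \<tau>" "trace (A' ** B') = \<tau> * \<tau>"
    using gen_traces_list(11) unfolding gen_traces_def by blast
  have c: "A \<in> carrier G" "B \<in> carrier G" "A ** B \<in> carrier G" "A' \<in> carrier G" "B' \<in> carrier G" "A' ** B' \<in> carrier G"
    using AB AB' by (auto simp: generating_pair_def det_mul)
  note ne = G.generating_pair_ne_one[OF AB(1), unfolded SL2_simps]
  have r: "realizes G q [1,2,2] A B" by (rule realizes_if_traces[OF AB(1)]) (use AB in \<open>simp_all add: tr_def\<close>)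
  have r': "realizes G q [1,2,2] A' B'" by (rule realizes_if_traces[OF AB'(1)]) (use AB' in \<open>simp_all add: tr_def\<close>)
  \<comment> \<open>Equal traces make \<open>A ** B\<close> and \<open>B\<close> conjugate; in the
    other pair \<open>\<tau> * \<tau> \<noteq> \<tau>\<close> forbids this.\<close>
  obtain g where g: "g \<in> carrier G" "A ** B = conj_by G B g"
    by (rule conj_same_trace[OF c(2,3) ne(2,3)]) (use AB in simp_all)
  show ?thesis
  proof (rule H.purely_strongly_real_direct_power[OF k P])
    show "\<exists>x y. realizes H q T x y"
      if "T \<in> {[2,1,0], [2,1,1], [1,0,2], [0,1,2], [1,2,2], [0,2,1], [2,2,1], [1,2,1], [2,2,2], [1,1,2]}" for T
      using that by (auto intro!: img real simp: tr_def gen_traces_list gen_traces_\<tau>)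
    show "\<exists>x y. realizes H q [1,1,1] x y" if "q > 4"
    proof (intro img real)
      have "\<alpha> * \<alpha> + \<alpha> * \<alpha> + \<alpha> * \<alpha> + \<alpha> * \<alpha> * \<alpha> = \<alpha> * \<alpha> * (1 + \<alpha>)" by (simp only: ring2)
      also have "\<dots> \<noteq> 0" using \<alpha>_ne_1[OF that] trace_nz by auto
      finally have "gen_traces \<alpha> \<alpha> \<alpha>" by (rule gen_traces_\<alpha>) (use trace_nz in simp)
      then show "gen_traces (tr 1) (tr 1) (tr 1)" by (simp add: tr_def)
    qed simp
    show "realizes H q [1,2,2] (h A) (h B)" "realizes H q [1,2,2] (h A') (h B')"
      using h.realizes_image[OF h] r r' by blast+
    have "h (A \<otimes>\<^bsub>G\<^esub> B) = conj_by H (h B) (h g)" using g h.hom_conj_by[OF c(2) g(1)] by simp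
    then have "h A \<otimes>\<^bsub>H\<^esub> h B = conj_by H (h B) (h g)" using h.hom_mult[OF c(1,2)] by simp
    then show "\<exists>g\<in>carrier H. h A \<otimes>\<^bsub>H\<^esub> h B = conj_by H (h B) g" using h.hom_closed[OF g(1)] by blast
    show "\<not> (\<exists>g\<in>carrier H. h A' \<otimes>\<^bsub>H\<^esub> h B' = conj_by H (h B') g)"
    proof
      assume "\<exists>g\<in>carrier H. h A' \<otimes>\<^bsub>H\<^esub> h B' = conj_by H (h B') g"
      then obtain g' where g': "g' \<in> carrier H" "h A' \<otimes>\<^bsub>H\<^esub> h B' = conj_by H (h B') g'" by blast
      then have "g' \<in> h ` carrier G" using h by (simp add: Group.iso_iff)
      with g'(2) obtain g where g: "g \<in> carrier G" "h A' \<otimes>\<^bsub>H\<^esub> h B' = conj_by H (h B') (h g)" by auto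
      have "h (A' \<otimes>\<^bsub>G\<^esub> B') = h (conj_by G B' g)"
        using h.hom_conj_by[OF c(5) g(1)] h.hom_mult[OF c(4,5)] g(2) by metis
      moreover have "inj_on h (carrier G)" using h by (simp add: Group.iso_iff)
      ultimately have "A' ** B' = conj_by G B' g"
        using inj_onD[of h "carrier G" "A' \<otimes>\<^bsub>G\<^esub> B'" "conj_by G B' g"] c(6) G.conj_by_closed[OF c(5) g(1)] by simp
      then have "\<tau> * \<tau> = \<tau>" using trace_conj_by[OF c(5) g(1)] AB' by simp
      then show False using trace_nz \<tau>_ne_1 by simp
    qed
  qed
qed

end

theorem proposition3p2:
  fixes q k :: nat
    and L :: "(('f::{field,finite}) ^ 2 ^ 2) set monoid"
  assumes "CARD('f) = q"
    and "L = PSL2"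
    and "q > 2" and "\<exists>n. q = 2 ^ n"
    and "k > 0" and "(q, k) \<noteq> (4, 1)"
    and "\<exists>x y. generating_pair (direct_power L k) x y"
  shows "purely_strongly_real_Beauville_group (direct_power L k)"
proof -
  obtain n where n: "q = 2 ^ n" using assms(4) by blast
  have "n \<noteq> 0" "n \<noteq> 1" using n assms(3) by (intro notI; simp)+
  then have "q \<ge> 2 ^ 2" unfolding n by (intro power_increasing) auto
  then have q4: "q \<ge> 4" by simp
  interpret F: even_field "TYPE('f)" q by unfold_locales (use assms q4 in auto)
  obtain l :: 'f where l: "l \<noteq> 0" "\<And>x. x \<noteq> 0 \<Longrightarrow> \<exists>i. x = l ^ i" "\<And>n. l ^ n = 1 \<longleftrightarrow> (q - 1) dvd n"
    using F.ex_primitive by metis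
  obtain A :: "'f ^ 2 ^ 2" where A: "A \<in> carrier SL2" "group.ord SL2 A = q + 1" by (rule F.ex_ord_Suc_q)
  interpret F: even_field_elements "TYPE('f)" q l "l + 1 / l" "trace A"
    by unfold_locales (use l A in auto)
  let ?S = "SL2 :: ('f ^ 2 ^ 2) monoid" and ?Z = "group_center (SL2 :: ('f ^ 2 ^ 2) monoid)"
  interpret Z: normal ?Z ?S by (rule F.G.normal_group_center)
  \<comment> \<open>A nonabelian simple group has trivial centre, so the quotient map onto
    \<open>PSL2\<close> is an isomorphism.\<close>
  have "?Z \<noteq> carrier ?S"
    using F.G.nonabelian by (auto simp: group_center_def)
  then have Z: "?Z = {\<one>\<^bsub>?S\<^esub>}" using F.G.no_real_normal_subgroup[OF Z.normal_axioms] by blast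
  have "(\<lambda>x. ?Z #>\<^bsub>?S\<^esub> x) \<in> iso ?S L"
    unfolding Group.iso_iff assms(2) PSL2_def
  proof (intro conjI)
    show "(\<lambda>x. ?Z #>\<^bsub>?S\<^esub> x) \<in> hom ?S (?S Mod ?Z)" by (rule Z.r_coset_hom_Mod)
    show "(\<lambda>x. ?Z #>\<^bsub>?S\<^esub> x) ` carrier ?S = carrier (?S Mod ?Z)" by (simp add: carrier_FactGroup)
    show "inj_on (\<lambda>x. ?Z #>\<^bsub>?S\<^esub> x) (carrier ?S)"
      unfolding Z by (rule inj_onI) (simp add: r_coset_def)
  qed
  then show ?thesis
    using F.purely_strongly_real_iso assms group_PSL2 by metis
qed

end
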